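(* Let $k$ be a commutative ring, let $\Omega$ be an infinite set, let $\mathscr{E}\leqslant\Omega^{\Omega}$ be a monoid of self-maps of $\Omega$, and let $\mathscr{C}$ be the associated category of finite subsets of $\Omega$. Then one has equivalences of categories $$k\mathscr{E}\text{-}\mathrm{Mod}^{\mathrm{uc}}\;\simeq\;\mathscr{C}\text{-}\mathrm{Mod}/\mathscr{C}\text{-}\mathrm{Mod}^{\mathrm{tor}}\;\simeq\;\mathrm{Sh}(\mathscr{C}^{\mathrm{op}},J,\underline{k}),$$ where $k\mathscr{E}\text{-}\mathrm{Mod}^{\mathrm{uc}}$ is the category of uniformly continuous $k\mathscr{E}$-modules, $\mathscr{C}\text{-}\mathrm{Mod}^{\mathrm{tor}}$ is the category of torsion $\mathscr{C}$-modules, and $\mathrm{Sh}(\mathscr{C}^{\mathrm{op}},J,\underline{k})$ is the category of sheaves of modules over the constant structure sheaf $\underline{k}$. In particular, if every inclusion morphism $\iota_{A,B}:A\hookrightarrow B$ in $\mathscr{C}$ admits a retraction given by a surjective morphism $p:B\twoheadrightarrow A$ in $\mathscr{C}$, then $J$ is the trivial topology, and hence $\mathscr{C}\text{-}\mathrm{Mod}\simeq k\mathscr{E}\text{-}\mathrm{Mod}^{\mathrm{uc}}$.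
   Context: The category $\mathscr{C}$ has as objects the finite subsets of $\Omega$; a morphism $A\to B$ is a map $f:A\to B$ such that $f=\tilde f|_A$ for some $\tilde f\in\mathscr{E}$. In particular $\mathscr{C}$ contains every inclusion $\iota_{A,B}:A\hookrightarrow B$ for $A\subseteq B$ finite. A $\mathscr{C}$-module is a covariant functor $\mathscr{C}\to k\text{-}\mathrm{Mod}$. A $k\mathscr{E}$-module $M$ is uniformly continuous if for every $v\in M$ there is a finite subset $A_v\subseteq\Omega$ such that for all $h,h'\in\mathscr{E}$, $h|_{A_v}=h'|_{A_v}$ implies $h\cdot v=h'\cdot v$ (equivalently, the action is uniformly continuous for the uniform structure on $\mathscr{E}$ of pointwise convergence and the discrete topology on $M$). A $\mathscr{C}$-module $V$ is torsion if for every object $A$ and every $v\in V(A)$ there is an inclusion $\iota_{A,B}:A\hookrightarrow B$ with $\iota_{A,B}\cdot v=0$. The torsion modules form a localizing subcategory, and $\mathscr{C}\text{-}\mathrm{Mod}/\mathscr{C}\text{-}\mathrm{Mod}^{\mathrm{tor}}$ is the Serre (Gabriel) quotient. The Grothendieck topology $J$ on $\mathscr{C}^{\mathrm{op}}$: a sieve on $A$ in $\mathscr{C}^{\mathrm{op}}$ is a set $S$ of morphisms of $\mathscr{C}$ with source $A$ closed under postcomposition in $\mathscr{C}$; $S$ is covering (i.e. $S\in J(A)$) if it contains an inclusion morphism $\iota_{A,B}$ for some finite $B\supseteq A$. The trivial topology is the one whose only covering sieves are the maximal ones. *)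

theory Defs
  imports "HOL-Algebra.Module" "HOL-Library.Equipollence"
begin

section \<open>Categories, functors, equivalences\<close>

text \<open>
  Composition and identities carry their objects as arguments, and hom-sets need not be
  disjoint: \<^term>\<open>Cmp C X Y Z g f\<close> is the composite of \<^term>\<open>f\<close> from \<^term>\<open>X\<close> to \<^term>\<open>Y\<close>
  followed by \<^term>\<open>g\<close> from \<^term>\<open>Y\<close> to \<^term>\<open>Z\<close>.  Morphisms that are functions are taken
  extensional, so that equality of morphisms is equality on the source.
\<close>

record ('o, 'm) cat =
  Obj :: "'o set"
  Mor :: "'o \<Rightarrow> 'o \<Rightarrow> 'm set"
  Cmp :: "'o \<Rightarrow> 'o \<Rightarrow> 'o \<Rightarrow> 'm \<Rightarrow> 'm \<Rightarrow> 'm"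
  Idn :: "'o \<Rightarrow> 'm"

definition is_category :: "('o, 'm) cat \<Rightarrow> bool" where
  "is_category C \<longleftrightarrow>
     (\<forall>X\<in>Obj C. Idn C X \<in> Mor C X X) \<and>
     (\<forall>X\<in>Obj C. \<forall>Y\<in>Obj C. \<forall>Z\<in>Obj C. \<forall>f\<in>Mor C X Y. \<forall>g\<in>Mor C Y Z.
        Cmp C X Y Z g f \<in> Mor C X Z) \<and>
     (\<forall>X\<in>Obj C. \<forall>Y\<in>Obj C. \<forall>f\<in>Mor C X Y.
        Cmp C X X Y f (Idn C X) = f \<and> Cmp C X Y Y (Idn C Y) f = f) \<and>
     (\<forall>W\<in>Obj C. \<forall>X\<in>Obj C. \<forall>Y\<in>Obj C. \<forall>Z\<in>Obj C.
        \<forall>f\<in>Mor C W X. \<forall>g\<in>Mor C X Y. \<forall>h\<in>Mor C Y Z.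
        Cmp C W Y Z h (Cmp C W X Y g f) = Cmp C W X Z (Cmp C X Y Z h g) f)"

definition op_cat :: "('o, 'm) cat \<Rightarrow> ('o, 'm) cat" where
  "op_cat C = \<lparr>Obj = Obj C, Mor = (\<lambda>X Y. Mor C Y X),
     Cmp = (\<lambda>X Y Z g f. Cmp C Z Y X f g), Idn = Idn C\<rparr>"

definition full_subcategory :: "('o, 'm) cat \<Rightarrow> 'o set \<Rightarrow> ('o, 'm) cat" where
  "full_subcategory C P = C\<lparr>Obj := Obj C \<inter> P\<rparr>"

record ('o, 'm, 'p, 'n) fnctr =
  fobj :: "'o \<Rightarrow> 'p"
  fmap :: "'o \<Rightarrow> 'o \<Rightarrow> 'm \<Rightarrow> 'n"

definition is_functor :: "('o, 'm) cat \<Rightarrow> ('p, 'n) cat \<Rightarrow> ('o, 'm, 'p, 'n) fnctr \<Rightarrow> bool" where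
  "is_functor C D F \<longleftrightarrow>
     (\<forall>X\<in>Obj C. fobj F X \<in> Obj D) \<and>
     (\<forall>X\<in>Obj C. \<forall>Y\<in>Obj C. \<forall>f\<in>Mor C X Y. fmap F X Y f \<in> Mor D (fobj F X) (fobj F Y)) \<and>
     (\<forall>X\<in>Obj C. fmap F X X (Idn C X) = Idn D (fobj F X)) \<and>
     (\<forall>X\<in>Obj C. \<forall>Y\<in>Obj C. \<forall>Z\<in>Obj C. \<forall>f\<in>Mor C X Y. \<forall>g\<in>Mor C Y Z.
        fmap F X Z (Cmp C X Y Z g f) =
        Cmp D (fobj F X) (fobj F Y) (fobj F Z) (fmap F Y Z g) (fmap F X Y f))"

definition id_functor :: "('o, 'm, 'o, 'm) fnctr" where
  "id_functor = \<lparr>fobj = (\<lambda>X. X), fmap = (\<lambda>X Y f. f)\<rparr>"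

definition comp_functor ::
  "('p, 'n, 'q, 'l) fnctr \<Rightarrow> ('o, 'm, 'p, 'n) fnctr \<Rightarrow> ('o, 'm, 'q, 'l) fnctr" where
  "comp_functor G F = \<lparr>fobj = (\<lambda>X. fobj G (fobj F X)),
     fmap = (\<lambda>X Y f. fmap G (fobj F X) (fobj F Y) (fmap F X Y f))\<rparr>"

definition nat_trans :: "('o, 'm) cat \<Rightarrow> ('p, 'n) cat \<Rightarrow>
    ('o, 'm, 'p, 'n) fnctr \<Rightarrow> ('o, 'm, 'p, 'n) fnctr \<Rightarrow> ('o \<Rightarrow> 'n) set" where
  "nat_trans C D F G =
     {\<eta> \<in> extensional (Obj C).
        (\<forall>X\<in>Obj C. \<eta> X \<in> Mor D (fobj F X) (fobj G X)) \<and>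
        (\<forall>X\<in>Obj C. \<forall>Y\<in>Obj C. \<forall>f\<in>Mor C X Y.
           Cmp D (fobj F X) (fobj F Y) (fobj G Y) (\<eta> Y) (fmap F X Y f) =
           Cmp D (fobj F X) (fobj G X) (fobj G Y) (fmap G X Y f) (\<eta> X))}"

definition functor_category ::
  "('o, 'm) cat \<Rightarrow> ('p, 'n) cat \<Rightarrow> (('o, 'm, 'p, 'n) fnctr, 'o \<Rightarrow> 'n) cat" where
  "functor_category C D =
     \<lparr>Obj = {F. is_functor C D F},
      Mor = nat_trans C D,
      Cmp = (\<lambda>F G H \<beta> \<alpha>. \<lambda>X\<in>Obj C. Cmp D (fobj F X) (fobj G X) (fobj H X) (\<beta> X) (\<alpha> X)),
      Idn = (\<lambda>F. \<lambda>X\<in>Obj C. Idn D (fobj F X))\<rparr>"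

definition is_iso :: "('o, 'm) cat \<Rightarrow> 'o \<Rightarrow> 'o \<Rightarrow> 'm \<Rightarrow> bool" where
  "is_iso C X Y f \<longleftrightarrow> f \<in> Mor C X Y \<and>
     (\<exists>g\<in>Mor C Y X. Cmp C X Y X g f = Idn C X \<and> Cmp C Y X Y f g = Idn C Y)"

definition nat_isomorphic :: "('o, 'm) cat \<Rightarrow> ('p, 'n) cat \<Rightarrow>
    ('o, 'm, 'p, 'n) fnctr \<Rightarrow> ('o, 'm, 'p, 'n) fnctr \<Rightarrow> bool" where
  "nat_isomorphic C D F G \<longleftrightarrow>
     (\<exists>\<eta>\<in>nat_trans C D F G. \<forall>X\<in>Obj C. is_iso D (fobj F X) (fobj G X) (\<eta> X))"

definition equivalent_categories :: "('o, 'm) cat \<Rightarrow> ('p, 'n) cat \<Rightarrow> bool"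
    (infix \<open>\<simeq>\<^sub>c\<^sub>a\<^sub>t\<close> 50) where
  "C \<simeq>\<^sub>c\<^sub>a\<^sub>t D \<longleftrightarrow> is_category C \<and> is_category D \<and>
     (\<exists>F G. is_functor C D F \<and> is_functor D C G \<and>
        nat_isomorphic C C (comp_functor G F) id_functor \<and>
        nat_isomorphic D D (comp_functor F G) id_functor)"


section \<open>Serre quotients\<close>

definition zero_object :: "('o, 'm) cat \<Rightarrow> 'o \<Rightarrow> bool" where
  "zero_object C Z \<longleftrightarrow> Z \<in> Obj C \<and>
     (\<forall>X\<in>Obj C. (\<exists>!f. f \<in> Mor C X Z) \<and> (\<exists>!f. f \<in> Mor C Z X))"

definition zero_morphism :: "('o, 'm) cat \<Rightarrow> 'o \<Rightarrow> 'o \<Rightarrow> 'm \<Rightarrow> bool" where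
  "zero_morphism C X Y f \<longleftrightarrow>
     (\<exists>Z. zero_object C Z \<and> (\<exists>a\<in>Mor C X Z. \<exists>b\<in>Mor C Z Y. f = Cmp C X Z Y b a))"

definition is_kernel :: "('o, 'm) cat \<Rightarrow> 'o \<Rightarrow> 'o \<Rightarrow> 'm \<Rightarrow> 'o \<Rightarrow> 'm \<Rightarrow> bool" where
  "is_kernel C X Y f K i \<longleftrightarrow> K \<in> Obj C \<and> i \<in> Mor C K X \<and>
     zero_morphism C K Y (Cmp C K X Y f i) \<and>
     (\<forall>W\<in>Obj C. \<forall>g\<in>Mor C W X. zero_morphism C W Y (Cmp C W X Y f g) \<longrightarrow>
        (\<exists>!u. u \<in> Mor C W K \<and> Cmp C W K X i u = g))"

definition is_cokernel :: "('o, 'm) cat \<Rightarrow> 'o \<Rightarrow> 'o \<Rightarrow> 'm \<Rightarrow> 'o \<Rightarrow> 'm \<Rightarrow> bool" where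
  "is_cokernel C X Y f Q p \<longleftrightarrow> is_kernel (op_cat C) Y X f Q p"

text \<open>
  Localization \<open>C[W\<^sup>-\<^sup>1]\<close> by right fractions: a morphism from \<open>X\<close> to \<open>Y\<close> is a class of roofs
  \<open>X \<leftarrow> U \<rightarrow> Y\<close> whose leg \<open>U \<rightarrow> X\<close> belongs to \<open>W\<close>.  Two roofs are identified when some roof
  maps to both, compatibly with the legs, with its left leg in \<open>W\<close>; roofs are composed
  by completing \<open>U \<rightarrow> Y \<leftarrow> V\<close> to a commutative square with \<open>T \<rightarrow> U\<close> in \<open>W\<close>.  The definition is
  the usual one provided \<open>W\<close> admits a calculus of right fractions.
\<close>

definition roofs :: "('o, 'm) cat \<Rightarrow> ('o \<Rightarrow> 'o \<Rightarrow> 'm set) \<Rightarrow> 'o \<Rightarrow> 'o \<Rightarrow> ('o \<times> 'm \<times> 'm) set" where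
  "roofs C W X Y = {(U, s, f). U \<in> Obj C \<and> s \<in> W U X \<and> f \<in> Mor C U Y}"

definition roof_rel :: "('o, 'm) cat \<Rightarrow> ('o \<Rightarrow> 'o \<Rightarrow> 'm set) \<Rightarrow> 'o \<Rightarrow> 'o \<Rightarrow>
    (('o \<times> 'm \<times> 'm) \<times> ('o \<times> 'm \<times> 'm)) set" where
  "roof_rel C W X Y =
     {((U, s, f), (V, t, g)). (U, s, f) \<in> roofs C W X Y \<and> (V, t, g) \<in> roofs C W X Y \<and>
        (\<exists>T\<in>Obj C. \<exists>a\<in>Mor C T U. \<exists>b\<in>Mor C T V.
           Cmp C T U X s a = Cmp C T V X t b \<and> Cmp C T U X s a \<in> W T X \<and>
           Cmp C T U Y f a = Cmp C T V Y g b)}"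

definition roof_composites :: "('o, 'm) cat \<Rightarrow> ('o \<Rightarrow> 'o \<Rightarrow> 'm set) \<Rightarrow> 'o \<Rightarrow> 'o \<Rightarrow> 'o \<Rightarrow>
    ('o \<times> 'm \<times> 'm) set \<Rightarrow> ('o \<times> 'm \<times> 'm) set \<Rightarrow> ('o \<times> 'm \<times> 'm) set" where
  "roof_composites C W X Y Z \<beta> \<alpha> =
     {(T, Cmp C T U X s t', Cmp C T V Z g f') | T U V s t' g f'.
        \<exists>f t. (U, s, f) \<in> \<alpha> \<and> (V, t, g) \<in> \<beta> \<and> T \<in> Obj C \<and> t' \<in> W T U \<and> f' \<in> Mor C T V \<and>
          Cmp C T U Y f t' = Cmp C T V Y t f'}"

definition localization ::
  "('o, 'm) cat \<Rightarrow> ('o \<Rightarrow> 'o \<Rightarrow> 'm set) \<Rightarrow> ('o, ('o \<times> 'm \<times> 'm) set) cat" where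
  "localization C W =
     \<lparr>Obj = Obj C,
      Mor = (\<lambda>X Y. roofs C W X Y // roof_rel C W X Y),
      Cmp = (\<lambda>X Y Z \<beta> \<alpha>. roof_rel C W X Z `` roof_composites C W X Y Z \<beta> \<alpha>),
      Idn = (\<lambda>X. roof_rel C W X X `` {(X, Idn C X, Idn C X)})\<rparr>"

text \<open>
  The Serre quotient of an abelian category by a Serre subcategory, given by its set of
  objects \<open>T\<close>: invert the morphisms whose kernel and cokernel lie in \<open>T\<close>.
\<close>

definition iso_modulo :: "('o, 'm) cat \<Rightarrow> 'o set \<Rightarrow> 'o \<Rightarrow> 'o \<Rightarrow> 'm set" where
  "iso_modulo C T X Y = {s \<in> Mor C X Y.
     (\<exists>K\<in>T. \<exists>i. is_kernel C X Y s K i) \<and> (\<exists>Q\<in>T. \<exists>p. is_cokernel C X Y s Q p)}"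

definition serre_quotient :: "('o, 'm) cat \<Rightarrow> 'o set \<Rightarrow> ('o, ('o \<times> 'm \<times> 'm) set) cat" where
  "serre_quotient C T = localization C (iso_modulo C T)"


section \<open>Modules\<close>

text \<open>
  The library's \<^locale>\<open>module\<close> requires a commutative ring of scalars; its module axioms
  proper make sense over any ring, which is needed for monoid algebras.
\<close>

definition left_module :: "'k ring \<Rightarrow> ('k, 'u) module \<Rightarrow> bool" where
  "left_module S M \<longleftrightarrow> ring S \<and> abelian_group M \<and> module_axioms S M"

lemma left_module_iff_module: "cring S \<Longrightarrow> left_module S M \<longleftrightarrow> module S M"
  by (auto simp: left_module_def module_def cring.axioms)

definition linear_maps :: "'k ring \<Rightarrow> ('k, 'u) module \<Rightarrow> ('k, 'u) module \<Rightarrow> ('u \<Rightarrow> 'u) set" where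
  "linear_maps S M N = {f \<in> carrier M \<rightarrow>\<^sub>E carrier N.
     (\<forall>x\<in>carrier M. \<forall>y\<in>carrier M. f (x \<oplus>\<^bsub>M\<^esub> y) = f x \<oplus>\<^bsub>N\<^esub> f y) \<and>
     (\<forall>a\<in>carrier S. \<forall>x\<in>carrier M. f (a \<odot>\<^bsub>M\<^esub> x) = a \<odot>\<^bsub>N\<^esub> f x)}"

text \<open>
  The type \<open>'u\<close> is the universe: the objects are the left \<open>S\<close>-modules with carrier in \<open>'u\<close>.
\<close>

definition module_category :: "'k ring \<Rightarrow> (('k, 'u) module, 'u \<Rightarrow> 'u) cat" where
  "module_category S =
     \<lparr>Obj = {M. left_module S M},
      Mor = linear_maps S,
      Cmp = (\<lambda>M N P g f. compose (carrier M) g f),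
      Idn = (\<lambda>M. \<lambda>x\<in>carrier M. x)\<rparr>"

text \<open>
  The monoid algebra: finitely supported functions from the monoid to the ring, with
  the convolution product.
\<close>

definition monoid_algebra :: "'k ring \<Rightarrow> 'g monoid \<Rightarrow> ('g \<Rightarrow> 'k) ring" where
  "monoid_algebra R G =
     \<lparr>carrier = {a. (\<forall>g. a g \<in> carrier R) \<and> finite {g. a g \<noteq> \<zero>\<^bsub>R\<^esub>} \<and>
                    {g. a g \<noteq> \<zero>\<^bsub>R\<^esub>} \<subseteq> carrier G},
      mult = (\<lambda>a b h. finsum R (\<lambda>(f, g). a f \<otimes>\<^bsub>R\<^esub> b g)
                 {(f, g). a f \<noteq> \<zero>\<^bsub>R\<^esub> \<and> b g \<noteq> \<zero>\<^bsub>R\<^esub> \<and> f \<otimes>\<^bsub>G\<^esub> g = h}),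
      one = (\<lambda>h. if h = \<one>\<^bsub>G\<^esub> then \<one>\<^bsub>R\<^esub> else \<zero>\<^bsub>R\<^esub>),
      zero = (\<lambda>h. \<zero>\<^bsub>R\<^esub>),
      add = (\<lambda>a b h. a h \<oplus>\<^bsub>R\<^esub> b h)\<rparr>"

definition basis_element :: "'k ring \<Rightarrow> 'g \<Rightarrow> ('g \<Rightarrow> 'k)" where
  "basis_element R g = (\<lambda>h. if h = g then \<one>\<^bsub>R\<^esub> else \<zero>\<^bsub>R\<^esub>)"


section \<open>Uniformly continuous modules over a monoid of self-maps\<close>

text \<open>The set \<open>\<Omega>\<close> is the type \<open>'w\<close>.\<close>

definition full_transformation_monoid :: "('w \<Rightarrow> 'w) monoid" where
  "full_transformation_monoid = \<lparr>carrier = UNIV, mult = (\<circ>), one = id\<rparr>"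

definition kE :: "'k ring \<Rightarrow> ('w \<Rightarrow> 'w) set \<Rightarrow> (('w \<Rightarrow> 'w) \<Rightarrow> 'k) ring" where
  "kE R E = monoid_algebra R (full_transformation_monoid\<lparr>carrier := E\<rparr>)"

definition uniformly_continuous ::
  "'k ring \<Rightarrow> ('w \<Rightarrow> 'w) set \<Rightarrow> (('w \<Rightarrow> 'w) \<Rightarrow> 'k, 'u) module \<Rightarrow> bool" where
  "uniformly_continuous R E M \<longleftrightarrow>
     (\<forall>v\<in>carrier M. \<exists>A. finite A \<and>
        (\<forall>h\<in>E. \<forall>h'\<in>E. restrict h A = restrict h' A \<longrightarrow>
           basis_element R h \<odot>\<^bsub>M\<^esub> v = basis_element R h' \<odot>\<^bsub>M\<^esub> v))"

definition uc_modules :: "'k ring \<Rightarrow> ('w \<Rightarrow> 'w) set \<Rightarrow>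
    ((('w \<Rightarrow> 'w) \<Rightarrow> 'k, 'u) module, 'u \<Rightarrow> 'u) cat" where
  "uc_modules R E = full_subcategory (module_category (kE R E)) {M. uniformly_continuous R E M}"


section \<open>The category of finite subsets and its modules\<close>

text \<open>
  The parameter \<open>Fin\<close> is the set of objects: all finite subsets of \<open>\<Omega>\<close>, or all nonempty
  ones.  The second convention matters when retractions of inclusions are considered,
  since the inclusion of the empty set into a nonempty set never has a retraction.
\<close>

definition finset_category ::
  "'w set set \<Rightarrow> ('w \<Rightarrow> 'w) set \<Rightarrow> ('w set, 'w \<Rightarrow> 'w) cat" where
  "finset_category Fin E =
     \<lparr>Obj = Fin,
      Mor = (\<lambda>A B. {f \<in> A \<rightarrow>\<^sub>E B. \<exists>h\<in>E. f = restrict h A}),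
      Cmp = (\<lambda>A B D g f. compose A g f),
      Idn = (\<lambda>A. \<lambda>x\<in>A. x)\<rparr>"

definition incl :: "'w set \<Rightarrow> 'w set \<Rightarrow> ('w \<Rightarrow> 'w)" where
  "incl A B = (\<lambda>x\<in>A. x)"

type_synonym ('w, 'k, 'u) cmod = "('w set, 'w \<Rightarrow> 'w, ('k, 'u) module, 'u \<Rightarrow> 'u) fnctr"

definition C_modules :: "'k ring \<Rightarrow> 'w set set \<Rightarrow> ('w \<Rightarrow> 'w) set \<Rightarrow>
    (('w, 'k, 'u) cmod, 'w set \<Rightarrow> 'u \<Rightarrow> 'u) cat" where
  "C_modules R Fin E = functor_category (finset_category Fin E) (module_category R)"

definition torsion_modules ::
  "'k ring \<Rightarrow> 'w set set \<Rightarrow> ('w \<Rightarrow> 'w) set \<Rightarrow> ('w, 'k, 'u) cmod set" where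
  "torsion_modules R Fin E = {V \<in> Obj (C_modules R Fin E).
     \<forall>A\<in>Fin. \<forall>v\<in>carrier (fobj V A). \<exists>B\<in>Fin. A \<subseteq> B \<and>
        fmap V A B (incl A B) v = \<zero>\<^bsub>fobj V B\<^esub>}"


section \<open>Sites and sheaves of modules\<close>

text \<open>A morphism in a sieve is recorded together with its source.\<close>

definition sieve :: "('o, 'm) cat \<Rightarrow> 'o \<Rightarrow> ('o \<times> 'm) set \<Rightarrow> bool" where
  "sieve D X S \<longleftrightarrow> X \<in> Obj D \<and> S \<subseteq> {(Y, f). Y \<in> Obj D \<and> f \<in> Mor D Y X} \<and>
     (\<forall>(Y, f)\<in>S. \<forall>Z\<in>Obj D. \<forall>g\<in>Mor D Z Y. (Z, Cmp D Z Y X f g) \<in> S)"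

definition maximal_sieve :: "('o, 'm) cat \<Rightarrow> 'o \<Rightarrow> ('o \<times> 'm) set" where
  "maximal_sieve D X = {(Y, f). Y \<in> Obj D \<and> f \<in> Mor D Y X}"

definition pullback_sieve ::
  "('o, 'm) cat \<Rightarrow> 'o \<Rightarrow> 'o \<Rightarrow> 'm \<Rightarrow> ('o \<times> 'm) set \<Rightarrow> ('o \<times> 'm) set" where
  "pullback_sieve D Y X f S = {(Z, g). Z \<in> Obj D \<and> g \<in> Mor D Z Y \<and> (Z, Cmp D Z Y X f g) \<in> S}"

definition grothendieck_topology :: "('o, 'm) cat \<Rightarrow> ('o \<Rightarrow> ('o \<times> 'm) set set) \<Rightarrow> bool" where
  "grothendieck_topology D J \<longleftrightarrow>
     (\<forall>X\<in>Obj D. \<forall>S\<in>J X. sieve D X S) \<and>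
     (\<forall>X\<in>Obj D. maximal_sieve D X \<in> J X) \<and>
     (\<forall>X\<in>Obj D. \<forall>Y\<in>Obj D. \<forall>f\<in>Mor D Y X. \<forall>S\<in>J X. pullback_sieve D Y X f S \<in> J Y) \<and>
     (\<forall>X\<in>Obj D. \<forall>S\<in>J X. \<forall>S'. sieve D X S' \<longrightarrow>
        (\<forall>(Y, f)\<in>S. pullback_sieve D Y X f S' \<in> J Y) \<longrightarrow> S' \<in> J X)"

definition trivial_topology :: "('o, 'm) cat \<Rightarrow> 'o \<Rightarrow> ('o \<times> 'm) set set" where
  "trivial_topology D X = (if X \<in> Obj D then {maximal_sieve D X} else {})"

text \<open>
  Presheaves on \<open>D\<close> are functors on \<^term>\<open>op_cat D\<close>: for \<open>f : Y \<rightarrow> X\<close> in \<open>D\<close>, the restriction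
  map from the sections over \<open>X\<close> to those over \<open>Y\<close> is \<open>res X Y f\<close>.
\<close>

definition matching_family :: "('o, 'm) cat \<Rightarrow> ('o \<Rightarrow> 'x set) \<Rightarrow>
    ('o \<Rightarrow> 'o \<Rightarrow> 'm \<Rightarrow> 'x \<Rightarrow> 'x) \<Rightarrow> 'o \<Rightarrow> ('o \<times> 'm) set \<Rightarrow> ('o \<times> 'm \<Rightarrow> 'x) \<Rightarrow> bool" where
  "matching_family D sec res X S x \<longleftrightarrow>
     (\<forall>(Y, f)\<in>S. x (Y, f) \<in> sec Y \<and>
        (\<forall>Z\<in>Obj D. \<forall>g\<in>Mor D Z Y. res Y Z g (x (Y, f)) = x (Z, Cmp D Z Y X f g)))"

definition sheaf_condition :: "('o, 'm) cat \<Rightarrow> ('o \<Rightarrow> ('o \<times> 'm) set set) \<Rightarrow>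
    ('o \<Rightarrow> 'x set) \<Rightarrow> ('o \<Rightarrow> 'o \<Rightarrow> 'm \<Rightarrow> 'x \<Rightarrow> 'x) \<Rightarrow> bool" where
  "sheaf_condition D J sec res \<longleftrightarrow>
     (\<forall>X\<in>Obj D. \<forall>S\<in>J X. \<forall>x. matching_family D sec res X S x \<longrightarrow>
        (\<exists>!s. s \<in> sec X \<and> (\<forall>(Y, f)\<in>S. res X Y f s = x (Y, f))))"

type_synonym ('o, 'm, 'k) ring_presheaf = "('o, 'm, 'k ring, 'k \<Rightarrow> 'k) fnctr"

definition sheaf_of_rings ::
  "('o, 'm) cat \<Rightarrow> ('o \<Rightarrow> ('o \<times> 'm) set set) \<Rightarrow> ('o, 'm, 'k) ring_presheaf \<Rightarrow> bool" where
  "sheaf_of_rings D J Ring \<longleftrightarrow>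
     (\<forall>X\<in>Obj D. cring (fobj Ring X)) \<and>
     (\<forall>X\<in>Obj D. \<forall>Y\<in>Obj D. \<forall>f\<in>Mor D Y X.
        fmap Ring X Y f \<in> ring_hom (fobj Ring X) (fobj Ring Y)) \<and>
     (\<forall>X\<in>Obj D. \<forall>a\<in>carrier (fobj Ring X). fmap Ring X X (Idn D X) a = a) \<and>
     (\<forall>X\<in>Obj D. \<forall>Y\<in>Obj D. \<forall>Z\<in>Obj D. \<forall>f\<in>Mor D Y X. \<forall>g\<in>Mor D Z Y.
        \<forall>a\<in>carrier (fobj Ring X).
        fmap Ring X Z (Cmp D Z Y X f g) a = fmap Ring Y Z g (fmap Ring X Y f a)) \<and>
     sheaf_condition D J (\<lambda>X. carrier (fobj Ring X)) (fmap Ring)"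

type_synonym ('o, 'm, 'k, 'u) module_presheaf = "('o, 'm, ('k, 'u) module, 'u \<Rightarrow> 'u) fnctr"

definition sheaf_of_modules :: "('o, 'm) cat \<Rightarrow> ('o \<Rightarrow> ('o \<times> 'm) set set) \<Rightarrow>
    ('o, 'm, 'k) ring_presheaf \<Rightarrow> ('o, 'm, 'k, 'u) module_presheaf \<Rightarrow> bool" where
  "sheaf_of_modules D J Ring F \<longleftrightarrow>
     (\<forall>X\<in>Obj D. module (fobj Ring X) (fobj F X)) \<and>
     (\<forall>X\<in>Obj D. \<forall>Y\<in>Obj D. \<forall>f\<in>Mor D Y X.
        fmap F X Y f \<in> carrier (fobj F X) \<rightarrow>\<^sub>E carrier (fobj F Y) \<and>
        (\<forall>u\<in>carrier (fobj F X). \<forall>v\<in>carrier (fobj F X).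
           fmap F X Y f (u \<oplus>\<^bsub>fobj F X\<^esub> v) = fmap F X Y f u \<oplus>\<^bsub>fobj F Y\<^esub> fmap F X Y f v) \<and>
        (\<forall>a\<in>carrier (fobj Ring X). \<forall>v\<in>carrier (fobj F X).
           fmap F X Y f (a \<odot>\<^bsub>fobj F X\<^esub> v) = fmap Ring X Y f a \<odot>\<^bsub>fobj F Y\<^esub> fmap F X Y f v)) \<and>
     (\<forall>X\<in>Obj D. \<forall>v\<in>carrier (fobj F X). fmap F X X (Idn D X) v = v) \<and>
     (\<forall>X\<in>Obj D. \<forall>Y\<in>Obj D. \<forall>Z\<in>Obj D. \<forall>f\<in>Mor D Y X. \<forall>g\<in>Mor D Z Y.
        \<forall>v\<in>carrier (fobj F X).
        fmap F X Z (Cmp D Z Y X f g) v = fmap F Y Z g (fmap F X Y f v)) \<and>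
     sheaf_condition D J (\<lambda>X. carrier (fobj F X)) (fmap F)"

definition sheaf_morphisms :: "('o, 'm) cat \<Rightarrow> ('o, 'm, 'k) ring_presheaf \<Rightarrow>
    ('o, 'm, 'k, 'u) module_presheaf \<Rightarrow> ('o, 'm, 'k, 'u) module_presheaf \<Rightarrow>
    ('o \<Rightarrow> 'u \<Rightarrow> 'u) set" where
  "sheaf_morphisms D Ring F G =
     {\<eta> \<in> extensional (Obj D).
        (\<forall>X\<in>Obj D. \<eta> X \<in> linear_maps (fobj Ring X) (fobj F X) (fobj G X)) \<and>
        (\<forall>X\<in>Obj D. \<forall>Y\<in>Obj D. \<forall>f\<in>Mor D Y X. \<forall>v\<in>carrier (fobj F X).
           \<eta> Y (fmap F X Y f v) = fmap G X Y f (\<eta> X v))}"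

definition Sh :: "('o, 'm) cat \<Rightarrow> ('o \<Rightarrow> ('o \<times> 'm) set set) \<Rightarrow> ('o, 'm, 'k) ring_presheaf \<Rightarrow>
    (('o, 'm, 'k, 'u) module_presheaf, 'o \<Rightarrow> 'u \<Rightarrow> 'u) cat" where
  "Sh D J Ring =
     \<lparr>Obj = {F. sheaf_of_modules D J Ring F},
      Mor = sheaf_morphisms D Ring,
      Cmp = (\<lambda>F G H \<beta> \<alpha>. \<lambda>X\<in>Obj D. compose (carrier (fobj F X)) (\<beta> X) (\<alpha> X)),
      Idn = (\<lambda>F. \<lambda>X\<in>Obj D. \<lambda>v\<in>carrier (fobj F X). v)\<rparr>"

text \<open>
  In general the constant sheaf is the sheafification of the constant presheaf.  On the
  site considered here the constant presheaf is already a sheaf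
  (lemma \<open>sheaf_of_rings_constant\<close> below), hence equal to its sheafification.
\<close>

definition constant_sheaf :: "'k ring \<Rightarrow> ('o, 'm, 'k) ring_presheaf" where
  "constant_sheaf R = \<lparr>fobj = (\<lambda>X. R), fmap = (\<lambda>X Y f a. a)\<rparr>"

definition inclusion_topology ::
  "'w set set \<Rightarrow> ('w \<Rightarrow> 'w) set \<Rightarrow> 'w set \<Rightarrow> ('w set \<times> ('w \<Rightarrow> 'w)) set set" where
  "inclusion_topology Fin E A =
     {S. sieve (op_cat (finset_category Fin E)) A S \<and>
         (\<exists>B\<in>Fin. A \<subseteq> B \<and> (B, incl A B) \<in> S)}"


lemma is_category_finset_category:
  assumes "submonoid E full_transformation_monoid"
  shows "is_category (finset_category Fin E)"
proof -
  have E: "id \<in> E" "\<And>f g. f \<in> E \<Longrightarrow> g \<in> E \<Longrightarrow> f \<circ> g \<in> E"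
    using assms by (auto simp: submonoid_def full_transformation_monoid_def)
  have 1: "(\<lambda>x\<in>A. x) \<in> A \<rightarrow>\<^sub>E A \<and> (\<exists>h\<in>E. (\<lambda>x\<in>A. x) = restrict h A)" for A
    using E(1) by (auto intro!: bexI[of _ id] simp: restrict_def)
  have 2: "\<exists>h\<in>E. compose A g f = restrict h A"
    if "f \<in> A \<rightarrow>\<^sub>E B" "\<exists>h\<in>E. f = restrict h A" "\<exists>h\<in>E. g = restrict h B" for A B f g
  proof -
    from that obtain h h' where "h \<in> E" "f = restrict h A" "h' \<in> E" "g = restrict h' B" by blast
    with that(1) show ?thesis
      using E(2)[of h' h] by (intro bexI[of _ "h' \<circ> h"]) (auto simp: compose_def fun_eq_iff)
  qed
  have 3: "compose A g f \<in> A \<rightarrow>\<^sub>E D" if "f \<in> A \<rightarrow>\<^sub>E B" "g \<in> B \<rightarrow>\<^sub>E D" for A B D f and g :: "'a \<Rightarrow> 'a"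
    using that by (auto simp: compose_def)
  have 4: "compose A f (\<lambda>x\<in>A. x) = f \<and> compose A (\<lambda>x\<in>B. x) f = f" if "f \<in> A \<rightarrow>\<^sub>E B"
    for A B and f :: "'a \<Rightarrow> 'a"
    using that by (auto simp: compose_def fun_eq_iff PiE_iff extensional_def)
  have 5: "compose A h (compose A g f) = compose A (compose B h g) f" if "f \<in> A \<rightarrow>\<^sub>E B"
    for A B and f g h :: "'a \<Rightarrow> 'a"
    using that by (auto simp: compose_def fun_eq_iff)
  show ?thesis
    unfolding is_category_def finset_category_def cat.simps
  proof (intro conjI ballI)
    fix A show "(\<lambda>x\<in>A. x) \<in> {f \<in> A \<rightarrow>\<^sub>E A. \<exists>h\<in>E. f = restrict h A}"
      by (rule CollectI) (rule 1)
  next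
    fix A B D f g
    assume "f \<in> {f \<in> A \<rightarrow>\<^sub>E B. \<exists>h\<in>E. f = restrict h A}" "g \<in> {f \<in> B \<rightarrow>\<^sub>E D. \<exists>h\<in>E. f = restrict h B}"
    then show "compose A g f \<in> {f \<in> A \<rightarrow>\<^sub>E D. \<exists>h\<in>E. f = restrict h A}"
      by (elim CollectE conjE) (intro CollectI conjI 2 3)
  next
    fix A B f assume "f \<in> {f \<in> A \<rightarrow>\<^sub>E B. \<exists>h\<in>E. f = restrict h A}"
    then have "f \<in> A \<rightarrow>\<^sub>E B" by simp
    then show "compose A f (\<lambda>x\<in>A. x) = f" "compose A (\<lambda>x\<in>B. x) f = f"
      using 4 by (auto simp only:)
  next
    fix A B and f g h :: "'a \<Rightarrow> 'a" assume "f \<in> {f \<in> A \<rightarrow>\<^sub>E B. \<exists>h\<in>E. f = restrict h A}"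
    then have "f \<in> A \<rightarrow>\<^sub>E B" by simp
    then show "compose A h (compose A g f) = compose A (compose B h g) f" by (rule 5)
  qed
qed

lemma
  assumes E: "submonoid E full_transformation_monoid"
    and fin: "\<And>A. A \<in> Fin \<Longrightarrow> finite A"
    and up: "\<And>A B. A \<in> Fin \<Longrightarrow> A \<subseteq> B \<Longrightarrow> finite B \<Longrightarrow> B \<in> Fin"
  shows grothendieck_topology_inclusion:
      "grothendieck_topology (op_cat (finset_category Fin E)) (inclusion_topology Fin E)"
    and sheaf_of_rings_constant: "cring R \<Longrightarrow>
      sheaf_of_rings (op_cat (finset_category Fin E)) (inclusion_topology Fin E) (constant_sheaf R)"
proof -
  let ?D = "op_cat (finset_category Fin E)"
  have idE: "id \<in> E"
    using E by (auto simp: submonoid_def full_transformation_monoid_def)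
  have D: "Obj ?D = Fin" "Mor ?D B A = {f \<in> A \<rightarrow>\<^sub>E B. \<exists>h\<in>E. f = restrict h A}"
    "Cmp ?D G B A f g = compose A g f" for A B G f g
    by (simp_all add: op_cat_def finset_category_def)
  have "is_category (finset_category Fin E)" by (rule is_category_finset_category[OF E])
  then have comp: "compose A g f \<in> Mor ?D G A"
    if "A \<in> Fin" "B \<in> Fin" "G \<in> Fin" "f \<in> Mor ?D B A" "g \<in> Mor ?D G B" for A B G f g
    using that by (auto simp: is_category_def op_cat_def finset_category_def)
  have incl: "incl A B \<in> Mor ?D B A" if "A \<subseteq> B" for A B
    using that idE by (auto simp: D incl_def intro!: bexI[of _ id])
  have assoc: "compose A (compose B h g) f = compose A h (compose A g f)"
    if "f \<in> Mor ?D B A" for A B f and g h :: "'a \<Rightarrow> 'a"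
    using that by (auto simp: D compose_def fun_eq_iff)
  have sieveD: "Y \<in> Fin" "f \<in> Mor ?D Y A" "\<And>Z g. Z \<in> Fin \<Longrightarrow> g \<in> Mor ?D Z Y \<Longrightarrow> (Z, compose A g f) \<in> S"
    if "sieve ?D A S" "(Y, f) \<in> S" for A S Y f
    using that unfolding sieve_def D(1,3) by blast+
  have ext: "\<exists>G'\<in>Fin. \<exists>g\<in>Mor ?D G' B. G \<subseteq> G' \<and>
      compose A g (incl A B) = compose A (incl G G') f"
    if "A \<in> Fin" "B \<in> Fin" "G \<in> Fin" "A \<subseteq> B" "f \<in> Mor ?D G A" for A B G f
  proof -
    from that(5) obtain h where h: "h \<in> E" "f = restrict h A" "f \<in> A \<rightarrow>\<^sub>E G" by (auto simp: D)
    have hG: "h x \<in> G" if "x \<in> A" for x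
      using h(2) PiE_mem[OF h(3) that] that by simp
    have "G \<union> h ` B \<in> Fin" by (rule up[of G]) (use fin that in auto)
    moreover have "restrict h B \<in> Mor ?D (G \<union> h ` B) B" using h by (auto simp: D)
    moreover have "compose A (restrict h B) (incl A B) = compose A (incl G (G \<union> h ` B)) f"
      using hG that(4) by (auto simp: h(2) compose_def incl_def fun_eq_iff)
    ultimately show ?thesis by blast
  qed
  show "grothendieck_topology ?D (inclusion_topology Fin E)"
    unfolding grothendieck_topology_def
  proof (intro conjI ballI allI impI)
    fix A S assume "S \<in> inclusion_topology Fin E A"
    then show "sieve ?D A S" by (simp add: inclusion_topology_def)
  next
    fix A assume "A \<in> Obj ?D"
    then have A: "A \<in> Fin" by (simp add: D)
    have "sieve ?D A (maximal_sieve ?D A)"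
      unfolding sieve_def maximal_sieve_def D(1,3) using A comp[OF A] by blast
    then show "maximal_sieve ?D A \<in> inclusion_topology Fin E A"
      using A incl[of A A] by (auto simp: inclusion_topology_def maximal_sieve_def D(1))
  next
    fix A G f S
    assume "A \<in> Obj ?D" "G \<in> Obj ?D" and f: "f \<in> Mor ?D G A" and "S \<in> inclusion_topology Fin E A"
    then obtain B where A: "A \<in> Fin" "G \<in> Fin" "B \<in> Fin" "A \<subseteq> B" and S: "sieve ?D A S" "(B, incl A B) \<in> S"
      by (auto simp: inclusion_topology_def D(1))
    obtain G' g where G: "G' \<in> Fin" "g \<in> Mor ?D G' B" "G \<subseteq> G'"
        "compose A g (incl A B) = compose A (incl G G') f"
      using ext[OF A(1,3,2,4) f] by blast
    have "(G', compose A (incl G G') f) \<in> S" using sieveD(3)[OF S G(1,2)] G(4) by simp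
    moreover have "sieve ?D G (pullback_sieve ?D G A f S)"
    proof -
      have "(Z, compose A (compose G h g) f) \<in> S"
        if "Z \<in> Fin" "h \<in> Mor ?D Z Y" "(Y, compose A g f) \<in> S" for Y Z g h
        using sieveD(3)[OF S(1) that(3,1,2)] assoc[OF f, of h g] by simp
      then show ?thesis
        unfolding sieve_def pullback_sieve_def D(1,3) using A(2) comp[OF A(2)] by blast
    qed
    ultimately show "pullback_sieve ?D G A f S \<in> inclusion_topology Fin E G"
      using G incl[of G G'] by (auto simp: inclusion_topology_def pullback_sieve_def D(1,3))
  next
    fix A S S'
    assume A: "A \<in> Obj ?D" and S: "S \<in> inclusion_topology Fin E A" and S': "sieve ?D A S'"
      and loc: "\<forall>(Y, f)\<in>S. pullback_sieve ?D Y A f S' \<in> inclusion_topology Fin E Y"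
    obtain B where B: "B \<in> Fin" "A \<subseteq> B" "(B, incl A B) \<in> S"
      using S by (auto simp: inclusion_topology_def)
    then have "pullback_sieve ?D B A (incl A B) S' \<in> inclusion_topology Fin E B"
      using loc by blast
    then obtain B' where B': "B' \<in> Fin" "B \<subseteq> B'" "(B', compose A (incl B B') (incl A B)) \<in> S'"
      unfolding inclusion_topology_def pullback_sieve_def D(3) by blast
    moreover have "compose A (incl B B') (incl A B) = incl A B'"
      using B by (auto simp: compose_def incl_def fun_eq_iff)
    ultimately show "S' \<in> inclusion_topology Fin E A"
      using S' B by (auto simp: inclusion_topology_def)
  qed
  assume R: "cring R"
  have "sheaf_condition ?D (inclusion_topology Fin E) (\<lambda>X. carrier R) (\<lambda>X Y f a. a)"
    unfolding sheaf_condition_def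
  proof (intro ballI allI impI)
    fix A S and x :: "'a set \<times> ('a \<Rightarrow> 'a) \<Rightarrow> 'b"
    assume A0: "A \<in> Obj ?D" and S0: "S \<in> inclusion_topology Fin E A"
      and mf: "matching_family ?D (\<lambda>X. carrier R) (\<lambda>X Y f a. a) A S x"
    obtain B where A: "A \<in> Fin" "B \<in> Fin" "A \<subseteq> B" and S: "sieve ?D A S" "(B, incl A B) \<in> S"
      using A0 S0 unfolding inclusion_topology_def D(1) by blast
    have x: "\<And>Y f. (Y, f) \<in> S \<Longrightarrow> x (Y, f) \<in> carrier R"
        "\<And>Y f Z g. (Y, f) \<in> S \<Longrightarrow> Z \<in> Fin \<Longrightarrow> g \<in> Mor ?D Z Y \<Longrightarrow> x (Y, f) = x (Z, compose A g f)"
      using mf unfolding matching_family_def D(1,3) by blast+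
    have "x (G, f) = x (B, incl A B)" if f: "(G, f) \<in> S" for G f
    proof -
      note G = sieveD(1,2)[OF S(1) f]
      obtain G' g where G': "G' \<in> Fin" "g \<in> Mor ?D G' B" "G \<subseteq> G'"
          "compose A g (incl A B) = compose A (incl G G') f"
        using ext[OF A(1,2) G(1) A(3) G(2)] by blast
      have "x (G, f) = x (G', compose A (incl G G') f)"
        by (rule x(2)[OF f G'(1) incl[OF G'(3)]])
      also have "\<dots> = x (B, incl A B)" using x(2)[OF S(2) G'(1,2)] G'(4) by simp
      finally show ?thesis .
    qed
    then have *: "\<forall>(Y, f)\<in>S. x (B, incl A B) = x (Y, f)" by fastforce
    show "\<exists>!s. s \<in> carrier R \<and> (\<forall>(Y, f)\<in>S. s = x (Y, f))"
    proof (rule ex1I[of _ "x (B, incl A B)"])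
      show "x (B, incl A B) \<in> carrier R \<and> (\<forall>(Y, f)\<in>S. x (B, incl A B) = x (Y, f))"
        using x(1)[OF S(2)] * by (rule conjI)
      show "s = x (B, incl A B)" if "s \<in> carrier R \<and> (\<forall>(Y, f)\<in>S. s = x (Y, f))" for s
        using bspec[OF conjunct2[OF that] S(2)] by simp
    qed
  qed
  then show "sheaf_of_rings ?D (inclusion_topology Fin E) (constant_sheaf R)"
    using R by (simp add: sheaf_of_rings_def constant_sheaf_def ring_hom_def)
qed

end

(*
  Let Psi send a C-module V to the colimit of V along the inclusions, with h in E acting by
  [v in V(A)] |-> [V(h|A) v], and let Phi send a uniformly continuous module M to the functor
  whose value at A consists of the v in M such that h v depends only on h|A.

  Uniform continuity of M means that M is the union of the Phi M (A), so Psi (Phi M) = M. A class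
  in the colimit vanishes iff some inclusion kills it; hence Psi inverts exactly the morphisms with
  torsion kernel and cokernel, parallel morphisms with the same image under Psi agree on a
  subobject with torsion quotient, and every map Psi X -> Psi Y is represented by a roof, whose
  apex is the fibre product of X and Y over Psi Y. So Psi exhibits the uniformly continuous modules
  as the localization. A C-module V is a sheaf iff V = Phi (Psi V), so Psi is also an equivalence
  on sheaves. A retraction of each inclusion makes every covering sieve contain the identity.
*)
theory Submission
  imports Defs "HOL-Algebra.Free_Abelian_Groups"
begin

section \<open>Equivalences of categories\<close>

text \<open>Everything has to be realised inside one universe type \<open>'u\<close>. Colimits,
  cokernels and fibre products are therefore not sets of classes or of pairs but subsets of
  \<open>'u\<close>: a class is replaced by a chosen representative, coded through
  \<open>enc\<close> when it is a point of some stage, and pairs are coded through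
  \<open>pair\<close>. The embedding of \<open>'w\<close> into \<open>'u\<close> is what makes such
  codes available. No quasi-inverse is written down. The quotient category, the sheaves and the
  uniformly continuous modules themselves are each mapped to the uniformly continuous modules by a
  fully faithful, essentially surjective functor, and any two such functors with a common target
  give an equivalence. The localization is not handled through the axioms of a calculus of fractions
  either. A class of roofs is shown to be the set of all roofs that represent one fixed morphism of
  the target, so that composition and the category axioms are read off there.\<close>

lemma is_categoryD:
  assumes "is_category C"
  shows Idn_in: "X \<in> Obj C \<Longrightarrow> Idn C X \<in> Mor C X X"
    and Cmp_in: "X \<in> Obj C \<Longrightarrow> Y \<in> Obj C \<Longrightarrow> Z \<in> Obj C \<Longrightarrow> f \<in> Mor C X Y \<Longrightarrow> g \<in> Mor C Y Z \<Longrightarrow>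
      Cmp C X Y Z g f \<in> Mor C X Z"
    and Cmp_Idn: "X \<in> Obj C \<Longrightarrow> Y \<in> Obj C \<Longrightarrow> f \<in> Mor C X Y \<Longrightarrow> Cmp C X X Y f (Idn C X) = f"
    and Idn_Cmp: "X \<in> Obj C \<Longrightarrow> Y \<in> Obj C \<Longrightarrow> f \<in> Mor C X Y \<Longrightarrow> Cmp C X Y Y (Idn C Y) f = f"
    and Cmp_assoc: "W \<in> Obj C \<Longrightarrow> X \<in> Obj C \<Longrightarrow> Y \<in> Obj C \<Longrightarrow> Z \<in> Obj C \<Longrightarrow>
      f \<in> Mor C W X \<Longrightarrow> g \<in> Mor C X Y \<Longrightarrow> h \<in> Mor C Y Z \<Longrightarrow>
      Cmp C W Y Z h (Cmp C W X Y g f) = Cmp C W X Z (Cmp C X Y Z h g) f"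
  using assms unfolding is_category_def by blast+

lemma is_functorD:
  assumes "is_functor C D F"
  shows fobj_in: "X \<in> Obj C \<Longrightarrow> fobj F X \<in> Obj D"
    and fmap_in: "X \<in> Obj C \<Longrightarrow> Y \<in> Obj C \<Longrightarrow> f \<in> Mor C X Y \<Longrightarrow>
      fmap F X Y f \<in> Mor D (fobj F X) (fobj F Y)"
    and fmap_Idn: "X \<in> Obj C \<Longrightarrow> fmap F X X (Idn C X) = Idn D (fobj F X)"
    and fmap_Cmp: "X \<in> Obj C \<Longrightarrow> Y \<in> Obj C \<Longrightarrow> Z \<in> Obj C \<Longrightarrow> f \<in> Mor C X Y \<Longrightarrow> g \<in> Mor C Y Z \<Longrightarrow>
      fmap F X Z (Cmp C X Y Z g f) =
      Cmp D (fobj F X) (fobj F Y) (fobj F Z) (fmap F Y Z g) (fmap F X Y f)"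
  using assms unfolding is_functor_def by blast+

lemma is_category_full_subcategory:
  "is_category C \<Longrightarrow> is_category (full_subcategory C P)"
  unfolding is_category_def full_subcategory_def by simp

lemma is_category_functor_category:
  assumes C: "is_category C" and D: "is_category D"
  shows "is_category (functor_category C D)"
proof -
  note D' = is_categoryD[OF D] and C' = is_categoryD[OF C]
  show ?thesis
    unfolding is_category_def functor_category_def cat.simps
  proof (intro conjI ballI)
    fix F assume F: "F \<in> {F. is_functor C D F}"
    then show "(\<lambda>X\<in>Obj C. Idn D (fobj F X)) \<in> nat_trans C D F F"
      unfolding nat_trans_def
      using is_functorD[of C D F] by (auto simp: D' )
  next
    fix F G H \<alpha> \<beta>
    assume FGH: "F \<in> {F. is_functor C D F}" "G \<in> {F. is_functor C D F}" "H \<in> {F. is_functor C D F}"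
      and \<alpha>: "\<alpha> \<in> nat_trans C D F G" and \<beta>: "\<beta> \<in> nat_trans C D G H"
    have F: "is_functor C D F" and G: "is_functor C D G" and H: "is_functor C D H" using FGH by auto
    note fs = is_functorD[OF F] is_functorD[OF G] is_functorD[OF H]
    have a: "\<And>X. X \<in> Obj C \<Longrightarrow> \<alpha> X \<in> Mor D (fobj F X) (fobj G X)"
      "\<And>X Y f. X \<in> Obj C \<Longrightarrow> Y \<in> Obj C \<Longrightarrow> f \<in> Mor C X Y \<Longrightarrow>
        Cmp D (fobj F X) (fobj F Y) (fobj G Y) (\<alpha> Y) (fmap F X Y f) =
        Cmp D (fobj F X) (fobj G X) (fobj G Y) (fmap G X Y f) (\<alpha> X)"
      using \<alpha> unfolding nat_trans_def by blast+
    have b: "\<And>X. X \<in> Obj C \<Longrightarrow> \<beta> X \<in> Mor D (fobj G X) (fobj H X)"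
      "\<And>X Y f. X \<in> Obj C \<Longrightarrow> Y \<in> Obj C \<Longrightarrow> f \<in> Mor C X Y \<Longrightarrow>
        Cmp D (fobj G X) (fobj G Y) (fobj H Y) (\<beta> Y) (fmap G X Y f) =
        Cmp D (fobj G X) (fobj H X) (fobj H Y) (fmap H X Y f) (\<beta> X)"
      using \<beta> unfolding nat_trans_def by blast+
    show "(\<lambda>X\<in>Obj C. Cmp D (fobj F X) (fobj G X) (fobj H X) (\<beta> X) (\<alpha> X)) \<in> nat_trans C D F H"
      unfolding nat_trans_def
    proof (intro CollectI conjI ballI)
      fix X Y f assume XY: "X \<in> Obj C" "Y \<in> Obj C" "f \<in> Mor C X Y"
      note o = fs(1,5,9)[OF XY(1)] fs(1,5,9)[OF XY(2)] fs(2,6,10)[OF XY] a(1)[OF XY(1)] a(1)[OF XY(2)]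
        b(1)[OF XY(1)] b(1)[OF XY(2)]
      have "Cmp D (fobj F X) (fobj F Y) (fobj H Y) (Cmp D (fobj F Y) (fobj G Y) (fobj H Y) (\<beta> Y) (\<alpha> Y)) (fmap F X Y f)
        = Cmp D (fobj F X) (fobj G Y) (fobj H Y) (\<beta> Y) (Cmp D (fobj F X) (fobj G X) (fobj G Y) (fmap G X Y f) (\<alpha> X))"
        using o by (simp add: D'(5)[symmetric] a(2)[OF XY, symmetric])
      also have "\<dots> = Cmp D (fobj F X) (fobj G X) (fobj H Y) (Cmp D (fobj G X) (fobj H X) (fobj H Y) (fmap H X Y f) (\<beta> X)) (\<alpha> X)"
        using o by (simp add: D'(5) b(2)[OF XY, symmetric])
      also have "\<dots> = Cmp D (fobj F X) (fobj H X) (fobj H Y) (fmap H X Y f) (Cmp D (fobj F X) (fobj G X) (fobj H X) (\<beta> X) (\<alpha> X))"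
        using o by (simp add: D'(5))
      finally show "Cmp D (fobj F X) (fobj F Y) (fobj H Y)
          ((\<lambda>X\<in>Obj C. Cmp D (fobj F X) (fobj G X) (fobj H X) (\<beta> X) (\<alpha> X)) Y) (fmap F X Y f) =
         Cmp D (fobj F X) (fobj H X) (fobj H Y) (fmap H X Y f)
          ((\<lambda>X\<in>Obj C. Cmp D (fobj F X) (fobj G X) (fobj H X) (\<beta> X) (\<alpha> X)) X)"
        using XY by simp
    qed (use a b fs in \<open>auto intro: D'(2)\<close>)
  next
    fix F G \<alpha>
    assume FGH: "F \<in> {F. is_functor C D F}" "G \<in> {F. is_functor C D F}"
      and \<alpha>: "\<alpha> \<in> nat_trans C D F G"
    have a: "\<And>X. X \<in> Obj C \<Longrightarrow> \<alpha> X \<in> Mor D (fobj F X) (fobj G X)" "\<alpha> \<in> extensional (Obj C)"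
      using \<alpha> unfolding nat_trans_def by blast+
    show "(\<lambda>X\<in>Obj C. Cmp D (fobj F X) (fobj F X) (fobj G X) (\<alpha> X) ((\<lambda>X\<in>Obj C. Idn D (fobj F X)) X)) = \<alpha>"
      "(\<lambda>X\<in>Obj C. Cmp D (fobj F X) (fobj G X) (fobj G X) ((\<lambda>X\<in>Obj C. Idn D (fobj G X)) X) (\<alpha> X)) = \<alpha>"
      using FGH by (auto intro!: extensionalityI[OF _ a(2)] simp: D'(3,4) a is_functorD(1)[where C=C and D=D])
  next
    fix F G H K \<alpha> \<beta> \<gamma>
    assume *: "F \<in> {F. is_functor C D F}" "G \<in> {F. is_functor C D F}" "H \<in> {F. is_functor C D F}" "K \<in> {F. is_functor C D F}"
      "\<alpha> \<in> nat_trans C D F G" "\<beta> \<in> nat_trans C D G H" "\<gamma> \<in> nat_trans C D H K"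
    then have "Cmp D (fobj F X) (fobj H X) (fobj K X) (\<gamma> X) (Cmp D (fobj F X) (fobj G X) (fobj H X) (\<beta> X) (\<alpha> X)) =
      Cmp D (fobj F X) (fobj G X) (fobj K X) (Cmp D (fobj G X) (fobj H X) (fobj K X) (\<gamma> X) (\<beta> X)) (\<alpha> X)"
      if "X \<in> Obj C" for X
      using that by (intro D'(5)) (auto simp: nat_trans_def is_functorD(1)[where C=C and D=D])
    then show "(\<lambda>X\<in>Obj C. Cmp D (fobj F X) (fobj H X) (fobj K X) (\<gamma> X)
        ((\<lambda>X\<in>Obj C. Cmp D (fobj F X) (fobj G X) (fobj H X) (\<beta> X) (\<alpha> X)) X)) =
      (\<lambda>X\<in>Obj C. Cmp D (fobj F X) (fobj G X) (fobj K X)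
        ((\<lambda>X\<in>Obj C. Cmp D (fobj G X) (fobj H X) (fobj K X) (\<gamma> X) (\<beta> X)) X) (\<alpha> X))"
      by (intro restrict_ext) simp
  qed
qed

section \<open>Isomorphisms in a category\<close>

lemma is_isoE:
  assumes "is_iso C X Y f"
  obtains g where "f \<in> Mor C X Y" "g \<in> Mor C Y X" "Cmp C X Y X g f = Idn C X" "Cmp C Y X Y f g = Idn C Y"
  using assms unfolding is_iso_def by blast

lemma is_isoI:
  "\<lbrakk>f \<in> Mor C X Y; g \<in> Mor C Y X; Cmp C X Y X g f = Idn C X; Cmp C Y X Y f g = Idn C Y\<rbrakk> \<Longrightarrow> is_iso C X Y f"
  unfolding is_iso_def by blast

lemma is_iso_mor: "is_iso C X Y f \<Longrightarrow> f \<in> Mor C X Y"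
  unfolding is_iso_def by blast

lemma is_iso_Idn: "is_category C \<Longrightarrow> X \<in> Obj C \<Longrightarrow> is_iso C X X (Idn C X)"
  by (rule is_isoI[where g = "Idn C X"]) (auto simp: is_categoryD)

lemma is_iso_Cmp:
  assumes C: "is_category C" and o: "X \<in> Obj C" "Y \<in> Obj C" "Z \<in> Obj C"
    and f: "is_iso C X Y f" and g: "is_iso C Y Z g"
  shows "is_iso C X Z (Cmp C X Y Z g f)"
proof -
  note C' = is_categoryD[OF C]
  obtain f' where f': "f \<in> Mor C X Y" "f' \<in> Mor C Y X" "Cmp C X Y X f' f = Idn C X" "Cmp C Y X Y f f' = Idn C Y"
    using f by (rule is_isoE)
  obtain g' where g': "g \<in> Mor C Y Z" "g' \<in> Mor C Z Y" "Cmp C Y Z Y g' g = Idn C Y" "Cmp C Z Y Z g g' = Idn C Z"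
    using g by (rule is_isoE)
  show ?thesis
  proof (rule is_isoI[where g = "Cmp C Z Y X f' g'"])
    have "Cmp C X Z X (Cmp C Z Y X f' g') (Cmp C X Y Z g f) = Cmp C X Y X f' (Cmp C X Y Y (Cmp C Y Z Y g' g) f)"
      using o f'(1,2) g'(1,2) by (simp add: C'(5)[symmetric] C'(2))
    also have "\<dots> = Idn C X" using o f' by (simp add: g' C'(4))
    finally show "Cmp C X Z X (Cmp C Z Y X f' g') (Cmp C X Y Z g f) = Idn C X" .
    have "Cmp C Z X Z (Cmp C X Y Z g f) (Cmp C Z Y X f' g') = Cmp C Z Y Z g (Cmp C Z Y Y (Cmp C Y X Y f f') g')"
      using o f'(1,2) g'(1,2) by (simp add: C'(5)[symmetric] C'(2))
    also have "\<dots> = Idn C Z" using o g' by (simp add: f' C'(4))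
    finally show "Cmp C Z X Z (Cmp C X Y Z g f) (Cmp C Z Y X f' g') = Idn C Z" .
  qed (use o f'(1,2) g'(1,2) in \<open>auto intro: C'(2)\<close>)
qed

lemma is_iso_cancel_right:
  assumes C: "is_category C" and o: "X \<in> Obj C" "Y \<in> Obj C" "Z \<in> Obj C"
    and s: "is_iso C X Y s" and fg: "f \<in> Mor C Y Z" "g \<in> Mor C Y Z"
    and eq: "Cmp C X Y Z f s = Cmp C X Y Z g s"
  shows "f = g"
proof -
  note C' = is_categoryD[OF C]
  obtain s' where s': "s \<in> Mor C X Y" "s' \<in> Mor C Y X" "Cmp C X Y X s' s = Idn C X" "Cmp C Y X Y s s' = Idn C Y"
    using s by (rule is_isoE)
  have "Cmp C Y X Z (Cmp C X Y Z f s) s' = Cmp C Y X Z (Cmp C X Y Z g s) s'" by (simp add: eq)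
  then show ?thesis using o fg s' by (simp add: C'(5)[symmetric] C'(3))
qed

section \<open>Fully faithful and essentially surjective functors\<close>

definition fully_faithful :: "('o, 'm) cat \<Rightarrow> ('p, 'n) cat \<Rightarrow> ('o, 'm, 'p, 'n) fnctr \<Rightarrow> bool" where
  "fully_faithful C D F \<longleftrightarrow> is_functor C D F \<and>
     (\<forall>X\<in>Obj C. \<forall>Y\<in>Obj C. bij_betw (fmap F X Y) (Mor C X Y) (Mor D (fobj F X) (fobj F Y)))"

definition essentially_surjective :: "('o, 'm) cat \<Rightarrow> ('p, 'n) cat \<Rightarrow> ('o, 'm, 'p, 'n) fnctr \<Rightarrow> bool" where
  "essentially_surjective C D F \<longleftrightarrow> (\<forall>Z\<in>Obj D. \<exists>X\<in>Obj C. \<exists>i. is_iso D Z (fobj F X) i)"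

lemma fully_faithfulD:
  assumes "fully_faithful C D F"
  shows "is_functor C D F"
    and "X \<in> Obj C \<Longrightarrow> Y \<in> Obj C \<Longrightarrow> f \<in> Mor C X Y \<Longrightarrow> g \<in> Mor C X Y \<Longrightarrow> fmap F X Y f = fmap F X Y g \<Longrightarrow> f = g"
    and "X \<in> Obj C \<Longrightarrow> Y \<in> Obj C \<Longrightarrow> h \<in> Mor D (fobj F X) (fobj F Y) \<Longrightarrow> \<exists>f\<in>Mor C X Y. fmap F X Y f = h"
proof -
  show "is_functor C D F" using assms unfolding fully_faithful_def by blast
next
  assume XY: "X \<in> Obj C" "Y \<in> Obj C"
  then have "bij_betw (fmap F X Y) (Mor C X Y) (Mor D (fobj F X) (fobj F Y))"
    using assms unfolding fully_faithful_def by blast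
  then show "f \<in> Mor C X Y \<Longrightarrow> g \<in> Mor C X Y \<Longrightarrow> fmap F X Y f = fmap F X Y g \<Longrightarrow> f = g"
    "h \<in> Mor D (fobj F X) (fobj F Y) \<Longrightarrow> \<exists>f\<in>Mor C X Y. fmap F X Y f = h"
    by (auto simp: bij_betw_def inj_on_def elim!: equalityE)
qed

lemma fully_faithful_id: "fully_faithful C C id_functor"
  by (auto simp: fully_faithful_def is_functor_def id_functor_def bij_betw_def)

lemma essentially_surjective_id: "is_category C \<Longrightarrow> essentially_surjective C C id_functor"
  unfolding essentially_surjective_def id_functor_def using is_iso_Idn by fastforce

text \<open>Fullness lifts the inverse, and faithfulness lifts the two equations that make it an
  inverse.\<close>

lemma fully_faithful_reflects_iso:
  assumes A: "is_category A" and D: "is_category D" and F: "fully_faithful A D F"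
    and XY: "X \<in> Obj A" "Y \<in> Obj A" and f: "f \<in> Mor A X Y" and i: "is_iso D (fobj F X) (fobj F Y) (fmap F X Y f)"
  shows "is_iso A X Y f"
proof -
  note A' = is_categoryD[OF A] and F' = fully_faithfulD[OF F] and F'' = is_functorD[OF fully_faithfulD(1)[OF F]]
  obtain g where g: "g \<in> Mor D (fobj F Y) (fobj F X)"
    "Cmp D (fobj F X) (fobj F Y) (fobj F X) g (fmap F X Y f) = Idn D (fobj F X)"
    "Cmp D (fobj F Y) (fobj F X) (fobj F Y) (fmap F X Y f) g = Idn D (fobj F Y)"
    using i by (rule is_isoE)
  obtain g' where g': "g' \<in> Mor A Y X" "fmap F Y X g' = g" using F'(3)[OF XY(2,1) g(1)] by blast
  show ?thesis
  proof (rule is_isoI[where g = g'])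
    show "Cmp A X Y X g' f = Idn A X"
      using XY f g' g by (intro F'(2)[of X X]) (auto simp: A' F'')
    show "Cmp A Y X Y f g' = Idn A Y"
      using XY f g' g by (intro F'(2)[of Y Y]) (auto simp: A' F'')
  qed (use f g' in auto)
qed

text \<open>Essential surjectivity chooses \<open>h X\<close> with an isomorphism \<open>i X\<close>
  from \<open>F X\<close> to \<open>G (h X)\<close>. Naturality then leaves no freedom on morphisms:
  \<open>G\<close> of the value at \<open>f\<close> has to be \<open>i Y\<close> after
  \<open>F f\<close> after the inverse of \<open>i X\<close>. Full faithfulness provides exactly one
  such morphism, and functoriality is a consequence of this uniqueness.\<close>

lemma lift_along_equivalence:
  assumes A: "is_category A" and B: "is_category B" and D: "is_category D"
    and F: "is_functor A D F" and G: "fully_faithful B D G" and es: "essentially_surjective B D G"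
  obtains H i where "is_functor A B H"
    and "\<And>X. X \<in> Obj A \<Longrightarrow> is_iso D (fobj F X) (fobj G (fobj H X)) (i X)"
    and "\<And>X Y f. X \<in> Obj A \<Longrightarrow> Y \<in> Obj A \<Longrightarrow> f \<in> Mor A X Y \<Longrightarrow>
      Cmp D (fobj F X) (fobj F Y) (fobj G (fobj H Y)) (i Y) (fmap F X Y f) =
      Cmp D (fobj F X) (fobj G (fobj H X)) (fobj G (fobj H Y)) (fmap G (fobj H X) (fobj H Y) (fmap H X Y f)) (i X)"
proof -
  note A' = is_categoryD[OF A] and B' = is_categoryD[OF B] and D' = is_categoryD[OF D]
    and F' = is_functorD[OF F] and G' = fully_faithfulD[OF G] and G'' = is_functorD[OF fully_faithfulD(1)[OF G]]
  have "\<forall>X\<in>Obj A. \<exists>Y i. Y \<in> Obj B \<and> is_iso D (fobj F X) (fobj G Y) i"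
    using es F'(1) unfolding essentially_surjective_def by blast
  then obtain h i where h: "\<And>X. X \<in> Obj A \<Longrightarrow> h X \<in> Obj B"
    and i: "\<And>X. X \<in> Obj A \<Longrightarrow> is_iso D (fobj F X) (fobj G (h X)) (i X)"
    by metis
  let ?P = "\<lambda>X Y f g. g \<in> Mor B (h X) (h Y) \<and> Cmp D (fobj F X) (fobj F Y) (fobj G (h Y)) (i Y) (fmap F X Y f) =
      Cmp D (fobj F X) (fobj G (h X)) (fobj G (h Y)) (fmap G (h X) (h Y) g) (i X)"
  note iM = is_iso_mor[OF i]
  have uniq: "g = g'" if "X \<in> Obj A" "Y \<in> Obj A" "?P X Y f g" "?P X Y f g'" for X Y f g g'
  proof (rule G'(2)[of "h X" "h Y"])
    show "fmap G (h X) (h Y) g = fmap G (h X) (h Y) g'"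
      by (rule is_iso_cancel_right[OF D _ _ _ i[OF that(1)], where Z = "fobj G (h Y)"]) (use that h in \<open>auto simp: F'(1) G''(1,2)\<close>)
  qed (use that h in auto)
  have "\<exists>g. ?P X Y f g" if o: "X \<in> Obj A" "Y \<in> Obj A" "f \<in> Mor A X Y" for X Y f
  proof -
    \<comment> \<open>\<open>j\<close> inverts \<open>i X\<close>, so \<open>?k\<close> after
      \<open>j\<close> is the conjugate of \<open>F f\<close> that \<open>G\<close> has to
      hit.\<close>
    obtain j where j: "i X \<in> Mor D (fobj F X) (fobj G (h X))" "j \<in> Mor D (fobj G (h X)) (fobj F X)"
      "Cmp D (fobj F X) (fobj G (h X)) (fobj F X) j (i X) = Idn D (fobj F X)"
      using i[OF o(1)] by (rule is_isoE)
    let ?k = "Cmp D (fobj F X) (fobj F Y) (fobj G (h Y)) (i Y) (fmap F X Y f)"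
    have k: "?k \<in> Mor D (fobj F X) (fobj G (h Y))"
      using o by (intro D'(2)) (auto simp: F' G'' h iM)
    have "Cmp D (fobj G (h X)) (fobj F X) (fobj G (h Y)) ?k j \<in> Mor D (fobj G (h X)) (fobj G (h Y))"
      using o k j by (intro D'(2)[OF _ _ _ j(2)]) (auto simp: F' G'' h)
    then obtain g where g: "g \<in> Mor B (h X) (h Y)"
      "fmap G (h X) (h Y) g = Cmp D (fobj G (h X)) (fobj F X) (fobj G (h Y)) ?k j"
      using G'(3)[OF h[OF o(1)] h[OF o(2)]] by blast
    have "Cmp D (fobj F X) (fobj G (h X)) (fobj G (h Y)) (fmap G (h X) (h Y) g) (i X) = ?k"
      unfolding g(2) using o k j by (subst D'(5)[symmetric]) (auto simp: F' G'' h D'(3) iM)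
    with g(1) show ?thesis by auto
  qed
  then have "\<exists>m. \<forall>X Y f. X \<in> Obj A \<longrightarrow> Y \<in> Obj A \<longrightarrow> f \<in> Mor A X Y \<longrightarrow> ?P X Y f (m X Y f)" by metis
  then obtain m where m: "\<And>X Y f. X \<in> Obj A \<Longrightarrow> Y \<in> Obj A \<Longrightarrow> f \<in> Mor A X Y \<Longrightarrow> ?P X Y f (m X Y f)" by blast
  have m1: "\<And>X Y f. X \<in> Obj A \<Longrightarrow> Y \<in> Obj A \<Longrightarrow> f \<in> Mor A X Y \<Longrightarrow> m X Y f \<in> Mor B (h X) (h Y)"
    using m by blast
  have "is_functor A B \<lparr>fobj = h, fmap = m\<rparr>"
    unfolding is_functor_def fnctr.simps
  proof (intro conjI ballI)
    fix X assume X: "X \<in> Obj A"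
    have "?P X X (Idn A X) (Idn B (h X))"
      using X by (auto simp: B' h F' G'' D'(3,4) iM)
    then show "m X X (Idn A X) = Idn B (h X)"
      using uniq[OF X X m[OF X X A'(1)[OF X]]] by blast
  next
    fix X Y Z f g assume o: "X \<in> Obj A" "Y \<in> Obj A" "Z \<in> Obj A" "f \<in> Mor A X Y" "g \<in> Mor A Y Z"
    note ms = m1[OF o(1,2,4)] m1[OF o(2,3,5)]
    note objs = h[OF o(1)] h[OF o(2)] h[OF o(3)]
    note all = o objs ms F'(1)[OF o(1)] F'(1)[OF o(2)] F'(1)[OF o(3)] G''(1)[OF objs(1)] G''(1)[OF objs(2)] G''(1)[OF objs(3)]
      F'(2)[OF o(1,2,4)] F'(2)[OF o(2,3,5)] G''(2)[OF objs(1,2) ms(1)] G''(2)[OF objs(2,3) ms(2)] iM[OF o(1)] iM[OF o(2)] iM[OF o(3)]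
    have e1: "Cmp D (fobj F X) (fobj F Y) (fobj G (h Y)) (i Y) (fmap F X Y f) =
      Cmp D (fobj F X) (fobj G (h X)) (fobj G (h Y)) (fmap G (h X) (h Y) (m X Y f)) (i X)" using m[OF o(1,2,4)] by blast
    have e2: "Cmp D (fobj F Y) (fobj F Z) (fobj G (h Z)) (i Z) (fmap F Y Z g) =
      Cmp D (fobj F Y) (fobj G (h Y)) (fobj G (h Z)) (fmap G (h Y) (h Z) (m Y Z g)) (i Y)" using m[OF o(2,3,5)] by blast
    have "Cmp D (fobj F X) (fobj F Z) (fobj G (h Z)) (i Z) (fmap F X Z (Cmp A X Y Z g f))
       = Cmp D (fobj F X) (fobj F Y) (fobj G (h Z)) (Cmp D (fobj F Y) (fobj F Z) (fobj G (h Z)) (i Z) (fmap F Y Z g)) (fmap F X Y f)"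
      using all by (simp add: F'(4) D'(5))
    also have "\<dots> = Cmp D (fobj F X) (fobj G (h Y)) (fobj G (h Z)) (fmap G (h Y) (h Z) (m Y Z g)) 
         (Cmp D (fobj F X) (fobj F Y) (fobj G (h Y)) (i Y) (fmap F X Y f))"
      unfolding e2 using all by (simp add: D'(5))
    also have "\<dots> = Cmp D (fobj F X) (fobj G (h X)) (fobj G (h Z)) (fmap G (h X) (h Z) (Cmp B (h X) (h Y) (h Z) (m Y Z g) (m X Y f))) (i X)"
      unfolding e1 using all by (simp add: G''(4) D'(5))
    finally have "?P X Z (Cmp A X Y Z g f) (Cmp B (h X) (h Y) (h Z) (m Y Z g) (m X Y f))"
      using all by (auto intro: B'(2))
    then show "m X Z (Cmp A X Y Z g f) = Cmp B (h X) (h Y) (h Z) (m Y Z g) (m X Y f)"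
      using uniq[OF o(1,3) m[OF o(1,3) A'(2)[OF o]]] by blast
  qed (use h m1 in auto)
  then show thesis
    by (rule that[where i = i]) (use i m in auto)
qed

text \<open>\<open>j (H X)\<close> after \<open>i X\<close> is a natural isomorphism from
  \<open>F X\<close> to \<open>F (K (H X))\<close>. As \<open>F\<close> is fully faithful, its
  inverse is \<open>F\<close> of a unique morphism from \<open>K (H X)\<close> to \<open>X\<close>,
  and these morphisms form the natural isomorphism from the composite to the identity.\<close>

lemma lift_along_equivalence_inverse:
  assumes A: "is_category A" and B: "is_category B" and D: "is_category D"
    and F: "fully_faithful A D F" and G: "is_functor B D G"
    and H: "is_functor A B H" and K: "is_functor B A K"
    and i: "\<And>X. X \<in> Obj A \<Longrightarrow> is_iso D (fobj F X) (fobj G (fobj H X)) (i X)"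
    and i_nat: "\<And>X Y f. X \<in> Obj A \<Longrightarrow> Y \<in> Obj A \<Longrightarrow> f \<in> Mor A X Y \<Longrightarrow>
      Cmp D (fobj F X) (fobj F Y) (fobj G (fobj H Y)) (i Y) (fmap F X Y f) =
      Cmp D (fobj F X) (fobj G (fobj H X)) (fobj G (fobj H Y)) (fmap G (fobj H X) (fobj H Y) (fmap H X Y f)) (i X)"
    and j: "\<And>X. X \<in> Obj B \<Longrightarrow> is_iso D (fobj G X) (fobj F (fobj K X)) (j X)"
    and j_nat: "\<And>X Y f. X \<in> Obj B \<Longrightarrow> Y \<in> Obj B \<Longrightarrow> f \<in> Mor B X Y \<Longrightarrow>
      Cmp D (fobj G X) (fobj G Y) (fobj F (fobj K Y)) (j Y) (fmap G X Y f) =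
      Cmp D (fobj G X) (fobj F (fobj K X)) (fobj F (fobj K Y)) (fmap F (fobj K X) (fobj K Y) (fmap K X Y f)) (j X)"
  shows "nat_isomorphic A A (comp_functor K H) id_functor"
proof -
  note A' = is_categoryD[OF A] and B' = is_categoryD[OF B] and D' = is_categoryD[OF D]
    and F' = is_functorD[OF fully_faithfulD(1)[OF F]] and G' = is_functorD[OF G]
    and H' = is_functorD[OF H] and K' = is_functorD[OF K]
  note iM = is_iso_mor[OF i] and jM = is_iso_mor[OF j]
  let ?T = "\<lambda>X. fobj K (fobj H X)"
  define c where "c = (\<lambda>X. Cmp D (fobj F X) (fobj G (fobj H X)) (fobj F (?T X)) (j (fobj H X)) (i X))"
  have cI: "is_iso D (fobj F X) (fobj F (?T X)) (c X)" if "X \<in> Obj A" for X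
    unfolding c_def using that by (intro is_iso_Cmp[OF D]) (auto simp: F' G' H' K' i j)
  have "\<forall>X\<in>Obj A. \<exists>e. e \<in> Mor A (?T X) X \<and>
      Cmp D (fobj F X) (fobj F (?T X)) (fobj F X) (fmap F (?T X) X e) (c X) = Idn D (fobj F X) \<and>
      Cmp D (fobj F (?T X)) (fobj F X) (fobj F (?T X)) (c X) (fmap F (?T X) X e) = Idn D (fobj F (?T X))"
  proof
    fix X assume X: "X \<in> Obj A"
    obtain e where e: "e \<in> Mor D (fobj F (?T X)) (fobj F X)"
      "Cmp D (fobj F X) (fobj F (?T X)) (fobj F X) e (c X) = Idn D (fobj F X)"
      "Cmp D (fobj F (?T X)) (fobj F X) (fobj F (?T X)) (c X) e = Idn D (fobj F (?T X))"
      using cI[OF X] by (rule is_isoE)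
    then show "\<exists>e. e \<in> Mor A (?T X) X \<and>
      Cmp D (fobj F X) (fobj F (?T X)) (fobj F X) (fmap F (?T X) X e) (c X) = Idn D (fobj F X) \<and>
      Cmp D (fobj F (?T X)) (fobj F X) (fobj F (?T X)) (c X) (fmap F (?T X) X e) = Idn D (fobj F (?T X))"
      using fully_faithfulD(3)[OF F, of "?T X" X] X by (metis H'(1) K'(1))
  qed
  then obtain e where e: "\<And>X. X \<in> Obj A \<Longrightarrow> e X \<in> Mor A (?T X) X"
    and ec: "\<And>X. X \<in> Obj A \<Longrightarrow> Cmp D (fobj F X) (fobj F (?T X)) (fobj F X) (fmap F (?T X) X (e X)) (c X) = Idn D (fobj F X)"
    and ce: "\<And>X. X \<in> Obj A \<Longrightarrow> Cmp D (fobj F (?T X)) (fobj F X) (fobj F (?T X)) (c X) (fmap F (?T X) X (e X)) = Idn D (fobj F (?T X))"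
    by metis
  have eI: "is_iso A (?T X) X (e X)" if "X \<in> Obj A" for X
    using that ec[OF that] ce[OF that] is_iso_mor[OF cI[OF that]]
    by (intro fully_faithful_reflects_iso[OF A D F] is_isoI[where g = "c X"]) (auto simp: H' K' F' e)
  have nat: "Cmp A (?T X) (?T Y) Y (e Y) (fmap K (fobj H X) (fobj H Y) (fmap H X Y f)) =
     Cmp A (?T X) X Y f (e X)" if o: "X \<in> Obj A" "Y \<in> Obj A" "f \<in> Mor A X Y" for X Y f
  proof -
    let ?f' = "fmap K (fobj H X) (fobj H Y) (fmap H X Y f)"
    note hm = H'(2)[OF o]
    note obs = H'(1)[OF o(1)] H'(1)[OF o(2)] 
    note obs' = K'(1)[OF obs(1)] K'(1)[OF obs(2)]
    note km = K'(2)[OF obs hm]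
    note all = o obs obs' hm km F'(1)[OF o(1)] F'(1)[OF o(2)] G'(1)[OF obs(1)] G'(1)[OF obs(2)]
      F'(1)[OF obs'(1)] F'(1)[OF obs'(2)] F'(2)[OF o] F'(2)[OF obs' km] G'(2)[OF obs hm]
      iM[OF o(1)] iM[OF o(2)] jM[OF obs(1)] jM[OF obs(2)] e[OF o(1)] e[OF o(2)]
      F'(2)[OF obs'(1) o(1) e[OF o(1)]] F'(2)[OF obs'(2) o(2) e[OF o(2)]]
      is_iso_mor[OF cI[OF o(1)]] is_iso_mor[OF cI[OF o(2)]]
    have "Cmp D (fobj F X) (fobj F Y) (fobj F (?T Y)) (c Y) (fmap F X Y f) =
      Cmp D (fobj F X) (fobj G (fobj H Y)) (fobj F (?T Y)) (j (fobj H Y)) (Cmp D (fobj F X) (fobj F Y) (fobj G (fobj H Y)) (i Y) (fmap F X Y f))"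
      unfolding c_def using all by (simp add: D'(5))
    also have "\<dots> = Cmp D (fobj F X) (fobj G (fobj H X)) (fobj F (?T Y))
       (Cmp D (fobj G (fobj H X)) (fobj G (fobj H Y)) (fobj F (?T Y)) (j (fobj H Y)) (fmap G (fobj H X) (fobj H Y) (fmap H X Y f))) (i X)"
      unfolding i_nat[OF o] using all by (simp add: D'(5))
    also have "\<dots> = Cmp D (fobj F X) (fobj F (?T X)) (fobj F (?T Y)) (fmap F (?T X) (?T Y) ?f') (c X)"
      unfolding j_nat[OF obs hm] c_def using all by (simp add: D'(5))
    finally have cn: "Cmp D (fobj F X) (fobj F (?T X)) (fobj F (?T Y)) (fmap F (?T X) (?T Y) ?f') (c X) =
      Cmp D (fobj F X) (fobj F Y) (fobj F (?T Y)) (c Y) (fmap F X Y f)" by simp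
    \<comment> \<open>Naturality of \<open>e\<close> is naturality of \<open>c\<close> read through
      the inverses. It is tested after precomposition with the isomorphism \<open>c X\<close>, which
      can be cancelled.\<close>
    have "Cmp D (fobj F X) (fobj F (?T X)) (fobj F Y)
        (fmap F (?T X) Y (Cmp A (?T X) (?T Y) Y (e Y) ?f')) (c X)
      = Cmp D (fobj F X) (fobj F (?T Y)) (fobj F Y) (fmap F (?T Y) Y (e Y))
         (Cmp D (fobj F X) (fobj F (?T X)) (fobj F (?T Y)) (fmap F (?T X) (?T Y) ?f') (c X))"
      using all by (simp add: F'(4) D'(5))
    also have "\<dots> = Cmp D (fobj F X) (fobj F Y) (fobj F Y) (Cmp D (fobj F Y) (fobj F (?T Y)) (fobj F Y) (fmap F (?T Y) Y (e Y)) (c Y)) (fmap F X Y f)"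
      unfolding cn using all by (simp add: D'(5))
    also have "\<dots> = Cmp D (fobj F X) (fobj F X) (fobj F Y) (fmap F X Y f) (Cmp D (fobj F X) (fobj F (?T X)) (fobj F X) (fmap F (?T X) X (e X)) (c X))"
      unfolding ec[OF o(1)] ec[OF o(2)] using all by (simp add: D'(3,4))
    also have "\<dots> = Cmp D (fobj F X) (fobj F (?T X)) (fobj F Y)
        (fmap F (?T X) Y (Cmp A (?T X) X Y f (e X))) (c X)"
      using all by (simp add: F'(4) D'(5))
    finally have "fmap F (?T X) Y (Cmp A (?T X) (?T Y) Y (e Y) ?f') = fmap F (?T X) Y (Cmp A (?T X) X Y f (e X))"
      by (rule is_iso_cancel_right[OF D _ _ _ cI[OF o(1)], rotated -1]) (use all in \<open>auto intro!: F'(2) A'(2)\<close>)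
    then show ?thesis
      by (rule fully_faithfulD(2)[OF F, rotated -1]) (use all in \<open>auto intro!: A'(2)\<close>)
  qed
  show ?thesis
    unfolding nat_isomorphic_def
  proof (rule bexI[where x = "\<lambda>X\<in>Obj A. e X"])
    show "\<forall>X\<in>Obj A. is_iso A (fobj (comp_functor K H) X) (fobj id_functor X) (restrict e (Obj A) X)"
      using eI by (simp add: comp_functor_def id_functor_def)
    show "restrict e (Obj A) \<in> nat_trans A A (comp_functor K H) id_functor"
      using e nat by (auto simp: nat_trans_def comp_functor_def id_functor_def)
  qed
qed

text \<open>Each functor is lifted along the other, which gives functors in both directions. The
  hypotheses are symmetric, so the inverse law applies once to each composite.\<close>

lemma equivalent_categories_cospan:
  assumes A: "is_category A" and B: "is_category B" and D: "is_category D"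
    and F: "fully_faithful A D F" "essentially_surjective A D F"
    and G: "fully_faithful B D G" "essentially_surjective B D G"
  shows "A \<simeq>\<^sub>c\<^sub>a\<^sub>t B"
proof -
  obtain H i where H: "is_functor A B H"
    and i: "\<And>X. X \<in> Obj A \<Longrightarrow> is_iso D (fobj F X) (fobj G (fobj H X)) (i X)"
    and i_nat: "\<And>X Y f. X \<in> Obj A \<Longrightarrow> Y \<in> Obj A \<Longrightarrow> f \<in> Mor A X Y \<Longrightarrow>
      Cmp D (fobj F X) (fobj F Y) (fobj G (fobj H Y)) (i Y) (fmap F X Y f) =
      Cmp D (fobj F X) (fobj G (fobj H X)) (fobj G (fobj H Y)) (fmap G (fobj H X) (fobj H Y) (fmap H X Y f)) (i X)"
    using lift_along_equivalence[OF A B D fully_faithfulD(1)[OF F(1)] G] by blast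
  obtain K j where K: "is_functor B A K"
    and j: "\<And>X. X \<in> Obj B \<Longrightarrow> is_iso D (fobj G X) (fobj F (fobj K X)) (j X)"
    and j_nat: "\<And>X Y f. X \<in> Obj B \<Longrightarrow> Y \<in> Obj B \<Longrightarrow> f \<in> Mor B X Y \<Longrightarrow>
      Cmp D (fobj G X) (fobj G Y) (fobj F (fobj K Y)) (j Y) (fmap G X Y f) =
      Cmp D (fobj G X) (fobj F (fobj K X)) (fobj F (fobj K Y)) (fmap F (fobj K X) (fobj K Y) (fmap K X Y f)) (j X)"
    using lift_along_equivalence[OF B A D fully_faithfulD(1)[OF G(1)] F] by blast
  have "nat_isomorphic A A (comp_functor K H) id_functor"
    by (rule lift_along_equivalence_inverse[OF A B D F(1) fully_faithfulD(1)[OF G(1)] H K i i_nat j j_nat])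
  moreover have "nat_isomorphic B B (comp_functor H K) id_functor"
    by (rule lift_along_equivalence_inverse[OF B A D G(1) fully_faithfulD(1)[OF F(1)] K H j j_nat i i_nat])
  ultimately show ?thesis
    unfolding equivalent_categories_def using A B H K by blast
qed

section \<open>Zero morphisms and cokernels through the opposite category\<close>

lemma zero_object_op_cat: "zero_object (op_cat C) Z \<longleftrightarrow> zero_object C Z"
  by (auto simp: zero_object_def op_cat_def)

lemma zero_morphism_op_cat: "zero_morphism (op_cat C) Y X f \<longleftrightarrow> zero_morphism C X Y f"
  unfolding zero_morphism_def zero_object_op_cat by (auto simp: op_cat_def)

lemma is_cokernel_iff: "is_cokernel C X Y f Q p \<longleftrightarrow> Q \<in> Obj C \<and> p \<in> Mor C Y Q \<and>
    zero_morphism C X Q (Cmp C X Y Q p f) \<and>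
    (\<forall>W\<in>Obj C. \<forall>g\<in>Mor C Y W. zero_morphism C X W (Cmp C X Y W g f) \<longrightarrow>
      (\<exists>!u. u \<in> Mor C Q W \<and> Cmp C Y Q W u p = g))"
  unfolding is_cokernel_def is_kernel_def zero_morphism_op_cat by (simp add: op_cat_def)

lemma full_subcategory_simps [simp]:
  "Obj (full_subcategory C P) = Obj C \<inter> P" "Mor (full_subcategory C P) = Mor C"
  "Cmp (full_subcategory C P) = Cmp C" "Idn (full_subcategory C P) = Idn C"
  by (simp_all add: full_subcategory_def)

lemma is_functor_full_subcategory: "is_functor C D F \<Longrightarrow> is_functor (full_subcategory C P) D F"
  unfolding is_functor_def by simp

section \<open>Localization\<close>

text \<open>
  Up to essential surjectivity, these hypotheses characterize \<open>F\<close> as the localization of \<open>C\<close>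
  at the morphisms that it inverts.
\<close>

locale right_fractions =
  fixes C :: "('o, 'm) cat" and D :: "('p, 'n) cat" and F :: "('o, 'm, 'p, 'n) fnctr"
    and W :: "'o \<Rightarrow> 'o \<Rightarrow> 'm set"
  assumes C: "is_category C" and D: "is_category D" and F: "is_functor C D F"
    and W: "\<And>X Y. X \<in> Obj C \<Longrightarrow> Y \<in> Obj C \<Longrightarrow>
      W X Y = {s \<in> Mor C X Y. is_iso D (fobj F X) (fobj F Y) (fmap F X Y s)}"
    and fraction: "\<And>X Y \<phi>. X \<in> Obj C \<Longrightarrow> Y \<in> Obj C \<Longrightarrow> \<phi> \<in> Mor D (fobj F X) (fobj F Y) \<Longrightarrow>
      \<exists>U\<in>Obj C. \<exists>s\<in>W U X. \<exists>f\<in>Mor C U Y. Cmp D (fobj F U) (fobj F X) (fobj F Y) \<phi> (fmap F U X s) = fmap F U Y f"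
    and equalize: "\<And>X Y f g. X \<in> Obj C \<Longrightarrow> Y \<in> Obj C \<Longrightarrow> f \<in> Mor C X Y \<Longrightarrow> g \<in> Mor C X Y \<Longrightarrow>
      fmap F X Y f = fmap F X Y g \<Longrightarrow> \<exists>T\<in>Obj C. \<exists>t\<in>W T X. Cmp C T X Y f t = Cmp C T X Y g t"
begin

lemmas C' = is_categoryD[OF C] and D' = is_categoryD[OF D] and F' = is_functorD[OF F]

lemma W_D:
  assumes "X \<in> Obj C" "Y \<in> Obj C" "s \<in> W X Y"
  shows "s \<in> Mor C X Y" "is_iso D (fobj F X) (fobj F Y) (fmap F X Y s)"
  using assms by (auto simp: W)

lemma W_Idn: "X \<in> Obj C \<Longrightarrow> Idn C X \<in> W X X"
  using is_iso_Idn[OF D F'(1)] by (simp add: W C' F')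

lemma W_Cmp:
  assumes o: "X \<in> Obj C" "Y \<in> Obj C" "Z \<in> Obj C" and "s \<in> W X Y" "t \<in> W Y Z"
  shows "Cmp C X Y Z t s \<in> W X Z"
  using assms by (auto simp: W F' C' intro!: is_iso_Cmp[OF D] C'(2))

text \<open>The equation says that \<open>\<phi>\<close> is \<open>F f\<close> after the inverse of \<open>F s\<close>.\<close>

definition fractions :: "'o \<Rightarrow> 'o \<Rightarrow> 'n \<Rightarrow> ('o \<times> 'm \<times> 'm) set" where
  "fractions X Y \<phi> = {(U, s, f). (U, s, f) \<in> roofs C W X Y \<and>
     Cmp D (fobj F U) (fobj F X) (fobj F Y) \<phi> (fmap F U X s) = fmap F U Y f}"

lemma fractions_nonempty:
  assumes "X \<in> Obj C" "Y \<in> Obj C" "\<phi> \<in> Mor D (fobj F X) (fobj F Y)"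
  obtains U s f where "(U, s, f) \<in> fractions X Y \<phi>"
  using fraction[OF assms] unfolding fractions_def roofs_def by auto

text \<open>\<open>s\<close> becomes invertible under \<open>F\<close>, so the roof represents
  \<open>F f\<close> after the inverse of \<open>F s\<close>.\<close>

lemma roof_in_fractions:
  assumes o: "X \<in> Obj C" "Y \<in> Obj C" and r: "(U, s, f) \<in> roofs C W X Y"
  obtains \<phi> where "\<phi> \<in> Mor D (fobj F X) (fobj F Y)" "(U, s, f) \<in> fractions X Y \<phi>"
proof -
  have U: "U \<in> Obj C" "s \<in> W U X" "f \<in> Mor C U Y" using r by (auto simp: roofs_def)
  obtain s' where s': "s' \<in> Mor D (fobj F X) (fobj F U)"
    "Cmp D (fobj F U) (fobj F X) (fobj F U) s' (fmap F U X s) = Idn D (fobj F U)"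
    using W_D(2)[OF U(1) o(1) U(2)] by (rule is_isoE)
  show thesis
  proof (rule that[of "Cmp D (fobj F X) (fobj F U) (fobj F Y) (fmap F U Y f) s'"])
    show "Cmp D (fobj F X) (fobj F U) (fobj F Y) (fmap F U Y f) s' \<in> Mor D (fobj F X) (fobj F Y)"
      using o U s' by (intro D'(2)) (auto simp: F')
    show "(U, s, f) \<in> fractions X Y (Cmp D (fobj F X) (fobj F U) (fobj F Y) (fmap F U Y f) s')"
      unfolding fractions_def using o U s' r W_D(1)[OF U(1) o(1) U(2)]
      by (auto simp: F' D'(3) D'(5)[symmetric])
  qed
qed

text \<open>Both morphisms agree after precomposition with the left leg of the common roof, and
  \<open>F\<close> makes that leg invertible.\<close>

lemma fractions_cong:
  assumes o: "X \<in> Obj C" "Y \<in> Obj C" and \<phi>: "\<phi> \<in> Mor D (fobj F X) (fobj F Y)" "\<psi> \<in> Mor D (fobj F X) (fobj F Y)"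
    and r: "((U, s, f), (V, t, g)) \<in> roof_rel C W X Y"
    and U: "(U, s, f) \<in> fractions X Y \<phi>" and V: "(V, t, g) \<in> fractions X Y \<psi>"
  shows "\<phi> = \<psi>"
proof -
  have u: "U \<in> Obj C" "s \<in> W U X" "f \<in> Mor C U Y" "V \<in> Obj C" "t \<in> W V X" "g \<in> Mor C V Y"
    and uf: "Cmp D (fobj F U) (fobj F X) (fobj F Y) \<phi> (fmap F U X s) = fmap F U Y f"
    and vg: "Cmp D (fobj F V) (fobj F X) (fobj F Y) \<psi> (fmap F V X t) = fmap F V Y g"
    using U V by (auto simp: fractions_def roofs_def)
  note w = W_D(1)[OF u(1) o(1) u(2)] W_D(1)[OF u(4) o(1) u(5)]
  obtain T a b where T: "T \<in> Obj C" "a \<in> Mor C T U" "b \<in> Mor C T V"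
    and sa: "Cmp C T U X s a = Cmp C T V X t b" "Cmp C T U X s a \<in> W T X"
    and fa: "Cmp C T U Y f a = Cmp C T V Y g b"
    using r by (auto simp: roof_rel_def)
  let ?s = "Cmp C T U X s a"
  have "Cmp D (fobj F T) (fobj F X) (fobj F Y) \<phi> (fmap F T X ?s) =
    Cmp D (fobj F T) (fobj F U) (fobj F Y) (fmap F U Y f) (fmap F T U a)"
    unfolding uf[symmetric] using o u T w \<phi> by (simp add: F' D'(5))
  also have "\<dots> = Cmp D (fobj F T) (fobj F V) (fobj F Y) (fmap F V Y g) (fmap F T V b)"
    using o u T fa by (simp add: F'(4)[symmetric])
  also have "\<dots> = Cmp D (fobj F T) (fobj F X) (fobj F Y) \<psi> (fmap F T X ?s)"
    unfolding vg[symmetric] sa(1) using o u T w \<phi> by (simp add: F' D'(5))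
  finally show ?thesis
    by (rule is_iso_cancel_right[OF D _ _ _ W_D(2)[OF T(1) o(1) sa(2)] \<phi>, rotated -1]) (use o T in \<open>auto simp: F'\<close>)
qed

text \<open>Two roofs for the same morphism differ by the morphism from \<open>F U\<close> to
  \<open>F V\<close> that is the inverse of \<open>F t\<close> after \<open>F s\<close>. A fraction
  for it gives a common apex \<open>T\<close> over which both pairs of legs agree after applying
  \<open>F\<close>. Two further passages to objects over \<open>T\<close> make them agree in
  \<open>C\<close> itself.\<close>

lemma fractions_related:
  assumes o: "X \<in> Obj C" "Y \<in> Obj C" and \<phi>: "\<phi> \<in> Mor D (fobj F X) (fobj F Y)"
    and U: "(U, s, f) \<in> fractions X Y \<phi>" and V: "(V, t, g) \<in> fractions X Y \<phi>"
  shows "((U, s, f), (V, t, g)) \<in> roof_rel C W X Y"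
proof -
  have u: "U \<in> Obj C" "s \<in> W U X" "f \<in> Mor C U Y" "V \<in> Obj C" "t \<in> W V X" "g \<in> Mor C V Y"
    and uf: "Cmp D (fobj F U) (fobj F X) (fobj F Y) \<phi> (fmap F U X s) = fmap F U Y f"
    and vg: "Cmp D (fobj F V) (fobj F X) (fobj F Y) \<phi> (fmap F V X t) = fmap F V Y g"
    using U V by (auto simp: fractions_def roofs_def)
  note w = W_D(1)[OF u(1) o(1) u(2)] W_D(1)[OF u(4) o(1) u(5)]
  obtain t' where t': "t' \<in> Mor D (fobj F X) (fobj F V)"
    "Cmp D (fobj F X) (fobj F V) (fobj F X) (fmap F V X t) t' = Idn D (fobj F X)"
    using W_D(2)[OF u(4) o(1) u(5)] by (rule is_isoE)
  let ?r = "Cmp D (fobj F U) (fobj F X) (fobj F V) t' (fmap F U X s)"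
  have r: "?r \<in> Mor D (fobj F U) (fobj F V)" using o u w t' by (intro D'(2)) (auto simp: F')
  obtain T a b where T: "T \<in> Obj C" "a \<in> W T U" "b \<in> Mor C T V"
    "Cmp D (fobj F T) (fobj F U) (fobj F V) ?r (fmap F T U a) = fmap F T V b"
    using fraction[OF u(1,4) r] by blast
  note aM = W_D(1)[OF T(1) u(1) T(2)]
  have "fmap F T X (Cmp C T V X t b) = Cmp D (fobj F T) (fobj F U) (fobj F X)
      (Cmp D (fobj F U) (fobj F V) (fobj F X) (fmap F V X t) ?r) (fmap F T U a)"
    using o u w T(1,3) aM r t' by (simp add: F' T(4)[symmetric] D'(5)[symmetric] D'(2))
  also have "Cmp D (fobj F U) (fobj F V) (fobj F X) (fmap F V X t) ?r = fmap F U X s"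
    using o u w t' by (simp add: F' D'(4,5))
  also have "Cmp D (fobj F T) (fobj F U) (fobj F X) (fmap F U X s) (fmap F T U a) = fmap F T X (Cmp C T U X s a)"
    using o u w T aM by (simp add: F')
  finally have eq1: "fmap F T X (Cmp C T V X t b) = fmap F T X (Cmp C T U X s a)" .
  have "fmap F T Y (Cmp C T V Y g b) = Cmp D (fobj F T) (fobj F X) (fobj F Y) \<phi> (fmap F T X (Cmp C T V X t b))"
    using o u w T \<phi> by (simp add: F' vg[symmetric] D'(5))
  also have "\<dots> = fmap F T Y (Cmp C T U Y f a)"
    unfolding eq1 using o u w T aM \<phi> by (simp add: F' uf[symmetric] D'(5))
  finally have eq2: "fmap F T Y (Cmp C T V Y g b) = fmap F T Y (Cmp C T U Y f a)" .
  \<comment> \<open>From equality under \<open>F\<close> to equality in \<open>C\<close>: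
    \<open>p\<close> equalizes the left legs, and \<open>q\<close> below equalizes the right
    legs.\<close>
  obtain T1 p where p: "T1 \<in> Obj C" "p \<in> W T1 T"
    "Cmp C T1 T X (Cmp C T V X t b) p = Cmp C T1 T X (Cmp C T U X s a) p"
    using equalize[OF T(1) o(1) _ _ eq1] o u w T aM C'(2) by metis
  note pM = W_D(1)[OF p(1) T(1) p(2)]
  have "fmap F T1 Y (Cmp C T1 T Y (Cmp C T V Y g b) p) = fmap F T1 Y (Cmp C T1 T Y (Cmp C T U Y f a) p)"
    using o u w T(1,3) aM pM p(1) eq2 by (simp add: F'(4) C'(2))
  then obtain T2 q where q: "T2 \<in> Obj C" "q \<in> W T2 T1"
    "Cmp C T2 T1 Y (Cmp C T1 T Y (Cmp C T V Y g b) p) q = Cmp C T2 T1 Y (Cmp C T1 T Y (Cmp C T U Y f a) p) q"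
    using equalize[of T1 Y "Cmp C T1 T Y (Cmp C T V Y g b) p" "Cmp C T1 T Y (Cmp C T U Y f a) p"] o u w T aM p pM C'(2) by metis
  note qM = W_D(1)[OF q(1) p(1) q(2)]
  let ?p = "Cmp C T2 T1 T p q"
  note pq = W_Cmp[OF q(1) p(1) T(1) q(2) p(2)]
  have "Cmp C T2 U X s (Cmp C T2 T U a ?p) = Cmp C T2 T1 X (Cmp C T1 T X (Cmp C T U X s a) p) q"
    using o u(1,3,4,6) w T(1,3) aM p(1) pM q(1) qM by (simp add: C'(2,5))
  also have "\<dots> = Cmp C T2 V X t (Cmp C T2 T V b ?p)"
    unfolding p(3)[symmetric] using o u(1,3,4,6) w T(1,3) aM p(1) pM q(1) qM by (simp add: C'(2,5))
  finally have 1: "Cmp C T2 U X s (Cmp C T2 T U a ?p) = Cmp C T2 V X t (Cmp C T2 T V b ?p)" .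
  have "Cmp C T2 U Y f (Cmp C T2 T U a ?p) = Cmp C T2 T1 Y (Cmp C T1 T Y (Cmp C T U Y f a) p) q"
    using o u(1,3,4,6) w T(1,3) aM p(1) pM q(1) qM by (simp add: C'(2,5))
  also have "\<dots> = Cmp C T2 V Y g (Cmp C T2 T V b ?p)"
    unfolding q(3)[symmetric] using o u(1,3,4,6) w T(1,3) aM p(1) pM q(1) qM by (simp add: C'(2,5))
  finally have 2: "Cmp C T2 U Y f (Cmp C T2 T U a ?p) = Cmp C T2 V Y g (Cmp C T2 T V b ?p)" .
  have "Cmp C T2 U X s (Cmp C T2 T U a ?p) \<in> W T2 X"
    by (intro W_Cmp pq o u(1,2) T(1,2) q(1))
  moreover have "Cmp C T2 T U a ?p \<in> Mor C T2 U" "Cmp C T2 T V b ?p \<in> Mor C T2 V"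
    using u T p pM q qM aM by (auto intro!: C'(2))
  ultimately show ?thesis
    using U V q(1) 1 2 unfolding roof_rel_def fractions_def by blast
qed

text \<open>The class of a roof is a fibre of the map from roofs to morphisms of \<open>D\<close>.
  Since the quotient consists of the images of single roofs, this describes the hom-sets of the
  localization directly, and \<open>roof_rel\<close> is never treated as an equivalence
  relation.\<close>

lemma roof_rel_image:
  assumes o: "X \<in> Obj C" "Y \<in> Obj C" and \<phi>: "\<phi> \<in> Mor D (fobj F X) (fobj F Y)"
    and r: "r \<in> fractions X Y \<phi>"
  shows "roof_rel C W X Y `` {r} = fractions X Y \<phi>"
proof (intro equalityI subsetI)
  fix r' assume *: "r' \<in> roof_rel C W X Y `` {r}"
  obtain V t g where r': "r' = (V, t, g)" by (cases r')
  have "(V, t, g) \<in> roofs C W X Y" using * r' by (auto simp: roof_rel_def)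
  then obtain \<psi> where \<psi>: "\<psi> \<in> Mor D (fobj F X) (fobj F Y)" "(V, t, g) \<in> fractions X Y \<psi>"
    by (rule roof_in_fractions[OF o])
  moreover have "\<phi> = \<psi>" 
    using * r \<psi> by (cases r) (auto simp: r' intro: fractions_cong[OF o \<phi> \<psi>(1)])
  ultimately show "r' \<in> fractions X Y \<phi>" by (simp add: r')
next
  fix r' assume "r' \<in> fractions X Y \<phi>"
  then show "r' \<in> roof_rel C W X Y `` {r}"
    using fractions_related[OF o \<phi>] r by (cases r, cases r') auto
qed

lemma Mor_localization:
  assumes o: "X \<in> Obj C" "Y \<in> Obj C"
  shows "Mor (localization C W) X Y = fractions X Y ` Mor D (fobj F X) (fobj F Y)"
proof -
  have "\<alpha> \<in> fractions X Y ` Mor D (fobj F X) (fobj F Y)" if \<alpha>: "\<alpha> \<in> roofs C W X Y // roof_rel C W X Y" for \<alpha>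
  proof -
    obtain r where "r \<in> roofs C W X Y" "\<alpha> = roof_rel C W X Y `` {r}"
      using \<alpha> unfolding quotient_def by blast
    then obtain U s f where r: "(U, s, f) \<in> roofs C W X Y" "\<alpha> = roof_rel C W X Y `` {(U, s, f)}"
      by (cases r) blast
    show ?thesis
      by (rule roof_in_fractions[OF o r(1)]) (auto simp: r(2) roof_rel_image[OF o])
  qed
  moreover have "fractions X Y \<phi> \<in> roofs C W X Y // roof_rel C W X Y" if \<phi>: "\<phi> \<in> Mor D (fobj F X) (fobj F Y)" for \<phi>
  proof -
    obtain U s f where r: "(U, s, f) \<in> fractions X Y \<phi>" by (rule fractions_nonempty[OF o \<phi>])
    then have "(U, s, f) \<in> roofs C W X Y" by (simp add: fractions_def)
    then have "roof_rel C W X Y `` {(U, s, f)} \<in> roofs C W X Y // roof_rel C W X Y" by (rule quotientI)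
    then show ?thesis by (simp add: roof_rel_image[OF o \<phi> r])
  qed
  ultimately show ?thesis unfolding localization_def by auto
qed

lemma fractions_inj:
  assumes o: "X \<in> Obj C" "Y \<in> Obj C" and \<phi>: "\<phi> \<in> Mor D (fobj F X) (fobj F Y)" "\<psi> \<in> Mor D (fobj F X) (fobj F Y)"
    and "fractions X Y \<phi> = fractions X Y \<psi>"
  shows "\<phi> = \<psi>"
proof -
  obtain U s f where r: "(U, s, f) \<in> fractions X Y \<phi>" by (rule fractions_nonempty[OF o \<phi>(1)])
  then show ?thesis
    using fractions_cong[OF o \<phi> fractions_related[OF o \<phi>(1) r r] r] assms(5) by simp
qed

lemma Idn_localization:
  assumes "X \<in> Obj C"
  shows "Idn (localization C W) X = fractions X X (Idn D (fobj F X))"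
proof -
  have "(X, Idn C X, Idn C X) \<in> fractions X X (Idn D (fobj F X))"
    using assms by (simp add: fractions_def roofs_def W_Idn C' F' D')
  then show ?thesis
    using roof_rel_image[OF assms assms D'(1)[OF F'(1)[OF assms]]] by (simp add: localization_def)
qed

text \<open>Every composite of representatives represents the composite morphism. The image of the
  set of composites is therefore the fibre over that morphism as soon as some composite
  exists.\<close>

lemma Cmp_localization:
  assumes o: "X \<in> Obj C" "Y \<in> Obj C" "Z \<in> Obj C"
    and \<phi>: "\<phi> \<in> Mor D (fobj F X) (fobj F Y)" and \<psi>: "\<psi> \<in> Mor D (fobj F Y) (fobj F Z)"
  shows "Cmp (localization C W) X Y Z (fractions Y Z \<psi>) (fractions X Y \<phi>) =
    fractions X Z (Cmp D (fobj F X) (fobj F Y) (fobj F Z) \<psi> \<phi>)"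
proof -
  let ?\<chi> = "Cmp D (fobj F X) (fobj F Y) (fobj F Z) \<psi> \<phi>"
  let ?S = "roof_composites C W X Y Z (fractions Y Z \<psi>) (fractions X Y \<phi>)"
  have \<chi>: "?\<chi> \<in> Mor D (fobj F X) (fobj F Z)" using o \<phi> \<psi> by (intro D'(2)) (auto simp: F')
  have sub: "?S \<subseteq> fractions X Z ?\<chi>"
  proof
    fix r assume "r \<in> ?S"
    then obtain T U V s t' g f' f t where r: "r = (T, Cmp C T U X s t', Cmp C T V Z g f')"
      and U: "(U, s, f) \<in> fractions X Y \<phi>" and V: "(V, t, g) \<in> fractions Y Z \<psi>"
      and T: "T \<in> Obj C" "t' \<in> W T U" "f' \<in> Mor C T V"
      and eq: "Cmp C T U Y f t' = Cmp C T V Y t f'"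
      unfolding roof_composites_def by blast
    have u: "U \<in> Obj C" "s \<in> W U X" "f \<in> Mor C U Y" "V \<in> Obj C" "t \<in> W V Y" "g \<in> Mor C V Z"
      and uf: "Cmp D (fobj F U) (fobj F X) (fobj F Y) \<phi> (fmap F U X s) = fmap F U Y f"
      and vg: "Cmp D (fobj F V) (fobj F Y) (fobj F Z) \<psi> (fmap F V Y t) = fmap F V Z g"
      using U V by (auto simp: fractions_def roofs_def)
    note w = W_D(1)[OF u(1) o(1) u(2)] W_D(1)[OF u(4) o(2) u(5)] W_D(1)[OF T(1) u(1) T(2)]
    have "Cmp D (fobj F T) (fobj F X) (fobj F Z) ?\<chi> (fmap F T X (Cmp C T U X s t')) =
      Cmp D (fobj F T) (fobj F Y) (fobj F Z) \<psi> (Cmp D (fobj F T) (fobj F U) (fobj F Y)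
        (Cmp D (fobj F U) (fobj F X) (fobj F Y) \<phi> (fmap F U X s)) (fmap F T U t'))"
      using o u T(1,3) w \<phi> \<psi> by (simp add: F' D'(5)[symmetric] D'(2))
    also have "\<dots> = Cmp D (fobj F T) (fobj F Y) (fobj F Z) \<psi> (fmap F T Y (Cmp C T V Y t f'))"
      using o u T(1,3) w by (simp add: uf F' eq[symmetric])
    also have "\<dots> = fmap F T Z (Cmp C T V Z g f')"
      using o u T(1,3) w \<psi> by (simp add: F' vg[symmetric] D'(5))
    finally show "r \<in> fractions X Z ?\<chi>"
      using o u T w by (auto simp: r fractions_def roofs_def intro!: W_Cmp C'(2))
  qed
  \<comment> \<open>An empty set of composites would have an empty image, which is no morphism; so
    one completing square has to be found.\<close>
  have "?S \<noteq> {}"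
  proof -
    obtain U s f where U: "(U, s, f) \<in> fractions X Y \<phi>" by (rule fractions_nonempty[OF o(1,2) \<phi>])
    obtain V t g where V: "(V, t, g) \<in> fractions Y Z \<psi>" by (rule fractions_nonempty[OF o(2,3) \<psi>])
    have u: "U \<in> Obj C" "s \<in> W U X" "f \<in> Mor C U Y" "V \<in> Obj C" "t \<in> W V Y" "g \<in> Mor C V Z"
      using U V by (auto simp: fractions_def roofs_def)
    note w = W_D(1)[OF u(1) o(1) u(2)] W_D(1)[OF u(4) o(2) u(5)]
    obtain i where i: "i \<in> Mor D (fobj F Y) (fobj F V)"
      "Cmp D (fobj F Y) (fobj F V) (fobj F Y) (fmap F V Y t) i = Idn D (fobj F Y)"
      using W_D(2)[OF u(4) o(2) u(5)] by (rule is_isoE)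
    \<comment> \<open>The inverse of \<open>F t\<close> after \<open>F f\<close>. A fraction for it
      completes the square up to \<open>F\<close>, and \<open>equalize\<close> then makes it commute
      in \<open>C\<close>.\<close>
    let ?r = "Cmp D (fobj F U) (fobj F Y) (fobj F V) i (fmap F U Y f)"
    have r: "?r \<in> Mor D (fobj F U) (fobj F V)" using o u i by (intro D'(2)) (auto simp: F')
    obtain T a b where T: "T \<in> Obj C" "a \<in> W T U" "b \<in> Mor C T V"
      "Cmp D (fobj F T) (fobj F U) (fobj F V) ?r (fmap F T U a) = fmap F T V b"
      using fraction[OF u(1,4) r] by blast
    note aM = W_D(1)[OF T(1) u(1) T(2)]
    have "fmap F T Y (Cmp C T V Y t b) = Cmp D (fobj F T) (fobj F U) (fobj F Y)
        (Cmp D (fobj F U) (fobj F V) (fobj F Y) (fmap F V Y t) ?r) (fmap F T U a)"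
      using o u w T(1,3) aM r i by (simp add: F' T(4)[symmetric] D'(5)[symmetric] D'(2))
    also have "Cmp D (fobj F U) (fobj F V) (fobj F Y) (fmap F V Y t) ?r = fmap F U Y f"
      using o u w i by (simp add: F' D'(4,5))
    also have "Cmp D (fobj F T) (fobj F U) (fobj F Y) (fmap F U Y f) (fmap F T U a) = fmap F T Y (Cmp C T U Y f a)"
      using o u w T aM by (simp add: F')
    finally have "fmap F T Y (Cmp C T U Y f a) = fmap F T Y (Cmp C T V Y t b)" by simp
    then obtain T1 p where p: "T1 \<in> Obj C" "p \<in> W T1 T"
      "Cmp C T1 T Y (Cmp C T U Y f a) p = Cmp C T1 T Y (Cmp C T V Y t b) p"
      using equalize[of T Y "Cmp C T U Y f a" "Cmp C T V Y t b"] o u w T aM C'(2) by metis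
    note pM = W_D(1)[OF p(1) T(1) p(2)]
    have "Cmp C T1 U Y f (Cmp C T1 T U a p) = Cmp C T1 V Y t (Cmp C T1 T V b p)"
      using p(3) o u(1,3,4,6) w T(1,3) aM p(1) pM by (simp add: C'(5))
    moreover have "Cmp C T1 T U a p \<in> W T1 U" "Cmp C T1 T V b p \<in> Mor C T1 V"
      using u T p pM by (auto intro!: C'(2) W_Cmp)
    ultimately show ?thesis using U V p(1) unfolding roof_composites_def by blast
  qed
  moreover have "roof_rel C W X Z `` ?S = (\<Union>r\<in>?S. roof_rel C W X Z `` {r})" by auto
  moreover have "roof_rel C W X Z `` {r} = fractions X Z ?\<chi>" if "r \<in> ?S" for r
    using roof_rel_image[OF o(1,3) \<chi>] sub that by blast
  ultimately show ?thesis by (simp add: localization_def)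
qed

lemma Obj_localization: "Obj (localization C W) = Obj C"
  by (simp add: localization_def)

lemma is_category_localization: "is_category (localization C W)"
  unfolding is_category_def Obj_localization
  by (auto simp: Mor_localization Idn_localization Cmp_localization F' D')

text \<open>\<open>fractions X Y\<close> is a bijection from morphisms of \<open>D\<close> to
  morphisms of the localization; the functor is its inverse on morphisms and \<open>F\<close> on
  objects.\<close>

definition localization_functor :: "('o, ('o \<times> 'm \<times> 'm) set, 'p, 'n) fnctr" where
  "localization_functor = \<lparr>fobj = fobj F, 
     fmap = (\<lambda>X Y \<alpha>. THE \<phi>. \<phi> \<in> Mor D (fobj F X) (fobj F Y) \<and> \<alpha> = fractions X Y \<phi>)\<rparr>"

lemma fmap_localization_functor:
  assumes o: "X \<in> Obj C" "Y \<in> Obj C" and \<phi>: "\<phi> \<in> Mor D (fobj F X) (fobj F Y)"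
  shows "fmap localization_functor X Y (fractions X Y \<phi>) = \<phi>"
  unfolding localization_functor_def fnctr.simps
  by (rule the_equality) (use o \<phi> in \<open>auto dest: fractions_inj\<close>)

lemma fobj_localization_functor [simp]: "fobj localization_functor = fobj F"
  by (simp add: localization_functor_def)

lemma fully_faithful_localization_functor: "fully_faithful (localization C W) D localization_functor"
  unfolding fully_faithful_def is_functor_def Obj_localization fobj_localization_functor
proof (intro conjI ballI)
  fix X Y assume o: "X \<in> Obj C" "Y \<in> Obj C"
  show "bij_betw (fmap localization_functor X Y) (Mor (localization C W) X Y) (Mor D (fobj F X) (fobj F Y))"
    by (rule bij_betw_byWitness[where f' = "fractions X Y"])
      (use o in \<open>auto simp: Mor_localization fmap_localization_functor\<close>)
qed (auto simp: Mor_localization Idn_localization Cmp_localization F' D' fmap_localization_functor)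

lemma essentially_surjective_localization_functor:
  "essentially_surjective C D F \<Longrightarrow> essentially_surjective (localization C W) D localization_functor"
  by (simp add: essentially_surjective_def Obj_localization)

end

section \<open>Modules\<close>

lemma module_category_simps [simp]:
  "Obj (module_category S) = {M. left_module S M}"
  "Mor (module_category S) = linear_maps S"
  "Cmp (module_category S) M N P g f = compose (carrier M) g f"
  "Idn (module_category S) M = (\<lambda>x\<in>carrier M. x)"
  by (simp_all add: module_category_def)

lemma linear_mapsD:
  assumes "f \<in> linear_maps S M N"
  shows "f \<in> carrier M \<rightarrow>\<^sub>E carrier N"
    and linear_maps_closed: "x \<in> carrier M \<Longrightarrow> f x \<in> carrier N"
    and linear_maps_add: "x \<in> carrier M \<Longrightarrow> y \<in> carrier M \<Longrightarrow> f (x \<oplus>\<^bsub>M\<^esub> y) = f x \<oplus>\<^bsub>N\<^esub> f y"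
    and linear_maps_smult: "a \<in> carrier S \<Longrightarrow> x \<in> carrier M \<Longrightarrow> f (a \<odot>\<^bsub>M\<^esub> x) = a \<odot>\<^bsub>N\<^esub> f x"
    and linear_maps_extensional: "f \<in> extensional (carrier M)"
  using assms unfolding linear_maps_def by (auto simp: PiE_def)

lemma linear_mapsI:
  assumes "f \<in> extensional (carrier M)"
    and "\<And>x. x \<in> carrier M \<Longrightarrow> f x \<in> carrier N"
    and "\<And>x y. x \<in> carrier M \<Longrightarrow> y \<in> carrier M \<Longrightarrow> f (x \<oplus>\<^bsub>M\<^esub> y) = f x \<oplus>\<^bsub>N\<^esub> f y"
    and "\<And>a x. a \<in> carrier S \<Longrightarrow> x \<in> carrier M \<Longrightarrow> f (a \<odot>\<^bsub>M\<^esub> x) = a \<odot>\<^bsub>N\<^esub> f x"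
  shows "f \<in> linear_maps S M N"
  using assms unfolding linear_maps_def by (auto simp: PiE_def)

lemma left_moduleD:
  assumes "left_module S M"
  shows "ring S" "abelian_group M"
    and left_module_smult_closed: "a \<in> carrier S \<Longrightarrow> x \<in> carrier M \<Longrightarrow> a \<odot>\<^bsub>M\<^esub> x \<in> carrier M"
    and left_module_smult_l_distr: "a \<in> carrier S \<Longrightarrow> b \<in> carrier S \<Longrightarrow> x \<in> carrier M \<Longrightarrow>
      (a \<oplus>\<^bsub>S\<^esub> b) \<odot>\<^bsub>M\<^esub> x = a \<odot>\<^bsub>M\<^esub> x \<oplus>\<^bsub>M\<^esub> b \<odot>\<^bsub>M\<^esub> x"
    and left_module_smult_r_distr: "a \<in> carrier S \<Longrightarrow> x \<in> carrier M \<Longrightarrow> y \<in> carrier M \<Longrightarrow>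
      a \<odot>\<^bsub>M\<^esub> (x \<oplus>\<^bsub>M\<^esub> y) = a \<odot>\<^bsub>M\<^esub> x \<oplus>\<^bsub>M\<^esub> a \<odot>\<^bsub>M\<^esub> y"
    and left_module_smult_assoc: "a \<in> carrier S \<Longrightarrow> b \<in> carrier S \<Longrightarrow> x \<in> carrier M \<Longrightarrow>
      (a \<otimes>\<^bsub>S\<^esub> b) \<odot>\<^bsub>M\<^esub> x = a \<odot>\<^bsub>M\<^esub> (b \<odot>\<^bsub>M\<^esub> x)"
    and left_module_smult_one: "x \<in> carrier M \<Longrightarrow> \<one>\<^bsub>S\<^esub> \<odot>\<^bsub>M\<^esub> x = x"
  using assms unfolding left_module_def module_axioms_def by auto

lemma left_module_zero:
  assumes M: "left_module S M" and x: "x \<in> carrier M"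
  shows "\<zero>\<^bsub>S\<^esub> \<odot>\<^bsub>M\<^esub> x = \<zero>\<^bsub>M\<^esub>"
proof -
  interpret S: ring S by (rule left_moduleD(1)[OF M])
  interpret M: abelian_group M by (rule left_moduleD(2)[OF M])
  have "\<zero>\<^bsub>S\<^esub> \<odot>\<^bsub>M\<^esub> x \<oplus>\<^bsub>M\<^esub> \<zero>\<^bsub>S\<^esub> \<odot>\<^bsub>M\<^esub> x = \<zero>\<^bsub>S\<^esub> \<odot>\<^bsub>M\<^esub> x"
    using left_module_smult_l_distr[OF M, of "\<zero>\<^bsub>S\<^esub>" "\<zero>\<^bsub>S\<^esub>" x] x by simp
  then show ?thesis
    using left_module_smult_closed[OF M S.zero_closed x] by (metis M.add.r_cancel_one')
qed

lemma is_category_module_category: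
  fixes S :: "'k ring"
  shows "is_category (module_category S :: (('k, 'u) module, 'u \<Rightarrow> 'u) cat)"
  unfolding is_category_def module_category_simps
proof (intro conjI ballI)
  fix M :: "('k, 'u) module" assume "M \<in> {M. left_module S M}"
  then have M: "left_module S M" by simp
  interpret M: abelian_group M by (rule left_moduleD(2)[OF M])
  show "(\<lambda>x\<in>carrier M. x) \<in> linear_maps S M M"
    by (auto simp: linear_maps_def left_module_smult_closed[OF M])
next
  fix M N P :: "('k, 'u) module" and f g
  assume *: "M \<in> {M. left_module S M}" "f \<in> linear_maps S M N" "g \<in> linear_maps S N P"
  then have M: "left_module S M" by simp
  interpret M: abelian_group M by (rule left_moduleD(2)[OF M])
  show "compose (carrier M) g f \<in> linear_maps S M P"
    by (rule linear_mapsI)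
      (auto simp: compose_def left_module_smult_closed[OF M] linear_mapsD(2-4)[OF *(2)] linear_mapsD(2-4)[OF *(3)])
next
  fix M N P Q :: "('k, 'u) module" and f g h
  assume *: "f \<in> linear_maps S M N" 
  then show "compose (carrier M) f (\<lambda>x\<in>carrier M. x) = f"
    by (intro extensionalityI[OF _ linear_maps_extensional[OF *]]) (auto simp: compose_def)
  show "compose (carrier M) (\<lambda>x\<in>carrier N. x) f = f"
    by (intro extensionalityI[OF _ linear_maps_extensional[OF *]])
      (auto simp: compose_def linear_maps_closed[OF *])
  show "compose (carrier M) h (compose (carrier M) g f) = compose (carrier M) (compose (carrier N) h g) f"
    by (auto simp: compose_def fun_eq_iff linear_maps_closed[OF *])
qed

lemma linear_maps_zero:
  assumes M: "abelian_group M" and N: "abelian_group N" and f: "f \<in> linear_maps S M N"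
  shows "f \<zero>\<^bsub>M\<^esub> = \<zero>\<^bsub>N\<^esub>"
proof -
  interpret M: abelian_group M by (rule M)
  interpret N: abelian_group N by (rule N)
  have "f \<zero>\<^bsub>M\<^esub> \<oplus>\<^bsub>N\<^esub> f \<zero>\<^bsub>M\<^esub> = f \<zero>\<^bsub>M\<^esub>"
    using linear_maps_add[OF f, of "\<zero>\<^bsub>M\<^esub>" "\<zero>\<^bsub>M\<^esub>"] by simp
  then show ?thesis using linear_maps_closed[OF f M.zero_closed] by (metis N.add.r_cancel_one')
qed

lemma linear_maps_neg:
  assumes M: "abelian_group M" and N: "abelian_group N" and f: "f \<in> linear_maps S M N" and x: "x \<in> carrier M"
  shows "f (\<ominus>\<^bsub>M\<^esub> x) = \<ominus>\<^bsub>N\<^esub> f x"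
proof -
  interpret M: abelian_group M by (rule M)
  interpret N: abelian_group N by (rule N)
  have "f (\<ominus>\<^bsub>M\<^esub> x) \<oplus>\<^bsub>N\<^esub> f x = \<zero>\<^bsub>N\<^esub>"
    using linear_maps_add[OF f, of "\<ominus>\<^bsub>M\<^esub> x" x] x linear_maps_zero[OF M N f] by (simp add: M.l_neg)
  then show ?thesis using x linear_maps_closed[OF f]
    by (metis M.a_inv_closed N.add.m_comm N.minus_equality)
qed

lemma linear_maps_minus:
  assumes M: "abelian_group M" and N: "abelian_group N" and f: "f \<in> linear_maps S M N"
    and x: "x \<in> carrier M" and y: "y \<in> carrier M"
  shows "f (x \<ominus>\<^bsub>M\<^esub> y) = f x \<ominus>\<^bsub>N\<^esub> f y"
  using x y linear_maps_neg[OF M N f y] abelian_group.a_inv_closed[OF M y]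
  by (simp add: a_minus_def linear_maps_add[OF f])

lemma is_iso_module_category_iff:
  assumes M: "left_module S M" and N: "left_module S N" and f: "f \<in> linear_maps S M N"
  shows "is_iso (module_category S) M N f \<longleftrightarrow> bij_betw f (carrier M) (carrier N)"
proof
  assume "is_iso (module_category S) M N f"
  then obtain g where g: "g \<in> linear_maps S N M" "compose (carrier M) g f = (\<lambda>x\<in>carrier M. x)"
     "compose (carrier N) f g = (\<lambda>x\<in>carrier N. x)"
    by (auto simp: is_iso_def)
  show "bij_betw f (carrier M) (carrier N)"
  proof (rule bij_betw_byWitness[where f' = g])
    show "\<forall>a\<in>carrier M. g (f a) = a" using g(2) by (metis compose_eq restrict_apply')
    show "\<forall>a\<in>carrier N. f (g a) = a" using g(3) by (metis compose_eq restrict_apply')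
  qed (use f g in \<open>auto simp: linear_maps_closed\<close>)
next
  assume b: "bij_betw f (carrier M) (carrier N)"
  interpret M: abelian_group M by (rule left_moduleD(2)[OF M])
  interpret N: abelian_group N by (rule left_moduleD(2)[OF N])
  let ?g = "\<lambda>y\<in>carrier N. inv_into (carrier M) f y"
  have img: "f ` carrier M = carrier N" and inj: "inj_on f (carrier M)" using b by (auto simp: bij_betw_def)
  have g: "?g y \<in> carrier M" "f (?g y) = y" if "y \<in> carrier N" for y
    using that inv_into_into[of y f "carrier M"] f_inv_into_f[of y f "carrier M"] img by auto
  have gf: "?g (f x) = x" if "x \<in> carrier M" for x
    using that inj linear_maps_closed[OF f] by simp
  have "?g \<in> linear_maps S N M"
  proof (rule linear_mapsI)
    show "?g (x \<oplus>\<^bsub>N\<^esub> y) = ?g x \<oplus>\<^bsub>M\<^esub> ?g y" if "x \<in> carrier N" "y \<in> carrier N" for x y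
      using that g linear_maps_add[OF f g(1)[OF that(1)] g(1)[OF that(2)]] gf[of "?g x \<oplus>\<^bsub>M\<^esub> ?g y"] M.a_closed
      by metis
    show "?g (a \<odot>\<^bsub>N\<^esub> x) = a \<odot>\<^bsub>M\<^esub> ?g x" if "a \<in> carrier S" "x \<in> carrier N" for a x
      using that g linear_maps_smult[OF f that(1) g(1)[OF that(2)]] gf[of "a \<odot>\<^bsub>M\<^esub> ?g x"] left_module_smult_closed[OF M]
      by metis
  qed (use g in auto)
  moreover have "compose (carrier M) ?g f = (\<lambda>x\<in>carrier M. x)" "compose (carrier N) f ?g = (\<lambda>x\<in>carrier N. x)"
    using gf g by (auto simp: compose_def)
  ultimately show "is_iso (module_category S) M N f"
    using f by (auto simp: is_iso_def)
qed

section \<open>Submodules, and module structures transported along a map\<close>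

lemma submodule_if_closed:
  assumes M: "module R M" and sub: "S \<subseteq> carrier M" and zero: "\<zero>\<^bsub>M\<^esub> \<in> S"
    and add: "\<And>x y. x \<in> S \<Longrightarrow> y \<in> S \<Longrightarrow> x \<oplus>\<^bsub>M\<^esub> y \<in> S"
    and smult: "\<And>c x. c \<in> carrier R \<Longrightarrow> x \<in> S \<Longrightarrow> c \<odot>\<^bsub>M\<^esub> x \<in> S"
  shows "submodule S R M"
proof -
  interpret M: module R M by (rule M)
  show ?thesis
  proof (rule M.submoduleI[OF sub zero _ add smult])
    fix a assume "a \<in> S"
    then show "\<ominus>\<^bsub>M\<^esub> a \<in> S"
      using smult[of "\<ominus>\<^bsub>R\<^esub> \<one>\<^bsub>R\<^esub>" a] sub M.smult_l_minus[of "\<one>\<^bsub>R\<^esub>" a] by auto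
  qed
qed

text \<open>The structure transported along a map whose fibres form a congruence, computed on
  preimages chosen by \<open>inv_into\<close>. When \<open>q\<close> picks a representative of each
  coset, this is a quotient module whose carrier is a set of representatives.\<close>

definition image_module :: "('v \<Rightarrow> 'u) \<Rightarrow> ('k, 'v) module \<Rightarrow> ('k, 'u) module" where
  "image_module q N = \<lparr>carrier = q ` carrier N, mult = undefined, one = undefined, ring.zero = q \<zero>\<^bsub>N\<^esub>,
     add = (\<lambda>x y. q (inv_into (carrier N) q x \<oplus>\<^bsub>N\<^esub> inv_into (carrier N) q y)),
     smult = (\<lambda>c x. q (c \<odot>\<^bsub>N\<^esub> inv_into (carrier N) q x))\<rparr>"

lemma image_module_simps [simp]: "carrier (image_module q N) = q ` carrier N"
  "\<zero>\<^bsub>image_module q N\<^esub> = q \<zero>\<^bsub>N\<^esub>"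
  by (simp_all add: image_module_def)

context
  fixes R :: "'k ring" and N :: "('k, 'v) module" and q :: "'v \<Rightarrow> 'u"
  assumes N: "module R N"
    and add_cong: "\<And>x y z. x \<in> carrier N \<Longrightarrow> y \<in> carrier N \<Longrightarrow> z \<in> carrier N \<Longrightarrow> q x = q y \<Longrightarrow>
      q (x \<oplus>\<^bsub>N\<^esub> z) = q (y \<oplus>\<^bsub>N\<^esub> z)"
    and smult_cong: "\<And>c x y. c \<in> carrier R \<Longrightarrow> x \<in> carrier N \<Longrightarrow> y \<in> carrier N \<Longrightarrow> q x = q y \<Longrightarrow>
      q (c \<odot>\<^bsub>N\<^esub> x) = q (c \<odot>\<^bsub>N\<^esub> y)"
begin

interpretation N: module R N by (rule N)

lemma inv_image:
  assumes "x \<in> carrier N"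
  shows "inv_into (carrier N) q (q x) \<in> carrier N" "q (inv_into (carrier N) q (q x)) = q x"
  using assms by (auto intro: inv_into_into f_inv_into_f)

text \<open>\<open>add_cong\<close> exchanges only the left summand; commutativity brings the other
  summand to the left.\<close>

lemma image_module_add:
  assumes "x \<in> carrier N" "y \<in> carrier N"
  shows "q x \<oplus>\<^bsub>image_module q N\<^esub> q y = q (x \<oplus>\<^bsub>N\<^esub> y)"
proof -
  let ?i = "inv_into (carrier N) q"
  note i = inv_image[OF assms(1)] inv_image[OF assms(2)]
  have "q (?i (q x) \<oplus>\<^bsub>N\<^esub> ?i (q y)) = q (x \<oplus>\<^bsub>N\<^esub> ?i (q y))"
    using assms i by (intro add_cong)
  also have "\<dots> = q (?i (q y) \<oplus>\<^bsub>N\<^esub> x)" using assms i by (simp add: N.M.a_comm)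
  also have "\<dots> = q (y \<oplus>\<^bsub>N\<^esub> x)" using assms i by (intro add_cong)
  also have "\<dots> = q (x \<oplus>\<^bsub>N\<^esub> y)" using assms by (simp add: N.M.a_comm)
  finally show ?thesis by (simp add: image_module_def)
qed

lemma image_module_smult:
  assumes "c \<in> carrier R" "x \<in> carrier N"
  shows "c \<odot>\<^bsub>image_module q N\<^esub> q x = q (c \<odot>\<^bsub>N\<^esub> x)"
  using smult_cong[OF assms(1) inv_image(1)[OF assms(2)] assms(2) inv_image(2)[OF assms(2)]]
  by (simp add: image_module_def)

lemma module_image_module: "module R (image_module q N)"
proof (rule moduleI[OF N.R.is_cring])
  show "abelian_group (image_module q N)"
  proof (rule abelian_groupI)
    fix x assume "x \<in> carrier (image_module q N)"
    then obtain n where n: "n \<in> carrier N" "x = q n" by auto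
    then show "\<exists>y\<in>carrier (image_module q N). y \<oplus>\<^bsub>image_module q N\<^esub> x = \<zero>\<^bsub>image_module q N\<^esub>"
      by (intro bexI[of _ "q (\<ominus>\<^bsub>N\<^esub> n)"]) (auto simp: image_module_add N.M.l_neg)
  qed (auto simp: image_module_add N.M.a_ac)
qed (auto simp: image_module_add image_module_smult N.smult_l_distr N.smult_r_distr N.smult_assoc1)

end

section \<open>Monoid algebras\<close>

text \<open>The monomial \<open>c g\<close>. Arbitrary coefficients are allowed because every
  element of the monoid algebra is a finite sum of such monomials.\<close>

definition scaled_basis_element :: "'k ring \<Rightarrow> 'k \<Rightarrow> 'g \<Rightarrow> ('g \<Rightarrow> 'k)" where
  "scaled_basis_element R c g = (\<lambda>h. if h = g then c else \<zero>\<^bsub>R\<^esub>)"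

locale monoid_algebra_setup = R: cring R + G: monoid G
  for R :: "'k ring" and G :: "'g monoid"
begin

abbreviation "RG \<equiv> monoid_algebra R G"
abbreviation "e \<equiv> scaled_basis_element R"
abbreviation "supp a \<equiv> {g. a g \<noteq> \<zero>\<^bsub>R\<^esub>}"

lemma carrier_iff: "a \<in> carrier RG \<longleftrightarrow> (\<forall>g. a g \<in> carrier R) \<and> finite (supp a) \<and> supp a \<subseteq> carrier G"
  by (simp add: monoid_algebra_def)

lemma RG_simps: "\<zero>\<^bsub>RG\<^esub> = (\<lambda>h. \<zero>\<^bsub>R\<^esub>)" "\<one>\<^bsub>RG\<^esub> = e \<one>\<^bsub>R\<^esub> \<one>\<^bsub>G\<^esub>" "a \<oplus>\<^bsub>RG\<^esub> b = (\<lambda>h. a h \<oplus>\<^bsub>R\<^esub> b h)"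
  by (simp_all add: monoid_algebra_def scaled_basis_element_def fun_eq_iff)

lemma basis_in [simp]: "c \<in> carrier R \<Longrightarrow> g \<in> carrier G \<Longrightarrow> e c g \<in> carrier RG"
  by (auto simp: carrier_iff scaled_basis_element_def intro: finite_subset[of _ "{g}"])

lemma add_closed: "a \<in> carrier RG \<Longrightarrow> b \<in> carrier RG \<Longrightarrow> a \<oplus>\<^bsub>RG\<^esub> b \<in> carrier RG"
proof -
  assume *: "a \<in> carrier RG" "b \<in> carrier RG"
  have "supp (a \<oplus>\<^bsub>RG\<^esub> b) \<subseteq> supp a \<union> supp b" by (auto simp: RG_simps)
  then show ?thesis using * finite_subset[of "supp (a \<oplus>\<^bsub>RG\<^esub> b)" "supp a \<union> supp b"]
    by (auto simp: carrier_iff RG_simps)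
qed

text \<open>One point at a time is split off a finite set that contains the support. Identities that
  are additive in an argument are thereby reduced to monomials.\<close>

lemma induct [consumes 1, case_names zero basis add]:
  assumes "a \<in> carrier RG"
    and z: "P \<zero>\<^bsub>RG\<^esub>" and b: "\<And>c g. c \<in> carrier R \<Longrightarrow> g \<in> carrier G \<Longrightarrow> P (e c g)"
    and add: "\<And>a b. a \<in> carrier RG \<Longrightarrow> b \<in> carrier RG \<Longrightarrow> P a \<Longrightarrow> P b \<Longrightarrow> P (a \<oplus>\<^bsub>RG\<^esub> b)"
  shows "P a"
proof -
  have "P a" if "finite S" "a \<in> carrier RG" "supp a \<subseteq> S" for S a
    using that
  proof (induction S arbitrary: a)
    case empty
    then have "a = \<zero>\<^bsub>RG\<^esub>" by (auto simp: RG_simps)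
    then show ?case using z by simp
  next
    case (insert g S)
    let ?b = "\<lambda>h. if h = g then \<zero>\<^bsub>R\<^esub> else a h"
    have sub: "supp ?b \<subseteq> S" "supp ?b \<subseteq> supp a" using insert.prems by auto
    then have b': "?b \<in> carrier RG" using insert.prems finite_subset[OF sub(2)] by (auto simp: carrier_iff)
    have "P (e (a g) g)"
    proof (cases "a g = \<zero>\<^bsub>R\<^esub>")
      case True
      then have "e (a g) g = \<zero>\<^bsub>RG\<^esub>" by (auto simp: RG_simps scaled_basis_element_def)
      then show ?thesis using z by simp
    next
      case False
      then show ?thesis using insert.prems by (intro b) (auto simp: carrier_iff)
    qed
    moreover have "a = e (a g) g \<oplus>\<^bsub>RG\<^esub> ?b"
      using insert.prems by (auto simp: RG_simps scaled_basis_element_def carrier_iff)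
    moreover have "e (a g) g \<in> carrier RG"
      using insert.prems by (auto simp: carrier_iff scaled_basis_element_def)
    ultimately show ?case using add[OF _ b', of "e (a g) g"] insert.IH[OF b' sub(1)] by simp
  qed
  then show ?thesis using assms(1) by (auto simp: carrier_iff)
qed

text \<open>The sum in the definition runs over the supports, which change with the factors. Over a
  fixed finite rectangle \<open>S \<times> T\<close> that contains them, products with different
  factors can be compared term by term, as the distributive laws require.\<close>

lemma mult_eq:
  assumes a: "a \<in> carrier RG" and b: "b \<in> carrier RG" and S: "finite S" "supp a \<subseteq> S" and T: "finite T" "supp b \<subseteq> T"
  shows "(a \<otimes>\<^bsub>RG\<^esub> b) h = (\<Oplus>\<^bsub>R\<^esub>p\<in>{(f, g) \<in> S \<times> T. f \<otimes>\<^bsub>G\<^esub> g = h}. a (fst p) \<otimes>\<^bsub>R\<^esub> b (snd p))"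
proof -
  have "(a \<otimes>\<^bsub>RG\<^esub> b) h = (\<Oplus>\<^bsub>R\<^esub>p\<in>{(f, g). a f \<noteq> \<zero>\<^bsub>R\<^esub> \<and> b g \<noteq> \<zero>\<^bsub>R\<^esub> \<and> f \<otimes>\<^bsub>G\<^esub> g = h}. a (fst p) \<otimes>\<^bsub>R\<^esub> b (snd p))"
    by (simp add: monoid_algebra_def case_prod_unfold)
  also have "\<dots> = (\<Oplus>\<^bsub>R\<^esub>p\<in>{(f, g) \<in> S \<times> T. f \<otimes>\<^bsub>G\<^esub> g = h}. a (fst p) \<otimes>\<^bsub>R\<^esub> b (snd p))"
    using a b S T
    by (intro R.add.finprod_mono_neutral_cong_left)
      (auto simp: carrier_iff intro: finite_subset[OF _ finite_cartesian_product[OF S(1) T(1)]])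
  finally show ?thesis .
qed

lemma mult_in_R: "a \<in> carrier RG \<Longrightarrow> b \<in> carrier RG \<Longrightarrow> (a \<otimes>\<^bsub>RG\<^esub> b) h \<in> carrier R"
  by (simp add: monoid_algebra_def) (rule R.finsum_closed, auto)

lemma mult_closed:
  assumes "a \<in> carrier RG" "b \<in> carrier RG"
  shows "a \<otimes>\<^bsub>RG\<^esub> b \<in> carrier RG"
proof -
  let ?I = "(\<lambda>(f, g). f \<otimes>\<^bsub>G\<^esub> g) ` (supp a \<times> supp b)"
  have sub: "supp (a \<otimes>\<^bsub>RG\<^esub> b) \<subseteq> ?I"
  proof (rule subsetI, rule ccontr)
    fix h assume h: "h \<in> supp (a \<otimes>\<^bsub>RG\<^esub> b)" "h \<notin> ?I"
    then have "{(f, g). a f \<noteq> \<zero>\<^bsub>R\<^esub> \<and> b g \<noteq> \<zero>\<^bsub>R\<^esub> \<and> f \<otimes>\<^bsub>G\<^esub> g = h} = {}" by force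
    then have "(a \<otimes>\<^bsub>RG\<^esub> b) h = \<zero>\<^bsub>R\<^esub>" unfolding monoid_algebra_def monoid.simps by (metis R.finsum_empty)
    then show False using h by simp
  qed
  moreover have "finite ?I" "?I \<subseteq> carrier G" using assms by (auto simp: carrier_iff)
  ultimately show ?thesis
    using mult_in_R[OF assms] finite_subset[OF sub] unfolding carrier_iff by blast
qed

lemma l_distr:
  assumes "a \<in> carrier RG" "b \<in> carrier RG" "c \<in> carrier RG"
  shows "(a \<oplus>\<^bsub>RG\<^esub> b) \<otimes>\<^bsub>RG\<^esub> c = a \<otimes>\<^bsub>RG\<^esub> c \<oplus>\<^bsub>RG\<^esub> b \<otimes>\<^bsub>RG\<^esub> c"
proof
  fix h
  let ?I = "{(f, g) \<in> (supp a \<union> supp b) \<times> supp c. f \<otimes>\<^bsub>G\<^esub> g = h}"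
  have fin: "finite (supp a)" "finite (supp b)" "finite (supp c)" and R: "\<And>g. a g \<in> carrier R" "\<And>g. b g \<in> carrier R" "\<And>g. c g \<in> carrier R"
    using assms by (auto simp: carrier_iff)
  have "((a \<oplus>\<^bsub>RG\<^esub> b) \<otimes>\<^bsub>RG\<^esub> c) h = (\<Oplus>\<^bsub>R\<^esub>p\<in>?I. (a \<oplus>\<^bsub>RG\<^esub> b) (fst p) \<otimes>\<^bsub>R\<^esub> c (snd p))"
    by (rule mult_eq[OF add_closed]) (use assms fin in \<open>auto simp: RG_simps\<close>)
  also have "\<dots> = (\<Oplus>\<^bsub>R\<^esub>p\<in>?I. a (fst p) \<otimes>\<^bsub>R\<^esub> c (snd p) \<oplus>\<^bsub>R\<^esub> b (fst p) \<otimes>\<^bsub>R\<^esub> c (snd p))"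
    by (simp add: RG_simps R R.l_distr)
  also have "\<dots> = (\<Oplus>\<^bsub>R\<^esub>p\<in>?I. a (fst p) \<otimes>\<^bsub>R\<^esub> c (snd p)) \<oplus>\<^bsub>R\<^esub> (\<Oplus>\<^bsub>R\<^esub>p\<in>?I. b (fst p) \<otimes>\<^bsub>R\<^esub> c (snd p))"
    by (rule R.finsum_addf) (auto simp: R)
  also have "(\<Oplus>\<^bsub>R\<^esub>p\<in>?I. a (fst p) \<otimes>\<^bsub>R\<^esub> c (snd p)) = (a \<otimes>\<^bsub>RG\<^esub> c) h"
    by (rule mult_eq[symmetric]) (use assms fin in auto)
  also have "(\<Oplus>\<^bsub>R\<^esub>p\<in>?I. b (fst p) \<otimes>\<^bsub>R\<^esub> c (snd p)) = (b \<otimes>\<^bsub>RG\<^esub> c) h"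
    by (rule mult_eq[symmetric]) (use assms fin in auto)
  finally show "((a \<oplus>\<^bsub>RG\<^esub> b) \<otimes>\<^bsub>RG\<^esub> c) h = (a \<otimes>\<^bsub>RG\<^esub> c \<oplus>\<^bsub>RG\<^esub> b \<otimes>\<^bsub>RG\<^esub> c) h" by (simp add: RG_simps)
qed

lemma r_distr:
  assumes "a \<in> carrier RG" "b \<in> carrier RG" "c \<in> carrier RG"
  shows "c \<otimes>\<^bsub>RG\<^esub> (a \<oplus>\<^bsub>RG\<^esub> b) = c \<otimes>\<^bsub>RG\<^esub> a \<oplus>\<^bsub>RG\<^esub> c \<otimes>\<^bsub>RG\<^esub> b"
proof
  fix h
  let ?I = "{(f, g) \<in> supp c \<times> (supp a \<union> supp b). f \<otimes>\<^bsub>G\<^esub> g = h}"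
  have fin: "finite (supp a)" "finite (supp b)" "finite (supp c)" and R: "\<And>g. a g \<in> carrier R" "\<And>g. b g \<in> carrier R" "\<And>g. c g \<in> carrier R"
    using assms by (auto simp: carrier_iff)
  have "(c \<otimes>\<^bsub>RG\<^esub> (a \<oplus>\<^bsub>RG\<^esub> b)) h = (\<Oplus>\<^bsub>R\<^esub>p\<in>?I. c (fst p) \<otimes>\<^bsub>R\<^esub> (a \<oplus>\<^bsub>RG\<^esub> b) (snd p))"
    by (rule mult_eq[OF _ add_closed]) (use assms fin in \<open>auto simp: RG_simps\<close>)
  also have "\<dots> = (\<Oplus>\<^bsub>R\<^esub>p\<in>?I. c (fst p) \<otimes>\<^bsub>R\<^esub> a (snd p) \<oplus>\<^bsub>R\<^esub> c (fst p) \<otimes>\<^bsub>R\<^esub> b (snd p))"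
    by (simp add: RG_simps R R.r_distr)
  also have "\<dots> = (\<Oplus>\<^bsub>R\<^esub>p\<in>?I. c (fst p) \<otimes>\<^bsub>R\<^esub> a (snd p)) \<oplus>\<^bsub>R\<^esub> (\<Oplus>\<^bsub>R\<^esub>p\<in>?I. c (fst p) \<otimes>\<^bsub>R\<^esub> b (snd p))"
    by (rule R.finsum_addf) (auto simp: R)
  also have "(\<Oplus>\<^bsub>R\<^esub>p\<in>?I. c (fst p) \<otimes>\<^bsub>R\<^esub> a (snd p)) = (c \<otimes>\<^bsub>RG\<^esub> a) h"
    by (rule mult_eq[symmetric]) (use assms fin in auto)
  also have "(\<Oplus>\<^bsub>R\<^esub>p\<in>?I. c (fst p) \<otimes>\<^bsub>R\<^esub> b (snd p)) = (c \<otimes>\<^bsub>RG\<^esub> b) h"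
    by (rule mult_eq[symmetric]) (use assms fin in auto)
  finally show "(c \<otimes>\<^bsub>RG\<^esub> (a \<oplus>\<^bsub>RG\<^esub> b)) h = (c \<otimes>\<^bsub>RG\<^esub> a \<oplus>\<^bsub>RG\<^esub> c \<otimes>\<^bsub>RG\<^esub> b) h" by (simp add: RG_simps)
qed

lemma basis_mult:
  assumes "c \<in> carrier R" "d \<in> carrier R" "f \<in> carrier G" "g \<in> carrier G"
  shows "e c f \<otimes>\<^bsub>RG\<^esub> e d g = e (c \<otimes>\<^bsub>R\<^esub> d) (f \<otimes>\<^bsub>G\<^esub> g)"
proof
  fix h
  have "(e c f \<otimes>\<^bsub>RG\<^esub> e d g) h = (\<Oplus>\<^bsub>R\<^esub>p\<in>{(f', g') \<in> {f} \<times> {g}. f' \<otimes>\<^bsub>G\<^esub> g' = h}. e c f (fst p) \<otimes>\<^bsub>R\<^esub> e d g (snd p))"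
    by (rule mult_eq[OF basis_in basis_in]) (use assms in \<open>auto simp: scaled_basis_element_def\<close>)
  also have "{(f', g') \<in> {f} \<times> {g}. f' \<otimes>\<^bsub>G\<^esub> g' = h} = (if f \<otimes>\<^bsub>G\<^esub> g = h then {(f, g)} else {})" by auto
  finally show "(e c f \<otimes>\<^bsub>RG\<^esub> e d g) h = e (c \<otimes>\<^bsub>R\<^esub> d) (f \<otimes>\<^bsub>G\<^esub> g) h"
    using assms by (auto simp: scaled_basis_element_def R.finsum_insert)
qed

lemma zero_closed: "\<zero>\<^bsub>RG\<^esub> \<in> carrier RG" and one_closed: "\<one>\<^bsub>RG\<^esub> \<in> carrier RG"
  by (auto simp: RG_simps(2), auto simp: RG_simps carrier_iff)

lemma zero_mult: "a \<in> carrier RG \<Longrightarrow> \<zero>\<^bsub>RG\<^esub> \<otimes>\<^bsub>RG\<^esub> a = \<zero>\<^bsub>RG\<^esub>" "a \<in> carrier RG \<Longrightarrow> a \<otimes>\<^bsub>RG\<^esub> \<zero>\<^bsub>RG\<^esub> = \<zero>\<^bsub>RG\<^esub>"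
  by (simp_all add: monoid_algebra_def)

lemma abelian_group_RG: "abelian_group RG"
proof (rule abelian_groupI)
  fix a assume a: "a \<in> carrier RG"
  have "(\<lambda>h. \<ominus>\<^bsub>R\<^esub> a h) \<in> carrier RG"
  proof -
    have "supp (\<lambda>h. \<ominus>\<^bsub>R\<^esub> a h) \<subseteq> supp a" by auto
    then show ?thesis using a finite_subset[of "supp (\<lambda>h. \<ominus>\<^bsub>R\<^esub> a h)" "supp a"] by (auto simp: carrier_iff)
  qed
  moreover have "(\<lambda>h. \<ominus>\<^bsub>R\<^esub> a h) \<oplus>\<^bsub>RG\<^esub> a = \<zero>\<^bsub>RG\<^esub>"
    using a by (auto simp: RG_simps carrier_iff R.l_neg)
  ultimately show "\<exists>y\<in>carrier RG. y \<oplus>\<^bsub>RG\<^esub> a = \<zero>\<^bsub>RG\<^esub>" by blast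
qed (use add_closed zero_closed in \<open>auto simp: RG_simps carrier_iff R.a_ac\<close>)

text \<open>Associativity for monomials is associativity in \<open>R\<close> and in
  \<open>G\<close>. Three inductions, one for each factor, extend it by additivity.\<close>

lemma ring_RG: "ring RG"
proof -
  interpret A: abelian_group RG by (rule abelian_group_RG)
  have assoc_basis: "e c f \<otimes>\<^bsub>RG\<^esub> e d g \<otimes>\<^bsub>RG\<^esub> z = e c f \<otimes>\<^bsub>RG\<^esub> (e d g \<otimes>\<^bsub>RG\<^esub> z)"
    if "c \<in> carrier R" "f \<in> carrier G" "d \<in> carrier R" "g \<in> carrier G" "z \<in> carrier RG" for c f d g z
    using that(5) that(1-4)
    by (induction rule: induct) (simp_all add: basis_mult zero_mult r_distr mult_closed R.m_assoc G.m_assoc)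
  have assoc_basis': "e c f \<otimes>\<^bsub>RG\<^esub> y \<otimes>\<^bsub>RG\<^esub> z = e c f \<otimes>\<^bsub>RG\<^esub> (y \<otimes>\<^bsub>RG\<^esub> z)"
    if "c \<in> carrier R" "f \<in> carrier G" "y \<in> carrier RG" "z \<in> carrier RG" for c f y z
    using that(3) that(1,2,4)
    by (induction rule: induct) (simp_all add: assoc_basis zero_mult r_distr l_distr mult_closed)
  have assoc: "x \<otimes>\<^bsub>RG\<^esub> y \<otimes>\<^bsub>RG\<^esub> z = x \<otimes>\<^bsub>RG\<^esub> (y \<otimes>\<^bsub>RG\<^esub> z)"
    if "x \<in> carrier RG" "y \<in> carrier RG" "z \<in> carrier RG" for x y z
    using that(1) that(2,3)
    by (induction rule: induct) (simp_all add: assoc_basis' zero_mult l_distr mult_closed)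
  have one: "\<one>\<^bsub>RG\<^esub> \<otimes>\<^bsub>RG\<^esub> x = x" "x \<otimes>\<^bsub>RG\<^esub> \<one>\<^bsub>RG\<^esub> = x" if "x \<in> carrier RG" for x
    using that
    by (induction rule: induct)
      (simp_all add: RG_simps(2) basis_mult zero_mult[unfolded RG_simps(2)] r_distr l_distr)
  show ?thesis
    by (rule ringI) (auto intro!: abelian_group_RG monoidI assoc one mult_closed one_closed l_distr r_distr)
qed

lemma basis_element_eq: "basis_element R g = e \<one>\<^bsub>R\<^esub> g"
  by (simp add: basis_element_def scaled_basis_element_def)

text \<open>An action of \<open>G\<close> by linear maps, extended linearly to the monoid algebra;
  the context below states what \<open>act\<close> has to satisfy.\<close>

definition action_module :: "('k, 'u) module \<Rightarrow> ('g \<Rightarrow> 'u \<Rightarrow> 'u) \<Rightarrow> ('g \<Rightarrow> 'k, 'u) module" where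
  "action_module N act = \<lparr>carrier = carrier N, mult = mult N, one = one N, ring.zero = \<zero>\<^bsub>N\<^esub>, add = add N,
     smult = (\<lambda>a x. \<Oplus>\<^bsub>N\<^esub>g\<in>supp a. a g \<odot>\<^bsub>N\<^esub> act g x)\<rparr>"

lemma action_module_simps [simp]:
  "carrier (action_module N act) = carrier N" "\<zero>\<^bsub>action_module N act\<^esub> = \<zero>\<^bsub>N\<^esub>"
  "x \<oplus>\<^bsub>action_module N act\<^esub> y = x \<oplus>\<^bsub>N\<^esub> y"
  by (simp_all add: action_module_def)

context
  fixes N :: "('k, 'u) module" and act :: "'g \<Rightarrow> 'u \<Rightarrow> 'u"
  assumes N: "module R N"
    and act_closed: "\<And>g x. g \<in> carrier G \<Longrightarrow> x \<in> carrier N \<Longrightarrow> act g x \<in> carrier N"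
    and act_add: "\<And>g x y. g \<in> carrier G \<Longrightarrow> x \<in> carrier N \<Longrightarrow> y \<in> carrier N \<Longrightarrow>
      act g (x \<oplus>\<^bsub>N\<^esub> y) = act g x \<oplus>\<^bsub>N\<^esub> act g y"
    and act_smult: "\<And>g c x. g \<in> carrier G \<Longrightarrow> c \<in> carrier R \<Longrightarrow> x \<in> carrier N \<Longrightarrow>
      act g (c \<odot>\<^bsub>N\<^esub> x) = c \<odot>\<^bsub>N\<^esub> act g x"
    and act_one: "\<And>x. x \<in> carrier N \<Longrightarrow> act \<one>\<^bsub>G\<^esub> x = x"
    and act_mult: "\<And>g h x. g \<in> carrier G \<Longrightarrow> h \<in> carrier G \<Longrightarrow> x \<in> carrier N \<Longrightarrow>
      act (g \<otimes>\<^bsub>G\<^esub> h) x = act g (act h x)"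
begin

interpretation N: module R N by (rule N)

lemma action_smult_eq:
  assumes "a \<in> carrier RG" "x \<in> carrier N" "finite S" "supp a \<subseteq> S" "S \<subseteq> carrier G"
  shows "a \<odot>\<^bsub>action_module N act\<^esub> x = (\<Oplus>\<^bsub>N\<^esub>g\<in>S. a g \<odot>\<^bsub>N\<^esub> act g x)"
proof -
  have "(\<Oplus>\<^bsub>N\<^esub>g\<in>supp a. a g \<odot>\<^bsub>N\<^esub> act g x) = (\<Oplus>\<^bsub>N\<^esub>g\<in>S. a g \<odot>\<^bsub>N\<^esub> act g x)"
    using assms by (intro N.M.add.finprod_mono_neutral_cong_left)
      (auto simp: carrier_iff act_closed N.smult_l_null)
  then show ?thesis by (simp add: action_module_def)
qed

lemma action_smult_closed: "a \<in> carrier RG \<Longrightarrow> x \<in> carrier N \<Longrightarrow> a \<odot>\<^bsub>action_module N act\<^esub> x \<in> carrier N"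
  unfolding action_module_def module.simps
  by (rule N.M.finsum_closed) (auto simp: carrier_iff act_closed)

lemma action_smult_basis:
  assumes "c \<in> carrier R" "g \<in> carrier G" "x \<in> carrier N"
  shows "e c g \<odot>\<^bsub>action_module N act\<^esub> x = c \<odot>\<^bsub>N\<^esub> act g x"
proof -
  have "e c g \<odot>\<^bsub>action_module N act\<^esub> x = (\<Oplus>\<^bsub>N\<^esub>h\<in>{g}. e c g h \<odot>\<^bsub>N\<^esub> act h x)"
    by (rule action_smult_eq[OF basis_in]) (use assms in \<open>auto simp: scaled_basis_element_def\<close>)
  then show ?thesis using assms by (simp add: scaled_basis_element_def act_closed N.M.finsum_insert)
qed

lemma action_smult_l_distr:
  assumes "a \<in> carrier RG" "b \<in> carrier RG" "x \<in> carrier N"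
  shows "(a \<oplus>\<^bsub>RG\<^esub> b) \<odot>\<^bsub>action_module N act\<^esub> x =
    a \<odot>\<^bsub>action_module N act\<^esub> x \<oplus>\<^bsub>N\<^esub> b \<odot>\<^bsub>action_module N act\<^esub> x"
proof -
  let ?S = "supp a \<union> supp b"
  have S: "finite ?S" "?S \<subseteq> carrier G" "\<And>g. a g \<in> carrier R" "\<And>g. b g \<in> carrier R"
    using assms by (auto simp: carrier_iff)
  have "(a \<oplus>\<^bsub>RG\<^esub> b) \<odot>\<^bsub>action_module N act\<^esub> x = (\<Oplus>\<^bsub>N\<^esub>g\<in>?S. (a \<oplus>\<^bsub>RG\<^esub> b) g \<odot>\<^bsub>N\<^esub> act g x)"
    by (rule action_smult_eq[OF add_closed]) (use assms S in \<open>auto simp: RG_simps\<close>)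
  also have "\<dots> = (\<Oplus>\<^bsub>N\<^esub>g\<in>?S. a g \<odot>\<^bsub>N\<^esub> act g x \<oplus>\<^bsub>N\<^esub> b g \<odot>\<^bsub>N\<^esub> act g x)"
    by (rule N.M.finsum_cong') (use S assms(3) in \<open>auto simp: RG_simps N.smult_l_distr act_closed subset_iff\<close>)
  also have "\<dots> = (\<Oplus>\<^bsub>N\<^esub>g\<in>?S. a g \<odot>\<^bsub>N\<^esub> act g x) \<oplus>\<^bsub>N\<^esub> (\<Oplus>\<^bsub>N\<^esub>g\<in>?S. b g \<odot>\<^bsub>N\<^esub> act g x)"
    by (rule N.M.finsum_addf) (use S assms(3) in \<open>auto simp: act_closed subset_iff\<close>)
  also have "(\<Oplus>\<^bsub>N\<^esub>g\<in>?S. a g \<odot>\<^bsub>N\<^esub> act g x) = a \<odot>\<^bsub>action_module N act\<^esub> x"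
    by (rule action_smult_eq[symmetric]) (use assms S in auto)
  also have "(\<Oplus>\<^bsub>N\<^esub>g\<in>?S. b g \<odot>\<^bsub>N\<^esub> act g x) = b \<odot>\<^bsub>action_module N act\<^esub> x"
    by (rule action_smult_eq[symmetric]) (use assms S in auto)
  finally show ?thesis .
qed

lemma action_smult_zero: "x \<in> carrier N \<Longrightarrow> \<zero>\<^bsub>RG\<^esub> \<odot>\<^bsub>action_module N act\<^esub> x = \<zero>\<^bsub>N\<^esub>"
  by (simp add: action_module_def RG_simps)

lemma action_smult_r_distr:
  assumes "a \<in> carrier RG" "x \<in> carrier N" "y \<in> carrier N"
  shows "a \<odot>\<^bsub>action_module N act\<^esub> (x \<oplus>\<^bsub>N\<^esub> y) =
    a \<odot>\<^bsub>action_module N act\<^esub> x \<oplus>\<^bsub>N\<^esub> a \<odot>\<^bsub>action_module N act\<^esub> y"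
  using assms
  by (induction rule: induct)
    (simp_all add: action_smult_zero action_smult_basis act_add act_closed N.smult_r_distr
      action_smult_l_distr action_smult_closed N.M.a_ac)

text \<open>By additivity in the algebra arguments, the associative law only has to hold for
  monomials, where it says that \<open>act\<close> is an action by linear maps.\<close>

lemma left_module_action_module: "left_module RG (action_module N act)"
proof -
  interpret S: ring RG by (rule ring_RG)
  have r_zero: "a \<odot>\<^bsub>action_module N act\<^esub> \<zero>\<^bsub>N\<^esub> = \<zero>\<^bsub>N\<^esub>" if "a \<in> carrier RG" for a
    using action_smult_r_distr[OF that, of "\<zero>\<^bsub>N\<^esub>" "\<zero>\<^bsub>N\<^esub>"] action_smult_closed[OF that, of "\<zero>\<^bsub>N\<^esub>"]
    by (simp add: N.M.add.r_cancel_one')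
  have basis: "(e c g \<otimes>\<^bsub>RG\<^esub> b) \<odot>\<^bsub>action_module N act\<^esub> x = e c g \<odot>\<^bsub>action_module N act\<^esub> (b \<odot>\<^bsub>action_module N act\<^esub> x)"
    if "c \<in> carrier R" "g \<in> carrier G" "b \<in> carrier RG" "x \<in> carrier N" for c g b x
    using that(3) that(1,2,4)
    by (induction rule: induct)
      (simp_all add: zero_mult action_smult_zero r_zero basis_mult action_smult_basis act_closed act_mult act_smult N.smult_assoc1
        r_distr mult_closed action_smult_l_distr action_smult_r_distr action_smult_closed)
  have assoc: "(a \<otimes>\<^bsub>RG\<^esub> b) \<odot>\<^bsub>action_module N act\<^esub> x = a \<odot>\<^bsub>action_module N act\<^esub> (b \<odot>\<^bsub>action_module N act\<^esub> x)"
    if "a \<in> carrier RG" "b \<in> carrier RG" "x \<in> carrier N" for a b x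
    using that
    by (induction rule: induct)
      (simp_all add: zero_mult action_smult_zero action_smult_closed basis l_distr mult_closed action_smult_l_distr)
  have "abelian_group (action_module N act)"
  proof (rule abelian_groupI)
    show "\<exists>y\<in>carrier (action_module N act). y \<oplus>\<^bsub>action_module N act\<^esub> x = \<zero>\<^bsub>action_module N act\<^esub>"
      if "x \<in> carrier (action_module N act)" for x
      using that by (intro bexI[of _ "\<ominus>\<^bsub>N\<^esub> x"]) (auto simp: N.M.l_neg)
  qed (auto simp: N.M.a_ac)
  then show ?thesis
    unfolding left_module_def
    by (intro conjI module_axioms.intro ring_RG)
      (auto simp: action_smult_closed action_smult_l_distr action_smult_r_distr assoc RG_simps(2)
        action_smult_basis act_one)
qed

end

text \<open>Monomials span the algebra additively, so for an additive map compatibility with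
  monomials already is linearity.\<close>

lemma linear_maps_monoid_algebraI:
  assumes M: "left_module RG M" and N: "left_module RG N"
    and ext: "f \<in> extensional (carrier M)"
    and closed: "\<And>x. x \<in> carrier M \<Longrightarrow> f x \<in> carrier N"
    and add: "\<And>x y. x \<in> carrier M \<Longrightarrow> y \<in> carrier M \<Longrightarrow> f (x \<oplus>\<^bsub>M\<^esub> y) = f x \<oplus>\<^bsub>N\<^esub> f y"
    and basis: "\<And>c g x. c \<in> carrier R \<Longrightarrow> g \<in> carrier G \<Longrightarrow> x \<in> carrier M \<Longrightarrow> f (e c g \<odot>\<^bsub>M\<^esub> x) = e c g \<odot>\<^bsub>N\<^esub> f x"
  shows "f \<in> linear_maps RG M N"
proof (rule linear_mapsI[OF ext closed add])
  interpret M: abelian_group M by (rule left_moduleD(2)[OF M])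
  interpret N: abelian_group N by (rule left_moduleD(2)[OF N])
  note M' = left_moduleD[OF M] and N' = left_moduleD[OF N]
  have zero: "f \<zero>\<^bsub>M\<^esub> = \<zero>\<^bsub>N\<^esub>"
    using add[of "\<zero>\<^bsub>M\<^esub>" "\<zero>\<^bsub>M\<^esub>"] closed[of "\<zero>\<^bsub>M\<^esub>"] by (metis M.l_zero M.zero_closed N.add.r_cancel_one')
  show "f (a \<odot>\<^bsub>M\<^esub> x) = a \<odot>\<^bsub>N\<^esub> f x" if "a \<in> carrier RG" "x \<in> carrier M" for a x
    using that
    by (induction rule: induct)
      (simp_all add: left_module_zero[OF M] left_module_zero[OF N] zero closed basis M'(3,4) N'(4) add)
qed

text \<open>Restriction of scalars along the ring map that sends \<open>c\<close> to the monomial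
  with coefficient \<open>c\<close> at the unit of \<open>G\<close>.\<close>

definition scalar_restriction :: "('g \<Rightarrow> 'k, 'u) module \<Rightarrow> ('k, 'u) module" where
  "scalar_restriction M = \<lparr>carrier = carrier M, mult = mult M, one = one M, ring.zero = \<zero>\<^bsub>M\<^esub>, add = add M,
     smult = (\<lambda>c x. e c \<one>\<^bsub>G\<^esub> \<odot>\<^bsub>M\<^esub> x)\<rparr>"

lemma scalar_restriction_simps [simp]:
  "carrier (scalar_restriction M) = carrier M" "\<zero>\<^bsub>scalar_restriction M\<^esub> = \<zero>\<^bsub>M\<^esub>"
  "x \<oplus>\<^bsub>scalar_restriction M\<^esub> y = x \<oplus>\<^bsub>M\<^esub> y" "c \<odot>\<^bsub>scalar_restriction M\<^esub> x = e c \<one>\<^bsub>G\<^esub> \<odot>\<^bsub>M\<^esub> x"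
  by (simp_all add: scalar_restriction_def)

lemma basis_add: "c \<in> carrier R \<Longrightarrow> d \<in> carrier R \<Longrightarrow> e (c \<oplus>\<^bsub>R\<^esub> d) g = e c g \<oplus>\<^bsub>RG\<^esub> e d g"
  by (auto simp: RG_simps scaled_basis_element_def)

lemma module_scalar_restriction:
  assumes M: "left_module RG M"
  shows "module R (scalar_restriction M)"
proof -
  interpret M: abelian_group M by (rule left_moduleD(2)[OF M])
  note M' = left_moduleD[OF M]
  have "abelian_group (scalar_restriction M)"
  proof (rule abelian_groupI)
    show "\<exists>y\<in>carrier (scalar_restriction M). y \<oplus>\<^bsub>scalar_restriction M\<^esub> x = \<zero>\<^bsub>scalar_restriction M\<^esub>"
      if "x \<in> carrier (scalar_restriction M)" for x
      using that by (intro bexI[of _ "\<ominus>\<^bsub>M\<^esub> x"]) (auto simp: M.l_neg)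
  qed (auto simp: M.a_ac)
  moreover have "e (a \<otimes>\<^bsub>R\<^esub> b) \<one>\<^bsub>G\<^esub> = e a \<one>\<^bsub>G\<^esub> \<otimes>\<^bsub>RG\<^esub> e b \<one>\<^bsub>G\<^esub>" if "a \<in> carrier R" "b \<in> carrier R" for a b
    using that by (simp add: basis_mult)
  ultimately show ?thesis
    by (intro moduleI R.is_cring) (simp_all add: M'(3-7)[unfolded RG_simps(2)] basis_add)
qed

text \<open>In either order, the product of the monomial \<open>c\<close> at the unit and the
  monomial \<open>1\<close> at \<open>g\<close> is the monomial \<open>c g\<close>.\<close>

lemma basis_smult_commute:
  assumes "left_module RG M" "c \<in> carrier R" "g \<in> carrier G" "x \<in> carrier M"
  shows "e \<one>\<^bsub>R\<^esub> g \<odot>\<^bsub>M\<^esub> (e c \<one>\<^bsub>G\<^esub> \<odot>\<^bsub>M\<^esub> x) = e c \<one>\<^bsub>G\<^esub> \<odot>\<^bsub>M\<^esub> (e \<one>\<^bsub>R\<^esub> g \<odot>\<^bsub>M\<^esub> x)"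
    and "e c g \<odot>\<^bsub>M\<^esub> x = e c \<one>\<^bsub>G\<^esub> \<odot>\<^bsub>M\<^esub> (e \<one>\<^bsub>R\<^esub> g \<odot>\<^bsub>M\<^esub> x)"
  using assms by (simp_all add: left_moduleD(6)[OF assms(1), symmetric] basis_mult)

end

section \<open>Modules over the category of finite subsets\<close>

lemma restrict_id: "restrict id A = (\<lambda>x\<in>A. x)"
  by (simp add: restrict_def fun_eq_iff)

lemma incl_eq: "incl A B = restrict id A"
  by (simp add: incl_def restrict_id)

text \<open>
  The injections \<open>enc\<close> and \<open>pair\<close> allow colimits over \<open>Fin\<close> and binary products to be formed
  inside the universe \<open>'u\<close>.
\<close>

locale finset_modules =
  fixes k :: "'k ring" and E :: "('w \<Rightarrow> 'w) set" and Fin :: "'w set set"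
    and enc :: "'w set \<times> 'u \<Rightarrow> 'u" and pair :: "'u \<times> 'u \<Rightarrow> 'u"
  assumes k: "cring k"
    and E: "submonoid E full_transformation_monoid"
    and finite_Fin: "A \<in> Fin \<Longrightarrow> finite A"
    and Fin_up: "A \<in> Fin \<Longrightarrow> A \<subseteq> B \<Longrightarrow> finite B \<Longrightarrow> B \<in> Fin"
    and Fin_image: "A \<in> Fin \<Longrightarrow> h ` A \<in> Fin"
    and Fin_nonempty: "Fin \<noteq> {}"
    and inj_enc: "inj_on enc (Fin \<times> UNIV)"
    and inj_pair: "inj pair"
begin

sublocale R: cring k by (rule k)

lemma id_E: "id \<in> E" and comp_E: "f \<in> E \<Longrightarrow> g \<in> E \<Longrightarrow> f \<circ> g \<in> E"
  using E by (auto simp: submonoid_def full_transformation_monoid_def)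

abbreviation "EM \<equiv> full_transformation_monoid\<lparr>carrier := E\<rparr>"

lemma full_transformation_monoid_mult [simp]: "f \<otimes>\<^bsub>full_transformation_monoid\<^esub> g = f \<circ> g"
  by (simp add: full_transformation_monoid_def)

lemma EM_simps [simp]: "carrier EM = E" "f \<otimes>\<^bsub>EM\<^esub> g = f \<circ> g" "\<one>\<^bsub>EM\<^esub> = id"
  by (simp_all add: full_transformation_monoid_def)

sublocale kE: monoid_algebra_setup k EM
  by unfold_locales (auto simp: id_E comp_E o_assoc)

lemma kE_eq: "kE k E = kE.RG"
  by (simp add: kE_def)

abbreviation "Cat \<equiv> finset_category Fin E"
abbreviation "CM \<equiv> C_modules k Fin E :: (('w, 'k, 'u) cmod, 'w set \<Rightarrow> 'u \<Rightarrow> 'u) cat"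
abbreviation "UC \<equiv> uc_modules k E :: ((('w \<Rightarrow> 'w) \<Rightarrow> 'k, 'u) module, 'u \<Rightarrow> 'u) cat"

lemma Fin_Un: "A \<in> Fin \<Longrightarrow> B \<in> Fin \<Longrightarrow> A \<union> B \<in> Fin"
  by (rule Fin_up[of A]) (auto simp: finite_Fin)

text \<open>A finite set may fail to belong to \<open>Fin\<close> when only nonempty sets do;
  joining it with any member of \<open>Fin\<close> repairs this.\<close>

lemma Fin_cover:
  assumes "finite A"
  obtains B where "B \<in> Fin" "A \<subseteq> B"
  using Fin_nonempty assms Fin_up[of _ "A \<union> _"] finite_Fin by (metis Un_upper1 Un_upper2 ex_in_conv finite_UnI)

lemma Mor_Cat: "f \<in> Mor Cat A B \<longleftrightarrow> (\<exists>h\<in>E. f = restrict h A \<and> h ` A \<subseteq> B)"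
proof -
  have "restrict h A \<in> A \<rightarrow>\<^sub>E B \<longleftrightarrow> h ` A \<subseteq> B" for h by (auto simp: PiE_iff)
  then show ?thesis by (auto simp: finset_category_def)
qed

lemma Cat_simps [simp]: "Obj Cat = Fin" "Cmp Cat A B D g f = compose A g f" "Idn Cat A = (\<lambda>x\<in>A. x)"
  by (simp_all add: finset_category_def)

lemma is_category_Cat: "is_category Cat"
  by (rule is_category_finset_category[OF E])

lemma left_module_k: "left_module k M \<longleftrightarrow> module k M"
  by (rule left_module_iff_module[OF k])

lemma is_category_CM: "is_category CM"
  unfolding C_modules_def
  by (intro is_category_functor_category is_category_Cat is_category_module_category)

lemma is_category_UC: "is_category UC"
  unfolding uc_modules_def
  by (intro is_category_full_subcategory is_category_module_category)

lemma Obj_CM: "V \<in> Obj CM \<longleftrightarrow> is_functor Cat (module_category k) V"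
  by (simp add: C_modules_def functor_category_def)

abbreviation "sec V A \<equiv> carrier (fobj V A)"
text \<open>Every morphism is the restriction of some \<open>h\<close> in \<open>E\<close>. Naming
  it by \<open>h\<close> turns composition of morphisms into composition of self-maps, and
  \<open>h = id\<close> gives the map of an inclusion.\<close>

abbreviation "tr V A B h \<equiv> fmap V A B (restrict h A)"

lemma C_moduleD:
  assumes V: "V \<in> Obj CM"
  shows cm_module: "A \<in> Fin \<Longrightarrow> module k (fobj V A)"
    and cm_linear: "A \<in> Fin \<Longrightarrow> B \<in> Fin \<Longrightarrow> h \<in> E \<Longrightarrow> h ` A \<subseteq> B \<Longrightarrow>
      tr V A B h \<in> linear_maps k (fobj V A) (fobj V B)"
    and cm_id: "A \<in> Fin \<Longrightarrow> v \<in> sec V A \<Longrightarrow> tr V A A id v = v"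
    and cm_comp: "A \<in> Fin \<Longrightarrow> B \<in> Fin \<Longrightarrow> D \<in> Fin \<Longrightarrow> h \<in> E \<Longrightarrow> h ` A \<subseteq> B \<Longrightarrow> h' \<in> E \<Longrightarrow> h' ` B \<subseteq> D \<Longrightarrow>
      v \<in> sec V A \<Longrightarrow>
      tr V B D h' (tr V A B h v) = tr V A D (h' \<circ> h) v"
proof -
  have F: "is_functor Cat (module_category k) V" using V by (simp add: Obj_CM)
  note F' = is_functorD[OF F]
  show "A \<in> Fin \<Longrightarrow> module k (fobj V A)" using F'(1)[of A] by (simp add: left_module_k)
  show "A \<in> Fin \<Longrightarrow> B \<in> Fin \<Longrightarrow> h \<in> E \<Longrightarrow> h ` A \<subseteq> B \<Longrightarrow>
      tr V A B h \<in> linear_maps k (fobj V A) (fobj V B)"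
    using F'(2)[of A B "restrict h A"] by (auto simp: Mor_Cat)
  show "A \<in> Fin \<Longrightarrow> v \<in> sec V A \<Longrightarrow> tr V A A id v = v"
    using F'(3)[of A] by (simp add: restrict_id)
  assume *: "A \<in> Fin" "B \<in> Fin" "D \<in> Fin" "h \<in> E" "h ` A \<subseteq> B" "h' \<in> E" "h' ` B \<subseteq> D" "v \<in> sec V A"
  have "restrict (h' \<circ> h) A = compose A (restrict h' B) (restrict h A)"
    using * by (auto simp: compose_def fun_eq_iff)
  moreover have "fmap V A D (compose A (restrict h' B) (restrict h A)) =
     compose (sec V A) (tr V B D h') (tr V A B h)"
    using F'(4)[of A B D "restrict h A" "restrict h' B"] * by (auto simp: Mor_Cat)
  ultimately show "tr V B D h' (tr V A B h v) = tr V A D (h' \<circ> h) v"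
    using * by (simp add: compose_eq)
qed

lemma C_moduleI:
  assumes mod: "\<And>A. A \<in> Fin \<Longrightarrow> module k (fobj V A)"
    and lin: "\<And>A B h. A \<in> Fin \<Longrightarrow> B \<in> Fin \<Longrightarrow> h \<in> E \<Longrightarrow> h ` A \<subseteq> B \<Longrightarrow>
      tr V A B h \<in> linear_maps k (fobj V A) (fobj V B)"
    and id: "\<And>A v. A \<in> Fin \<Longrightarrow> v \<in> sec V A \<Longrightarrow> tr V A A id v = v"
    and comp: "\<And>A B D h h' v. A \<in> Fin \<Longrightarrow> B \<in> Fin \<Longrightarrow> D \<in> Fin \<Longrightarrow> h \<in> E \<Longrightarrow> h ` A \<subseteq> B \<Longrightarrow> h' \<in> E \<Longrightarrow> h' ` B \<subseteq> D \<Longrightarrow>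
      v \<in> sec V A \<Longrightarrow>
      tr V B D h' (tr V A B h v) = tr V A D (h' \<circ> h) v"
  shows "V \<in> Obj CM"
  unfolding Obj_CM is_functor_def Cat_simps
proof (intro conjI ballI)
  fix A assume A: "A \<in> Fin"
  show "fobj V A \<in> Obj (module_category k)" using mod[OF A] by (simp add: left_module_k)
  show "fmap V A A (\<lambda>x\<in>A. x) = Idn (module_category k) (fobj V A)"
    unfolding restrict_id[symmetric] using id[OF A]
    by (intro extensionalityI[OF linear_maps_extensional[OF lin[OF A A id_E]]]) auto
next
  fix A B f assume "A \<in> Fin" "B \<in> Fin" "f \<in> Mor Cat A B"
  then show "fmap V A B f \<in> Mor (module_category k) (fobj V A) (fobj V B)"
    using lin by (auto simp: Mor_Cat)
next
  fix A B D f g assume o: "A \<in> Fin" "B \<in> Fin" "D \<in> Fin" and "f \<in> Mor Cat A B" "g \<in> Mor Cat B D"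
  then obtain h h' where h: "h \<in> E" "f = restrict h A" "h ` A \<subseteq> B" "h' \<in> E" "g = restrict h' B" "h' ` B \<subseteq> D"
    by (auto simp: Mor_Cat)
  have c: "compose A g f = restrict (h' \<circ> h) A"
    using h by (auto simp: compose_def fun_eq_iff)
  have hh: "h' \<circ> h \<in> E" "(h' \<circ> h) ` A \<subseteq> D" using h by (auto intro: comp_E)
  show "fmap V A D (compose A g f) = Cmp (module_category k) (fobj V A) (fobj V B) (fobj V D) (fmap V B D g) (fmap V A B f)"
    unfolding c using comp[OF o h(1,3,4,6)]
    by (intro extensionalityI[OF linear_maps_extensional[OF lin[OF o(1,3) hh]]])
      (auto simp: h(2,5) compose_def)
qed

lemma Mor_CM: "\<eta> \<in> Mor CM V W \<longleftrightarrow> \<eta> \<in> extensional Fin \<and>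
    (\<forall>A\<in>Fin. \<eta> A \<in> linear_maps k (fobj V A) (fobj W A)) \<and>
    (\<forall>A\<in>Fin. \<forall>B\<in>Fin. \<forall>h\<in>E. h ` A \<subseteq> B \<longrightarrow> (\<forall>v\<in>sec V A.
      \<eta> B (tr V A B h v) = tr W A B h (\<eta> A v)))" (is "?l \<longleftrightarrow> ?r")
proof -
  have *: "compose S f g = compose S f' g' \<longleftrightarrow> (\<forall>x\<in>S. f (g x) = f' (g' x))"
    for S :: "'u set" and f g f' g' :: "'u \<Rightarrow> 'u"
    by (auto simp: compose_def fun_eq_iff)
  have "?l \<longleftrightarrow> \<eta> \<in> extensional Fin \<and>
    (\<forall>A\<in>Fin. \<eta> A \<in> linear_maps k (fobj V A) (fobj W A)) \<and>
    (\<forall>A\<in>Fin. \<forall>B\<in>Fin. \<forall>f\<in>Mor Cat A B. \<forall>v\<in>sec V A.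
      \<eta> B (fmap V A B f v) = fmap W A B f (\<eta> A v))"
    by (simp add: C_modules_def functor_category_def nat_trans_def *)
  also have "\<dots> \<longleftrightarrow> ?r"
  proof -
    have "(\<forall>f\<in>Mor Cat A B. P f) \<longleftrightarrow> (\<forall>h\<in>E. h ` A \<subseteq> B \<longrightarrow> P (restrict h A))" for A B P
      by (auto simp: Mor_Cat)
    then show ?thesis by simp
  qed
  finally show ?thesis .
qed

lemma Mor_CMD:
  assumes "\<eta> \<in> Mor CM V W"
  shows mor_linear: "A \<in> Fin \<Longrightarrow> \<eta> A \<in> linear_maps k (fobj V A) (fobj W A)"
    and mor_natural: "A \<in> Fin \<Longrightarrow> B \<in> Fin \<Longrightarrow> h \<in> E \<Longrightarrow> h ` A \<subseteq> B \<Longrightarrow> v \<in> sec V A \<Longrightarrow>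
      \<eta> B (tr V A B h v) = tr W A B h (\<eta> A v)"
    and mor_extensional: "\<eta> \<in> extensional Fin"
  using assms unfolding Mor_CM by blast+

lemma Mor_CMI:
  assumes "\<eta> \<in> extensional Fin"
    and "\<And>A. A \<in> Fin \<Longrightarrow> \<eta> A \<in> linear_maps k (fobj V A) (fobj W A)"
    and "\<And>A B h v. A \<in> Fin \<Longrightarrow> B \<in> Fin \<Longrightarrow> h \<in> E \<Longrightarrow> h ` A \<subseteq> B \<Longrightarrow> v \<in> sec V A \<Longrightarrow>
      \<eta> B (tr V A B h v) = tr W A B h (\<eta> A v)"
  shows "\<eta> \<in> Mor CM V W"
  using assms unfolding Mor_CM by blast

lemma Cmp_CM [simp]: "Cmp CM U V W \<beta> \<alpha> = (\<lambda>A\<in>Fin. compose (sec U A) (\<beta> A) (\<alpha> A))"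
  and Idn_CM [simp]: "Idn CM V = (\<lambda>A\<in>Fin. \<lambda>v\<in>sec V A. v)"
  by (simp_all add: C_modules_def functor_category_def)

lemma Mor_CM_eqI:
  assumes \<eta>: "\<eta> \<in> Mor CM V W" "\<theta> \<in> Mor CM V W"
    and eq: "\<And>A v. A \<in> Fin \<Longrightarrow> v \<in> sec V A \<Longrightarrow> \<eta> A v = \<theta> A v"
  shows "\<eta> = \<theta>"
proof (rule extensionalityI[OF mor_extensional[OF \<eta>(1)] mor_extensional[OF \<eta>(2)]])
  fix A assume A: "A \<in> Fin"
  show "\<eta> A = \<theta> A"
    by (rule extensionalityI[OF linear_maps_extensional[OF mor_linear[OF \<eta>(1) A]]
        linear_maps_extensional[OF mor_linear[OF \<eta>(2) A]]]) (rule eq[OF A])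
qed

lemma cm_closed:
  assumes "V \<in> Obj CM" "A \<in> Fin" "B \<in> Fin" "h \<in> E" "h ` A \<subseteq> B" "v \<in> sec V A"
  shows "tr V A B h v \<in> sec V B"
  using linear_maps_closed[OF cm_linear[OF assms(1-5)] assms(6)] .

lemma cm_closed_id:
  assumes "V \<in> Obj CM" "A \<in> Fin" "B \<in> Fin" "A \<subseteq> B" "v \<in> sec V A"
  shows "tr V A B id v \<in> sec V B"
  using cm_closed[OF assms(1-3) id_E] assms by simp

lemma cm_linear_id:
  assumes "V \<in> Obj CM" "A \<in> Fin" "B \<in> Fin" "A \<subseteq> B"
  shows "tr V A B id \<in> linear_maps k (fobj V A) (fobj V B)"
  using cm_linear[OF assms(1-3) id_E] assms by simp

lemma cm_comp_id:
  assumes "V \<in> Obj CM" "A \<in> Fin" "B \<in> Fin" "D \<in> Fin" "A \<subseteq> B" "B \<subseteq> D" "v \<in> sec V A"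
  shows "tr V B D id (tr V A B id v) = tr V A D id v"
  using cm_comp[OF assms(1-4) id_E _ id_E] assms by simp

lemma cm_abelian_group: "V \<in> Obj CM \<Longrightarrow> A \<in> Fin \<Longrightarrow> abelian_group (fobj V A)"
  by (rule module.axioms(2)[OF cm_module])

lemma cm_map_zero:
  assumes "V \<in> Obj CM" "A \<in> Fin" "B \<in> Fin" "h \<in> E" "h ` A \<subseteq> B"
  shows "tr V A B h \<zero>\<^bsub>fobj V A\<^esub> = \<zero>\<^bsub>fobj V B\<^esub>"
  using linear_maps_zero[OF cm_abelian_group[OF assms(1,2)] cm_abelian_group[OF assms(1,3)] cm_linear[OF assms]] .

subsection \<open>The colimit along inclusions\<close>

text \<open>The usual relation for a directed colimit. \<open>Fin\<close> is directed under
  inclusion by \<open>Fin_Un\<close>, so agreement at a single stage is enough, and it persists at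
  all larger stages.\<close>

definition germ_rel :: "('w, 'k, 'u) cmod \<Rightarrow> 'w set \<times> 'u \<Rightarrow> 'w set \<times> 'u \<Rightarrow> bool" where
  "germ_rel V p q \<longleftrightarrow> (\<exists>D\<in>Fin. fst p \<subseteq> D \<and> fst q \<subseteq> D \<and>
     tr V (fst p) D id (snd p) = tr V (fst q) D id (snd q))"

definition points :: "('w, 'k, 'u) cmod \<Rightarrow> ('w set \<times> 'u) set" where
  "points V = {(A, v). A \<in> Fin \<and> v \<in> sec V A}"

text \<open>
  The class of \<open>v\<close> in the colimit is encoded in the universe \<open>'u\<close> through a chosen representative.
\<close>

definition germ :: "('w, 'k, 'u) cmod \<Rightarrow> 'w set \<Rightarrow> 'u \<Rightarrow> 'u" where
  "germ V A v = enc (SOME p. p \<in> points V \<and> germ_rel V (A, v) p)"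

definition germs :: "('w, 'k, 'u) cmod \<Rightarrow> 'u set" where
  "germs V = (\<lambda>(A, v). germ V A v) ` points V"

lemma germ_rel_extend:
  assumes V: "V \<in> Obj CM" and p: "(A, v) \<in> points V" "(B, w) \<in> points V"
    and D: "D \<in> Fin" "A \<subseteq> D" "B \<subseteq> D" "tr V A D id v = tr V B D id w"
    and D': "D' \<in> Fin" "D \<subseteq> D'"
  shows "tr V A D' id v = tr V B D' id w"
proof -
  have "tr V A D' id v = tr V D D' id (tr V A D id v)"
    using p D D' by (intro cm_comp_id[OF V, symmetric]) (auto simp: points_def)
  also have "\<dots> = tr V B D' id w"
    unfolding D(4) using p D D' by (intro cm_comp_id[OF V]) (auto simp: points_def)
  finally show ?thesis .
qed

lemma germ_rel_equiv:
  assumes V: "V \<in> Obj CM"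
  shows "p \<in> points V \<Longrightarrow> germ_rel V p p"
    and "germ_rel V p q \<Longrightarrow> germ_rel V q p"
    and "p \<in> points V \<Longrightarrow> q \<in> points V \<Longrightarrow> r \<in> points V \<Longrightarrow> germ_rel V p q \<Longrightarrow> germ_rel V q r \<Longrightarrow> germ_rel V p r"
proof -
  show "p \<in> points V \<Longrightarrow> germ_rel V p p" by (auto simp: germ_rel_def points_def)
  show "germ_rel V p q \<Longrightarrow> germ_rel V q p" by (auto simp: germ_rel_def)
  assume pq: "p \<in> points V" "q \<in> points V" "r \<in> points V" and "germ_rel V p q" "germ_rel V q r"
  then obtain D D' where D: "D \<in> Fin" "fst p \<subseteq> D" "fst q \<subseteq> D"
      "tr V (fst p) D id (snd p) = tr V (fst q) D id (snd q)"
    and D': "D' \<in> Fin" "fst q \<subseteq> D'" "fst r \<subseteq> D'"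
      "tr V (fst q) D' id (snd q) = tr V (fst r) D' id (snd r)"
    unfolding germ_rel_def by blast
  have "D \<union> D' \<in> Fin" by (rule Fin_Un[OF D(1) D'(1)])
  moreover have "tr V (fst p) (D \<union> D') id (snd p) = tr V (fst q) (D \<union> D') id (snd q)"
    using pq D calculation by (intro germ_rel_extend[OF V _ _ D]) auto
  moreover have "tr V (fst q) (D \<union> D') id (snd q) = tr V (fst r) (D \<union> D') id (snd r)"
    using pq D' calculation by (intro germ_rel_extend[OF V _ _ D']) auto
  ultimately show "germ_rel V p r" unfolding germ_rel_def using D D' by (metis le_supI1 le_supI2)
qed

text \<open>Related points satisfy the same choice predicate, so the same representative is chosen
  for both. Conversely \<open>enc\<close> is injective on \<open>Fin \<times> UNIV\<close>, so equal
  codes come from one representative, and transitivity applies.\<close>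

lemma germ_eq_iff_rel:
  assumes V: "V \<in> Obj CM" and p: "(A, v) \<in> points V" "(B, w) \<in> points V"
  shows "germ V A v = germ V B w \<longleftrightarrow> germ_rel V (A, v) (B, w)"
proof
  let ?P = "\<lambda>A v p. p \<in> points V \<and> germ_rel V (A, v) p"
  note eqv = germ_rel_equiv[OF V]
  define p q where "p = (SOME p. ?P A v p)" and "q = (SOME p. ?P B w p)"
  have p': "?P A v p" unfolding p_def by (rule someI[of _ "(A, v)"]) (use p eqv(1) in blast)
  have q': "?P B w q" unfolding q_def by (rule someI[of _ "(B, w)"]) (use p eqv(1) in blast)
  assume "germ V A v = germ V B w"
  then have "enc p = enc q" by (simp add: germ_def p_def q_def)
  then have "p = q" by (rule inj_onD[OF inj_enc]) (use p' q' in \<open>auto simp: points_def\<close>)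
  then show "germ_rel V (A, v) (B, w)"
    using p' q' eqv(3)[OF p(1) _ p(2), of p] eqv(2)[of "(B, w)" q] by blast
next
  assume "germ_rel V (A, v) (B, w)"
  then have "germ_rel V (A, v) q \<longleftrightarrow> germ_rel V (B, w) q" if "q \<in> points V" for q
    using \<open>germ_rel V (A, v) (B, w)\<close> p that germ_rel_equiv(2)[OF V] germ_rel_equiv(3)[OF V] by blast
  then have "(\<lambda>p. p \<in> points V \<and> germ_rel V (A, v) p) = (\<lambda>p. p \<in> points V \<and> germ_rel V (B, w) p)"
    by blast
  then show "germ V A v = germ V B w" by (simp add: germ_def)
qed

lemma germ_eq_iff:
  assumes V: "V \<in> Obj CM" and "A \<in> Fin" "v \<in> sec V A" "B \<in> Fin" "w \<in> sec V B"
  shows "germ V A v = germ V B w \<longleftrightarrow>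
    (\<exists>D\<in>Fin. A \<subseteq> D \<and> B \<subseteq> D \<and> tr V A D id v = tr V B D id w)"
  using germ_eq_iff_rel[OF V, of A v B w] assms by (simp add: points_def germ_rel_def)

lemma germ_eqI:
  assumes "V \<in> Obj CM" "A \<in> Fin" "v \<in> sec V A" "B \<in> Fin" "w \<in> sec V B"
    and "D \<in> Fin" "A \<subseteq> D" "B \<subseteq> D" "tr V A D id v = tr V B D id w"
  shows "germ V A v = germ V B w"
  using assms germ_eq_iff by blast

lemma germ_in: "A \<in> Fin \<Longrightarrow> v \<in> sec V A \<Longrightarrow> germ V A v \<in> germs V"
  unfolding germs_def points_def by auto

lemma germ_incl:
  assumes V: "V \<in> Obj CM" and o: "A \<in> Fin" "B \<in> Fin" "A \<subseteq> B" and v: "v \<in> sec V A"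
  shows "germ V B (tr V A B id v) = germ V A v"
proof -
  have "tr V B B id (tr V A B id v) = tr V A B id v"
    using o v by (intro cm_comp_id[OF V]) auto
  then show ?thesis using o v cm_closed_id[OF V o v] by (subst germ_eq_iff[OF V]) auto
qed

lemma germsE:
  assumes "x \<in> germs V"
  obtains A v where "A \<in> Fin" "v \<in> sec V A" "x = germ V A v"
  using assms unfolding germs_def points_def by auto

text \<open>A class is represented at every stage that contains a suitable one. This is what allows
  several classes to be represented at a common stage.\<close>

lemma germs_from:
  assumes V: "V \<in> Obj CM" and x: "x \<in> germs V"
  obtains A where "A \<in> Fin" "\<forall>B\<in>Fin. A \<subseteq> B \<longrightarrow> (\<exists>v\<in>sec V B. x = germ V B v)"
proof -
  obtain A v where A: "A \<in> Fin" "v \<in> sec V A" "x = germ V A v" using x by (rule germsE)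
  show thesis
  proof (rule that[OF A(1)], intro ballI impI)
    fix B assume "B \<in> Fin" "A \<subseteq> B"
    then show "\<exists>v\<in>sec V B. x = germ V B v"
      using germ_incl[OF V A(1) _ _ A(2)] cm_closed_id[OF V A(1) _ _ A(2)] A(3) by metis
  qed
qed

lemma germs_common2:
  assumes V: "V \<in> Obj CM" and x: "x \<in> germs V" "y \<in> germs V"
  obtains A v w where "A \<in> Fin" "v \<in> sec V A" "w \<in> sec V A" "x = germ V A v" "y = germ V A w"
proof -
  obtain A where A: "A \<in> Fin" "\<forall>B\<in>Fin. A \<subseteq> B \<longrightarrow> (\<exists>v\<in>sec V B. x = germ V B v)"
    by (rule germs_from[OF V x(1)])
  obtain A' where A': "A' \<in> Fin" "\<forall>B\<in>Fin. A' \<subseteq> B \<longrightarrow> (\<exists>v\<in>sec V B. y = germ V B v)"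
    by (rule germs_from[OF V x(2)])
  show thesis using A(2)[rule_format, OF Fin_Un[OF A(1) A'(1)]] A'(2)[rule_format, OF Fin_Un[OF A(1) A'(1)]] that[OF Fin_Un[OF A(1) A'(1)]] by auto
qed

lemma germs_common3:
  assumes V: "V \<in> Obj CM" and x: "x \<in> germs V" "y \<in> germs V" "z \<in> germs V"
  obtains A v w u where "A \<in> Fin" "v \<in> sec V A" "w \<in> sec V A" "u \<in> sec V A"
    "x = germ V A v" "y = germ V A w" "z = germ V A u"
proof -
  obtain A v w where A: "A \<in> Fin" "v \<in> sec V A" "w \<in> sec V A" "x = germ V A v" "y = germ V A w"
    by (rule germs_common2[OF V x(1,2)])
  obtain A' where A': "A' \<in> Fin" "\<forall>B\<in>Fin. A' \<subseteq> B \<longrightarrow> (\<exists>v\<in>sec V B. z = germ V B v)"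
    by (rule germs_from[OF V x(3)])
  let ?B = "A \<union> A'"
  have B: "?B \<in> Fin" "A \<subseteq> ?B" by (auto intro: Fin_Un A A')
  obtain u where "u \<in> sec V ?B" "z = germ V ?B u" using A'(2)[rule_format, OF B(1)] by auto
  then show thesis
    using that[OF B(1), of "tr V A ?B id v" "tr V A ?B id w" u]
      germ_incl[OF V A(1) B] cm_closed_id[OF V A(1) B] A by simp
qed

text \<open>The operations are prescribed on representatives at a common stage; the congruence
  lemmas below show that \<open>SOME\<close> has exactly one candidate.\<close>

definition colimit :: "('w, 'k, 'u) cmod \<Rightarrow> ('k, 'u) module" where
  "colimit V = \<lparr>carrier = germs V, mult = undefined, one = undefined,
     ring.zero = (SOME z. \<exists>A\<in>Fin. z = germ V A \<zero>\<^bsub>fobj V A\<^esub>),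
     add = (\<lambda>x y. SOME z. \<exists>A\<in>Fin. \<exists>v\<in>sec V A. \<exists>w\<in>sec V A.
       x = germ V A v \<and> y = germ V A w \<and> z = germ V A (v \<oplus>\<^bsub>fobj V A\<^esub> w)),
     smult = (\<lambda>c x. SOME z. \<exists>A\<in>Fin. \<exists>v\<in>sec V A.
       x = germ V A v \<and> z = germ V A (c \<odot>\<^bsub>fobj V A\<^esub> v))\<rparr>"

text \<open>The image of \<open>A\<close> under \<open>h\<close> is the smallest stage into which
  \<open>h\<close> maps \<open>A\<close>; by \<open>act_germ\<close> any larger one gives the same
  class.\<close>

definition act :: "('w, 'k, 'u) cmod \<Rightarrow> ('w \<Rightarrow> 'w) \<Rightarrow> 'u \<Rightarrow> 'u" where
  "act V h x = (SOME z. \<exists>A\<in>Fin. \<exists>v\<in>sec V A.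
     x = germ V A v \<and> z = germ V (h ` A) (tr V A (h ` A) h v))"

lemma carrier_colimit [simp]: "carrier (colimit V) = germs V"
  by (simp add: colimit_def)

context
  fixes V assumes V: "V \<in> Obj CM"
begin

lemma germ_zero:
  assumes "A \<in> Fin" "B \<in> Fin"
  shows "germ V A \<zero>\<^bsub>fobj V A\<^esub> = germ V B \<zero>\<^bsub>fobj V B\<^esub>"
proof -
  have z: "\<zero>\<^bsub>fobj V D\<^esub> \<in> sec V D" if "D \<in> Fin" for D
    using cm_abelian_group[OF V that] by (simp add: abelian_group.axioms(1) abelian_monoid.zero_closed)
  have "germ V D \<zero>\<^bsub>fobj V D\<^esub> = germ V (A \<union> B) \<zero>\<^bsub>fobj V (A \<union> B)\<^esub>" if "D \<in> Fin" "D \<subseteq> A \<union> B" for D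
    using germ_incl[OF V that(1) Fin_Un[OF assms] that(2) z] cm_map_zero[OF V that(1) Fin_Un[OF assms] id_E] that by simp
  then show ?thesis using assms by (metis Un_upper1 Un_upper2)
qed

lemma colimit_zero: "A \<in> Fin \<Longrightarrow> \<zero>\<^bsub>colimit V\<^esub> = germ V A \<zero>\<^bsub>fobj V A\<^esub>"
  unfolding colimit_def module.simps ring.simps by (rule some_equality) (auto intro: germ_zero)

lemma germ_add_cong:
  assumes A: "A \<in> Fin" "v \<in> sec V A" "w \<in> sec V A"
    and B: "B \<in> Fin" "v' \<in> sec V B" "w' \<in> sec V B"
    and eq: "germ V A v = germ V B v'" "germ V A w = germ V B w'"
  shows "germ V A (v \<oplus>\<^bsub>fobj V A\<^esub> w) = germ V B (v' \<oplus>\<^bsub>fobj V B\<^esub> w')"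
proof -
  obtain D where D: "D \<in> Fin" "A \<subseteq> D" "B \<subseteq> D" "tr V A D id v = tr V B D id v'"
    using eq A B by (auto simp: germ_eq_iff[OF V])
  obtain D' where D': "D' \<in> Fin" "A \<subseteq> D'" "B \<subseteq> D'" "tr V A D' id w = tr V B D' id w'"
    using eq A B by (auto simp: germ_eq_iff[OF V])
  let ?D = "D \<union> D'"
  have F: "?D \<in> Fin" by (rule Fin_Un[OF D(1) D'(1)])
  have s: "A \<subseteq> ?D" "B \<subseteq> ?D" using D by auto
  have "tr V A ?D id v = tr V B ?D id v'"
    using A B F by (intro germ_rel_extend[OF V _ _ D]) (auto simp: points_def)
  moreover have "tr V A ?D id w = tr V B ?D id w'"
    using A B F by (intro germ_rel_extend[OF V _ _ D']) (auto simp: points_def)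
  ultimately have "tr V A ?D id (v \<oplus>\<^bsub>fobj V A\<^esub> w) = tr V B ?D id (v' \<oplus>\<^bsub>fobj V B\<^esub> w')"
    using linear_maps_add[OF cm_linear_id[OF V A(1) F s(1)] A(2,3)]
      linear_maps_add[OF cm_linear_id[OF V B(1) F s(2)] B(2,3)] by simp
  then show ?thesis
    using A B F s cm_abelian_group[OF V]
    by (subst germ_eq_iff[OF V]) (auto simp: abelian_group.axioms(1) abelian_monoid.a_closed)
qed

lemma colimit_add:
  assumes "A \<in> Fin" "v \<in> sec V A" "w \<in> sec V A"
  shows "germ V A v \<oplus>\<^bsub>colimit V\<^esub> germ V A w = germ V A (v \<oplus>\<^bsub>fobj V A\<^esub> w)"
  unfolding colimit_def module.simps ring.simps
  by (rule some_equality) (use assms in \<open>auto intro: germ_add_cong\<close>)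

text \<open>Two choices are settled at once, the representative of the class and the codomain at
  which \<open>h\<close> is read. If \<open>v\<close> and \<open>w\<close> agree at
  \<open>D\<close>, then both values agree at any stage containing \<open>A'\<close>,
  \<open>B'\<close> and the image of \<open>D\<close> under \<open>h\<close>, because applying
  \<open>h\<close> commutes with enlarging the stage.\<close>

lemma germ_map_cong:
  assumes A: "A \<in> Fin" "v \<in> sec V A" and B: "B \<in> Fin" "w \<in> sec V B"
    and eq: "germ V A v = germ V B w"
    and h: "h \<in> E" "A' \<in> Fin" "B' \<in> Fin" "h ` A \<subseteq> A'" "h ` B \<subseteq> B'"
  shows "germ V A' (tr V A A' h v) = germ V B' (tr V B B' h w)"
proof -
  obtain D where D: "D \<in> Fin" "A \<subseteq> D" "B \<subseteq> D" "tr V A D id v = tr V B D id w"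
    using eq A B by (auto simp: germ_eq_iff[OF V])
  let ?D = "A' \<union> B' \<union> h ` D"
  have F: "?D \<in> Fin" by (intro Fin_Un Fin_image h D)
  have "tr V A' ?D id (tr V A A' h v) = tr V A ?D h v"
    using cm_comp[OF V A(1) h(2) F h(1,4) id_E _ A(2)] by auto
  also have "\<dots> = tr V D ?D h (tr V A D id v)"
    using cm_comp[OF V A(1) D(1) F id_E _ h(1) _ A(2)] D by auto
  also have "\<dots> = tr V B ?D h w"
    unfolding D(4) using cm_comp[OF V B(1) D(1) F id_E _ h(1) _ B(2)] D by auto
  also have "\<dots> = tr V B' ?D id (tr V B B' h w)"
    using cm_comp[OF V B(1) h(3) F h(1,5) id_E _ B(2)] by (simp add: le_supI1)
  finally show ?thesis
    by (rule germ_eqI[OF V h(2) _ h(3) _ F, rotated -1]) (use h A B in \<open>auto intro!: cm_closed[OF V]\<close>)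
qed

lemma act_germ:
  assumes A: "A \<in> Fin" "v \<in> sec V A" and h: "h \<in> E" "B \<in> Fin" "h ` A \<subseteq> B"
  shows "act V h (germ V A v) = germ V B (tr V A B h v)"
  unfolding act_def
proof (rule some_equality)
  show "\<exists>A'\<in>Fin. \<exists>v'\<in>sec V A'. germ V A v = germ V A' v' \<and>
      germ V B (tr V A B h v) = germ V (h ` A') (tr V A' (h ` A') h v')"
    using A h by (intro bexI[of _ A] bexI[of _ v] conjI germ_map_cong) (auto intro: Fin_image)
  show "z = germ V B (tr V A B h v)"
    if z0: "\<exists>A'\<in>Fin. \<exists>v'\<in>sec V A'. germ V A v = germ V A' v' \<and>
      z = germ V (h ` A') (tr V A' (h ` A') h v')" for z
  proof -
    obtain A' v' where z: "A' \<in> Fin" "v' \<in> sec V A'" "germ V A v = germ V A' v'"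
      "z = germ V (h ` A') (tr V A' (h ` A') h v')"
      using z0 by blast
    show ?thesis unfolding z(4)
      by (rule germ_map_cong[OF z(1,2) A z(3)[symmetric] h(1) Fin_image[OF z(1)] h(2) _ h(3)]) simp
  qed
qed

lemma colimit_smult:
  assumes "c \<in> carrier k" "A \<in> Fin" "v \<in> sec V A"
  shows "c \<odot>\<^bsub>colimit V\<^esub> germ V A v = germ V A (c \<odot>\<^bsub>fobj V A\<^esub> v)"
  unfolding colimit_def module.simps
proof (rule some_equality)
  fix z assume "\<exists>B\<in>Fin. \<exists>w\<in>sec V B. germ V A v = germ V B w \<and> z = germ V B (c \<odot>\<^bsub>fobj V B\<^esub> w)"
  then obtain B w where B: "B \<in> Fin" "w \<in> sec V B" "germ V A v = germ V B w" "z = germ V B (c \<odot>\<^bsub>fobj V B\<^esub> w)"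
    by blast
  then obtain D where D: "D \<in> Fin" "A \<subseteq> D" "B \<subseteq> D" "tr V A D id v = tr V B D id w"
    using assms by (auto simp: germ_eq_iff[OF V])
  have "tr V A D id (c \<odot>\<^bsub>fobj V A\<^esub> v) = tr V B D id (c \<odot>\<^bsub>fobj V B\<^esub> w)"
    using linear_maps_smult[OF cm_linear_id[OF V assms(2) D(1,2)] assms(1,3)]
      linear_maps_smult[OF cm_linear_id[OF V B(1) D(1,3)] assms(1) B(2)] D(4) by simp
  then have "germ V A (c \<odot>\<^bsub>fobj V A\<^esub> v) = germ V B (c \<odot>\<^bsub>fobj V B\<^esub> w)"
    by (rule germ_eqI[OF V assms(2) _ B(1) _ D(1,2,3), rotated -1])
      (use assms B(1,2) in \<open>auto simp: module.smult_closed[OF cm_module[OF V]]\<close>)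
  then show "z = germ V A (c \<odot>\<^bsub>fobj V A\<^esub> v)" by (simp add: B(4))
qed (use assms in auto)

text \<open>Each axiom involves at most three elements. These are represented at a common stage,
  where the axiom holds.\<close>

lemma module_colimit: "module k (colimit V)"
proof (rule moduleI[OF k])
  obtain A0 where A0: "A0 \<in> Fin" using Fin_nonempty by blast
  note ag = cm_abelian_group[OF V] and md = cm_module[OF V]
  note am = abelian_group.axioms(1)[OF ag]
  note cl = abelian_monoid.a_closed[OF am] abelian_monoid.zero_closed[OF am]
  show "abelian_group (colimit V)"
  proof (rule abelian_groupI)
    fix x y assume "x \<in> carrier (colimit V)" "y \<in> carrier (colimit V)"
    then obtain A v w where A: "A \<in> Fin" "v \<in> sec V A" "w \<in> sec V A" "x = germ V A v" "y = germ V A w"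
      using germs_common2[OF V, of x y] unfolding carrier_colimit by blast
    then show "x \<oplus>\<^bsub>colimit V\<^esub> y \<in> carrier (colimit V)" "x \<oplus>\<^bsub>colimit V\<^esub> y = y \<oplus>\<^bsub>colimit V\<^esub> x"
      by (auto simp: colimit_add abelian_monoid.a_comm[OF am] intro!: germ_in cl)
  next
    show "\<zero>\<^bsub>colimit V\<^esub> \<in> carrier (colimit V)" using A0 by (auto simp: colimit_zero intro!: germ_in cl)
  next
    fix x y z assume "x \<in> carrier (colimit V)" "y \<in> carrier (colimit V)" "z \<in> carrier (colimit V)"
    then obtain A v w u where A: "A \<in> Fin" "v \<in> sec V A" "w \<in> sec V A" "u \<in> sec V A"
      "x = germ V A v" "y = germ V A w" "z = germ V A u"
      using germs_common3[OF V, of x y z] unfolding carrier_colimit by blast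
    then show "x \<oplus>\<^bsub>colimit V\<^esub> y \<oplus>\<^bsub>colimit V\<^esub> z = x \<oplus>\<^bsub>colimit V\<^esub> (y \<oplus>\<^bsub>colimit V\<^esub> z)"
      by (simp add: colimit_add cl abelian_monoid.a_assoc[OF am])
  next
    fix x assume "x \<in> carrier (colimit V)"
    then obtain A v where A: "A \<in> Fin" "v \<in> sec V A" "x = germ V A v" by (auto elim: germsE)
    then show "\<zero>\<^bsub>colimit V\<^esub> \<oplus>\<^bsub>colimit V\<^esub> x = x"
      by (simp add: colimit_zero[OF A(1)] colimit_add cl abelian_monoid.l_zero[OF am])
    show "\<exists>y\<in>carrier (colimit V). y \<oplus>\<^bsub>colimit V\<^esub> x = \<zero>\<^bsub>colimit V\<^esub>"
      using A by (intro bexI[of _ "germ V A (\<ominus>\<^bsub>fobj V A\<^esub> v)"])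
        (auto simp: colimit_add colimit_zero[OF A(1)] abelian_group.l_neg[OF ag] abelian_group.a_inv_closed[OF ag] intro!: germ_in)
  qed
  fix a b x assume a: "a \<in> carrier k" "b \<in> carrier k" and "x \<in> carrier (colimit V)"
  then obtain A v where A: "A \<in> Fin" "v \<in> sec V A" "x = germ V A v" by (auto elim: germsE)
  note sc = module.smult_closed[OF md]
  show "a \<odot>\<^bsub>colimit V\<^esub> x \<in> carrier (colimit V)" using a A by (auto simp: colimit_smult intro!: germ_in sc)
  show "(a \<oplus>\<^bsub>k\<^esub> b) \<odot>\<^bsub>colimit V\<^esub> x = a \<odot>\<^bsub>colimit V\<^esub> x \<oplus>\<^bsub>colimit V\<^esub> b \<odot>\<^bsub>colimit V\<^esub> x"
    using a A by (simp add: colimit_smult colimit_add sc module.smult_l_distr[OF md])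
  show "a \<otimes>\<^bsub>k\<^esub> b \<odot>\<^bsub>colimit V\<^esub> x = a \<odot>\<^bsub>colimit V\<^esub> (b \<odot>\<^bsub>colimit V\<^esub> x)"
    using a A by (simp add: colimit_smult sc module.smult_assoc1[OF md])
next
  fix x assume "x \<in> carrier (colimit V)"
  then obtain A v where A: "A \<in> Fin" "v \<in> sec V A" "x = germ V A v" by (auto elim: germsE)
  then show "\<one>\<^bsub>k\<^esub> \<odot>\<^bsub>colimit V\<^esub> x = x" by (simp add: colimit_smult module.smult_one[OF cm_module[OF V]])
next
  fix a x y assume a: "a \<in> carrier k" and "x \<in> carrier (colimit V)" "y \<in> carrier (colimit V)"
  then obtain A v w where A: "A \<in> Fin" "v \<in> sec V A" "w \<in> sec V A" "x = germ V A v" "y = germ V A w"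
    using germs_common2[OF V, of x y] unfolding carrier_colimit by blast
  then show "a \<odot>\<^bsub>colimit V\<^esub> (x \<oplus>\<^bsub>colimit V\<^esub> y) = a \<odot>\<^bsub>colimit V\<^esub> x \<oplus>\<^bsub>colimit V\<^esub> a \<odot>\<^bsub>colimit V\<^esub> y"
    using a by (simp add: colimit_smult colimit_add module.smult_closed[OF cm_module[OF V]] module.smult_r_distr[OF cm_module[OF V]]
      abelian_monoid.a_closed[OF abelian_group.axioms(1)[OF cm_abelian_group[OF V]]])
qed

lemma act_closed: "h \<in> E \<Longrightarrow> x \<in> germs V \<Longrightarrow> act V h x \<in> germs V"
proof (elim germsE)
  fix A v assume h: "h \<in> E" and A: "A \<in> Fin" "v \<in> sec V A" "x = germ V A v"
  show "act V h x \<in> germs V"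
    unfolding A(3) act_germ[OF A(1,2) h Fin_image[OF A(1)] subset_refl]
    by (intro germ_in cm_closed[OF V] Fin_image A h subset_refl)
qed

lemma act_add:
  assumes h: "h \<in> E" and "x \<in> germs V" "y \<in> germs V"
  shows "act V h (x \<oplus>\<^bsub>colimit V\<^esub> y) = act V h x \<oplus>\<^bsub>colimit V\<^esub> act V h y"
proof -
  obtain A v w where A: "A \<in> Fin" "v \<in> sec V A" "w \<in> sec V A" "x = germ V A v" "y = germ V A w"
    using assms germs_common2[OF V, of x y] by auto
  note hA = Fin_image[OF A(1), of h]
  show ?thesis
    using A h linear_maps_add[OF cm_linear[OF V A(1) hA h subset_refl] A(2,3)]
      cm_closed[OF V A(1) hA h subset_refl]
      abelian_monoid.a_closed[OF abelian_group.axioms(1)[OF cm_abelian_group[OF V A(1)]] A(2,3)]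
    by (simp add: colimit_add hA act_germ[OF A(1) _ h hA])
qed

lemma act_smult:
  assumes h: "h \<in> E" and c: "c \<in> carrier k" and "x \<in> germs V"
  shows "act V h (c \<odot>\<^bsub>colimit V\<^esub> x) = c \<odot>\<^bsub>colimit V\<^esub> act V h x"
proof -
  obtain A v where A: "A \<in> Fin" "v \<in> sec V A" "x = germ V A v"
    using assms by (auto elim: germsE)
  note hA = Fin_image[OF A(1), of h]
  show ?thesis
    using A h c linear_maps_smult[OF cm_linear[OF V A(1) hA h subset_refl] c A(2)]
      cm_closed[OF V A(1) hA h subset_refl]
    by (simp add: colimit_smult hA act_germ[OF A(1) _ h hA] module.smult_closed[OF cm_module[OF V]])
qed

lemma act_id: "x \<in> germs V \<Longrightarrow> act V id x = x"
  by (auto elim!: germsE simp: act_germ[OF _ _ id_E] cm_id[OF V])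

lemma act_comp:
  assumes "g \<in> E" "h \<in> E" "x \<in> germs V"
  shows "act V (g \<circ> h) x = act V g (act V h x)"
proof -
  obtain A v where A: "A \<in> Fin" "v \<in> sec V A" "x = germ V A v"
    using assms by (auto elim: germsE)
  note hA = Fin_image[OF A(1), of h] and gA = Fin_image[OF Fin_image[OF A(1)], of g h]
  show ?thesis
    using A assms cm_comp[OF V A(1) hA gA, of h g v] cm_closed[OF V A(1) hA]
    by (simp add: act_germ[OF A(1) _ _ hA] act_germ[OF A(1) _ _ gA] act_germ[OF hA _ _ gA] comp_E image_comp)
qed

end

section \<open>The functor from C-modules to uniformly continuous modules\<close>

definition Psi :: "('w, 'k, 'u) cmod \<Rightarrow> (('w \<Rightarrow> 'w) \<Rightarrow> 'k, 'u) module" where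
  "Psi V = kE.action_module (colimit V) (act V)"

lemma carrier_Psi [simp]: "carrier (Psi V) = germs V"
  by (simp add: Psi_def)

context
  fixes V assumes V: "V \<in> Obj CM"
begin

lemma left_module_Psi: "left_module kE.RG (Psi V)"
  unfolding Psi_def
  by (rule kE.left_module_action_module[OF module_colimit[OF V]])
    (simp_all add: act_closed[OF V] act_add[OF V] act_smult[OF V] act_id[OF V] act_comp[OF V])

lemma Psi_basis: "c \<in> carrier k \<Longrightarrow> h \<in> E \<Longrightarrow> x \<in> germs V \<Longrightarrow> kE.e c h \<odot>\<^bsub>Psi V\<^esub> x = c \<odot>\<^bsub>colimit V\<^esub> act V h x"
  unfolding Psi_def
  by (rule kE.action_smult_basis[OF module_colimit[OF V]])
    (simp_all add: act_closed[OF V] act_add[OF V] act_smult[OF V] act_id[OF V] act_comp[OF V])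

lemma Psi_add: "x \<oplus>\<^bsub>Psi V\<^esub> y = x \<oplus>\<^bsub>colimit V\<^esub> y"
  by (simp add: Psi_def)

lemma Psi_act: "h \<in> E \<Longrightarrow> x \<in> germs V \<Longrightarrow> basis_element k h \<odot>\<^bsub>Psi V\<^esub> x = act V h x"
  using module.smult_one[OF module_colimit[OF V]] by (simp add: kE.basis_element_eq Psi_basis act_closed[OF V])

lemma act_cong:
  assumes A: "A \<in> Fin" "v \<in> sec V A" and h: "h \<in> E" "h' \<in> E" "restrict h A = restrict h' A"
  shows "act V h (germ V A v) = act V h' (germ V A v)"
proof -
  have "h' ` A = h ` A" using h(3) by (metis image_restrict_eq)
  then show ?thesis
    using act_germ[OF V A h(1) Fin_image[OF A(1)] subset_refl] act_germ[OF V A h(2) Fin_image[OF A(1), of h]] h(3) by simp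
qed

text \<open>A stage \<open>A\<close> at which \<open>x\<close> is represented serves as the finite
  set: the action of \<open>h\<close> on the class involves only the restriction of \<open>h\<close>
  to \<open>A\<close>.\<close>

lemma uniformly_continuous_Psi: "uniformly_continuous k E (Psi V)"
  unfolding uniformly_continuous_def carrier_Psi
proof
  fix x assume x: "x \<in> germs V"
  then obtain A v where A: "A \<in> Fin" "v \<in> sec V A" "x = germ V A v" by (rule germsE)
  show "\<exists>A. finite A \<and> (\<forall>h\<in>E. \<forall>h'\<in>E. restrict h A = restrict h' A \<longrightarrow>
           basis_element k h \<odot>\<^bsub>Psi V\<^esub> x = basis_element k h' \<odot>\<^bsub>Psi V\<^esub> x)"
  proof (intro exI[of _ A] conjI ballI impI)
    fix h h' assume h: "h \<in> E" "h' \<in> E" "restrict h A = restrict h' A"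
    show "basis_element k h \<odot>\<^bsub>Psi V\<^esub> x = basis_element k h' \<odot>\<^bsub>Psi V\<^esub> x"
      using act_cong[OF A(1,2) h] by (simp add: Psi_act[OF h(1) x] Psi_act[OF h(2) x] A(3)[symmetric])
  qed (rule finite_Fin[OF A(1)])
qed

end

lemma Obj_UC: "M \<in> Obj UC \<longleftrightarrow> left_module kE.RG M \<and> uniformly_continuous k E M"
  by (simp add: uc_modules_def full_subcategory_def kE_eq)

lemma Mor_UC: "Mor UC M N = linear_maps kE.RG M N"
  and Cmp_UC: "Cmp UC M N P g f = compose (carrier M) g f"
  and Idn_UC: "Idn UC M = (\<lambda>x\<in>carrier M. x)"
  by (simp_all add: uc_modules_def full_subcategory_def kE_eq)

lemma Psi_in: "V \<in> Obj CM \<Longrightarrow> Psi V \<in> Obj UC"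
  by (simp add: Obj_UC left_module_Psi uniformly_continuous_Psi)

lemma is_iso_UC:
  assumes "M \<in> Obj UC" "N \<in> Obj UC" "f \<in> Mor UC M N"
  shows "is_iso UC M N f \<longleftrightarrow> bij_betw f (carrier M) (carrier N)"
proof -
  have "is_iso UC M N f \<longleftrightarrow> is_iso (module_category kE.RG) M N f"
    by (simp add: is_iso_def Mor_UC Cmp_UC Idn_UC)
  then show ?thesis
    using is_iso_module_category_iff[of kE.RG M N f] assms by (simp add: Obj_UC Mor_UC)
qed

definition Psi_map :: "('w, 'k, 'u) cmod \<Rightarrow> ('w, 'k, 'u) cmod \<Rightarrow> ('w set \<Rightarrow> 'u \<Rightarrow> 'u) \<Rightarrow> 'u \<Rightarrow> 'u" where
  "Psi_map V W \<eta> = (\<lambda>x\<in>germs V. SOME z. \<exists>A\<in>Fin. \<exists>v\<in>sec V A. x = germ V A v \<and> z = germ W A (\<eta> A v))"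

text \<open>Naturality along inclusions carries the agreement of two representatives at a later
  stage over to their images.\<close>

lemma Psi_map_germ:
  assumes V: "V \<in> Obj CM" and W: "W \<in> Obj CM" and \<eta>: "\<eta> \<in> Mor CM V W"
    and A: "A \<in> Fin" "v \<in> sec V A"
  shows "Psi_map V W \<eta> (germ V A v) = germ W A (\<eta> A v)"
proof -
  have "(SOME z. \<exists>B\<in>Fin. \<exists>w\<in>sec V B. germ V A v = germ V B w \<and> z = germ W B (\<eta> B w)) = germ W A (\<eta> A v)"
  proof (rule some_equality)
    fix z assume "\<exists>B\<in>Fin. \<exists>w\<in>sec V B. germ V A v = germ V B w \<and> z = germ W B (\<eta> B w)"
    then obtain B w where B: "B \<in> Fin" "w \<in> sec V B" "germ V A v = germ V B w" "z = germ W B (\<eta> B w)"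
      by blast
    then obtain D where D: "D \<in> Fin" "A \<subseteq> D" "B \<subseteq> D" "tr V A D id v = tr V B D id w"
      using A by (auto simp: germ_eq_iff[OF V])
    have "tr W A D id (\<eta> A v) = tr W B D id (\<eta> B w)"
      using mor_natural[OF \<eta> A(1) D(1) id_E _ A(2)] mor_natural[OF \<eta> B(1) D(1) id_E _ B(2)] D by simp
    then have "germ W A (\<eta> A v) = germ W B (\<eta> B w)"
      by (rule germ_eqI[OF W A(1) _ B(1) _ D(1,2,3), rotated -1])
        (use A B in \<open>auto intro: linear_maps_closed[OF mor_linear[OF \<eta>]]\<close>)
    then show "z = germ W A (\<eta> A v)" by (simp add: B(4))
  qed (use A in auto)
  then show ?thesis using germ_in[OF A] by (simp add: Psi_map_def)
qed

text \<open>Linearity over the monoid algebra is checked on monomials. These act by a scalar after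
  an element of \<open>E\<close>; scalars are respected stage by stage, and the action is respected
  by naturality.\<close>

lemma Psi_map_in:
  assumes V: "V \<in> Obj CM" and W: "W \<in> Obj CM" and \<eta>: "\<eta> \<in> Mor CM V W"
  shows "Psi_map V W \<eta> \<in> Mor UC (Psi V) (Psi W)"
proof -
  note lin = mor_linear[OF \<eta>]
  have closed: "Psi_map V W \<eta> x \<in> germs W" if x: "x \<in> germs V" for x
    using x by (auto elim!: germsE simp: Psi_map_germ[OF V W \<eta>] intro!: germ_in linear_maps_closed[OF lin])
  have map_act: "Psi_map V W \<eta> (act V h x) = act W h (Psi_map V W \<eta> x)" if h: "h \<in> E" and x: "x \<in> germs V" for h x
  proof -
    obtain A v where A: "A \<in> Fin" "v \<in> sec V A" "x = germ V A v" using x by (rule germsE)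
    note hA = Fin_image[OF A(1), of h]
    show ?thesis
      using A h mor_natural[OF \<eta> A(1) hA h _ A(2)] cm_closed[OF V A(1) hA h _ A(2)] linear_maps_closed[OF lin[OF A(1)] A(2)]
      by (simp add: Psi_map_germ[OF V W \<eta>] act_germ[OF V A(1) _ h hA] act_germ[OF W A(1) _ h hA] hA)
  qed
  have map_smult: "Psi_map V W \<eta> (c \<odot>\<^bsub>colimit V\<^esub> x) = c \<odot>\<^bsub>colimit W\<^esub> Psi_map V W \<eta> x"
    if c: "c \<in> carrier k" and x: "x \<in> germs V" for c x
  proof -
    obtain A v where A: "A \<in> Fin" "v \<in> sec V A" "x = germ V A v" using x by (rule germsE)
    show ?thesis
      using A c linear_maps_smult[OF lin[OF A(1)] c A(2)] linear_maps_closed[OF lin[OF A(1)] A(2)]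
        module.smult_closed[OF cm_module[OF V A(1)]]
      by (simp add: Psi_map_germ[OF V W \<eta>] colimit_smult[OF V] colimit_smult[OF W])
  qed
  show ?thesis
    unfolding Mor_UC
  proof (rule kE.linear_maps_monoid_algebraI[OF left_module_Psi[OF V] left_module_Psi[OF W]])
    show "Psi_map V W \<eta> \<in> extensional (carrier (Psi V))" by (simp add: Psi_map_def)
    fix x assume x: "x \<in> carrier (Psi V)"
    then show "Psi_map V W \<eta> x \<in> carrier (Psi W)" by (simp add: closed)
    show "Psi_map V W \<eta> (x \<oplus>\<^bsub>Psi V\<^esub> y) = Psi_map V W \<eta> x \<oplus>\<^bsub>Psi W\<^esub> Psi_map V W \<eta> y" if y: "y \<in> carrier (Psi V)" for y
    proof -
      obtain A v w where A: "A \<in> Fin" "v \<in> sec V A" "w \<in> sec V A" "x = germ V A v" "y = germ V A w"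
        using x y germs_common2[OF V, of x y] by auto
      then show ?thesis
        using linear_maps_add[OF lin[OF A(1)] A(2,3)] linear_maps_closed[OF lin[OF A(1)]]
          abelian_monoid.a_closed[OF abelian_group.axioms(1)[OF cm_abelian_group[OF V A(1)]] A(2,3)]
        by (simp add: Psi_map_germ[OF V W \<eta>] Psi_add[OF V] Psi_add[OF W] colimit_add[OF V] colimit_add[OF W])
    qed
    show "Psi_map V W \<eta> (kE.e c h \<odot>\<^bsub>Psi V\<^esub> x) = kE.e c h \<odot>\<^bsub>Psi W\<^esub> Psi_map V W \<eta> x"
      if "c \<in> carrier k" "h \<in> carrier EM" for c h
      using that x by (simp add: Psi_basis[OF V] Psi_basis[OF W] closed map_smult map_act act_closed[OF V])
  qed
qed

definition Psi_functor :: "(('w, 'k, 'u) cmod, 'w set \<Rightarrow> 'u \<Rightarrow> 'u, (('w \<Rightarrow> 'w) \<Rightarrow> 'k, 'u) module, 'u \<Rightarrow> 'u) fnctr" where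
  "Psi_functor = \<lparr>fobj = Psi, fmap = Psi_map\<rparr>"

lemma Psi_functor_simps [simp]: "fobj Psi_functor = Psi" "fmap Psi_functor = Psi_map"
  by (simp_all add: Psi_functor_def)

lemma germs_extensionalityI:
  assumes "f \<in> extensional (germs V)" "g \<in> extensional (germs V)"
    and "\<And>A v. A \<in> Fin \<Longrightarrow> v \<in> sec V A \<Longrightarrow> f (germ V A v) = g (germ V A v)"
  shows "f = g"
  by (rule extensionalityI[OF assms(1,2)]) (use assms(3) in \<open>auto elim!: germsE\<close>)

lemma is_functor_Psi: "is_functor CM UC Psi_functor"
  unfolding is_functor_def Psi_functor_simps
proof (intro conjI ballI)
  fix V assume V: "V \<in> Obj CM"
  then show "Psi V \<in> Obj UC" by (rule Psi_in)
  show "Psi_map V V (Idn CM V) = Idn UC (Psi V)"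
    using Psi_map_germ[OF V V Idn_in[OF is_category_CM V]]
    by (intro germs_extensionalityI) (auto simp: Psi_map_def Idn_UC germ_in)
next
  fix V W \<eta> assume "V \<in> Obj CM" "W \<in> Obj CM" "\<eta> \<in> Mor CM V W"
  then show "Psi_map V W \<eta> \<in> Mor UC (Psi V) (Psi W)" by (rule Psi_map_in)
next
  fix U V W \<alpha> \<beta> assume *: "U \<in> Obj CM" "V \<in> Obj CM" "W \<in> Obj CM" "\<alpha> \<in> Mor CM U V" "\<beta> \<in> Mor CM V W"
  note c = Cmp_in[OF is_category_CM *]
  show "Psi_map U W (Cmp CM U V W \<beta> \<alpha>) = Cmp UC (Psi U) (Psi V) (Psi W) (Psi_map V W \<beta>) (Psi_map U V \<alpha>)"
    using Psi_map_germ[OF *(1,3) c] linear_maps_closed[OF mor_linear[OF *(4)]]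
    by (intro germs_extensionalityI[of _ U])
      (auto simp: Psi_map_def[of U W] Cmp_UC germ_in compose_def Psi_map_germ[OF *(1,2,4)] Psi_map_germ[OF *(2,3,5)])
qed

subsection \<open>Submodules, quotients and products\<close>

definition sub :: "('w, 'k, 'u) cmod \<Rightarrow> ('w set \<Rightarrow> 'u set) \<Rightarrow> ('w, 'k, 'u) cmod" where
  "sub V S = \<lparr>fobj = (\<lambda>A. (fobj V A)\<lparr>carrier := S A\<rparr>), fmap = (\<lambda>A B f. restrict (fmap V A B f) (S A))\<rparr>"

definition sub_incl :: "('w set \<Rightarrow> 'u set) \<Rightarrow> 'w set \<Rightarrow> 'u \<Rightarrow> 'u" where
  "sub_incl S = (\<lambda>A\<in>Fin. \<lambda>v\<in>S A. v)"

lemma sub_simps [simp]: "sec (sub V S) A = S A" "\<zero>\<^bsub>fobj (sub V S) A\<^esub> = \<zero>\<^bsub>fobj V A\<^esub>"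
  "x \<oplus>\<^bsub>fobj (sub V S) A\<^esub> y = x \<oplus>\<^bsub>fobj V A\<^esub> y" "c \<odot>\<^bsub>fobj (sub V S) A\<^esub> x = c \<odot>\<^bsub>fobj V A\<^esub> x"
  "fmap (sub V S) A B f = restrict (fmap V A B f) (S A)"
  by (simp_all add: sub_def)

lemma cm_submoduleI:
  assumes "V \<in> Obj CM" "A \<in> Fin" "S \<subseteq> sec V A" "\<zero>\<^bsub>fobj V A\<^esub> \<in> S"
    and "\<And>x y. x \<in> S \<Longrightarrow> y \<in> S \<Longrightarrow> x \<oplus>\<^bsub>fobj V A\<^esub> y \<in> S"
    and "\<And>c x. c \<in> carrier k \<Longrightarrow> x \<in> S \<Longrightarrow> c \<odot>\<^bsub>fobj V A\<^esub> x \<in> S"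
  shows "submodule S k (fobj V A)"
  by (rule submodule_if_closed[OF cm_module[OF assms(1,2)] assms(3-6)])

context
  fixes V S
  assumes V: "V \<in> Obj CM" and S: "\<And>A. A \<in> Fin \<Longrightarrow> submodule (S A) k (fobj V A)"
    and S_map: "\<And>A B h v. A \<in> Fin \<Longrightarrow> B \<in> Fin \<Longrightarrow> h \<in> E \<Longrightarrow> h ` A \<subseteq> B \<Longrightarrow> v \<in> S A \<Longrightarrow>
      tr V A B h v \<in> S B"
begin

lemma S_subset: "A \<in> Fin \<Longrightarrow> v \<in> S A \<Longrightarrow> v \<in> sec V A"
  using module.submoduleE(1)[OF cm_module[OF V] S] by blast

lemma sub_in: "sub V S \<in> Obj CM"
proof (rule C_moduleI)
  fix A assume A: "A \<in> Fin"
  show "module k (fobj (sub V S) A)"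
    using submodule.submodule_is_module[OF S[OF A] cm_module[OF V A]] by (simp add: sub_def)
  show "v \<in> sec (sub V S) A \<Longrightarrow> tr (sub V S) A A id v = v" for v
    using cm_id[OF V A] S_subset[OF A] by simp
next
  fix A B h assume *: "A \<in> Fin" "B \<in> Fin" "h \<in> E" "h ` A \<subseteq> B"
  note lin = cm_linear[OF V *]
  have c: "x \<oplus>\<^bsub>fobj V A\<^esub> y \<in> S A" "c \<in> carrier k \<Longrightarrow> c \<odot>\<^bsub>fobj V A\<^esub> x \<in> S A" if "x \<in> S A" "y \<in> S A" for x y c
    using module.submoduleE(4,5)[OF cm_module[OF V *(1)] S[OF *(1)]] that by auto
  show "tr (sub V S) A B h \<in> linear_maps k (fobj (sub V S) A) (fobj (sub V S) B)"
    by (rule linear_mapsI)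
      (auto simp: S_map * c S_subset linear_maps_add[OF lin] linear_maps_smult[OF lin])
next
  fix A B D h h' v assume "A \<in> Fin" "B \<in> Fin" "D \<in> Fin" "h \<in> E" "h ` A \<subseteq> B" "h' \<in> E" "h' ` B \<subseteq> D"
    "v \<in> sec (sub V S) A"
  then show "tr (sub V S) B D h' (tr (sub V S) A B h v) = tr (sub V S) A D (h' \<circ> h) v"
    using cm_comp[OF V] S_map[of A B h v] S_subset[of A v] by simp
qed

lemma sub_incl_in: "sub_incl S \<in> Mor CM (sub V S) V"
proof (rule Mor_CMI)
  fix A assume A: "A \<in> Fin"
  show "sub_incl S A \<in> linear_maps k (fobj (sub V S) A) (fobj V A)"
    using module.submoduleE(4,5)[OF cm_module[OF V A] S[OF A]]
    by (intro linear_mapsI) (auto simp: sub_incl_def A S_subset)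
qed (auto simp: sub_incl_def S_map)

lemma Mor_sub:
  assumes "\<eta> \<in> Mor CM W V" "\<And>A v. A \<in> Fin \<Longrightarrow> v \<in> sec W A \<Longrightarrow> \<eta> A v \<in> S A"
  shows "\<eta> \<in> Mor CM W (sub V S)"
proof (rule Mor_CMI[OF mor_extensional[OF assms(1)]])
  fix A assume A: "A \<in> Fin"
  note lin = mor_linear[OF assms(1) A]
  show "\<eta> A \<in> linear_maps k (fobj W A) (fobj (sub V S) A)"
    by (rule linear_mapsI[OF linear_maps_extensional[OF lin]])
      (auto simp: assms(2)[OF A] linear_maps_add[OF lin] linear_maps_smult[OF lin])
qed (auto simp: assms(2) mor_natural[OF assms(1)])

lemma Mor_from_sub:
  assumes "\<eta> \<in> Mor CM V W"
  shows "(\<lambda>A\<in>Fin. \<lambda>v\<in>S A. \<eta> A v) \<in> Mor CM (sub V S) W"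
proof (rule Mor_CMI)
  fix A assume A: "A \<in> Fin"
  note lin = mor_linear[OF assms(1) A]
  show "(\<lambda>A\<in>Fin. \<lambda>v\<in>S A. \<eta> A v) A \<in> linear_maps k (fobj (sub V S) A) (fobj W A)"
    using A module.submoduleE(4,5)[OF cm_module[OF V A] S[OF A]]
    by (intro linear_mapsI)
      (auto simp: linear_maps_closed[OF lin] S_subset linear_maps_add[OF lin] linear_maps_smult[OF lin])
qed (auto simp: S_map S_subset mor_natural[OF assms(1)])

end

text \<open>A representative of the coset of \<open>x\<close>, chosen by a predicate that depends
  only on the coset. The quotient thus has its carrier inside the carrier of \<open>M\<close>, in
  the same universe.\<close>

definition rep :: "('k, 'u) module \<Rightarrow> 'u set \<Rightarrow> 'u \<Rightarrow> 'u" where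
  "rep M I x = (SOME y. y \<in> carrier M \<and> x \<ominus>\<^bsub>M\<^esub> y \<in> I)"

definition quot :: "('w, 'k, 'u) cmod \<Rightarrow> ('w set \<Rightarrow> 'u set) \<Rightarrow> ('w, 'k, 'u) cmod" where
  "quot V S = \<lparr>fobj = (\<lambda>A. image_module (rep (fobj V A) (S A)) (fobj V A)),
     fmap = (\<lambda>A B f. \<lambda>x\<in>rep (fobj V A) (S A) ` sec V A.
       rep (fobj V B) (S B) (fmap V A B f (inv_into (sec V A) (rep (fobj V A) (S A)) x)))\<rparr>"

definition quot_proj :: "('w, 'k, 'u) cmod \<Rightarrow> ('w set \<Rightarrow> 'u set) \<Rightarrow> 'w set \<Rightarrow> 'u \<Rightarrow> 'u" where
  "quot_proj V S = (\<lambda>A\<in>Fin. \<lambda>v\<in>sec V A. rep (fobj V A) (S A) v)"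

lemma rep_eq_iff:
  assumes M: "module k M" and I: "submodule I k M" and x: "x \<in> carrier M" "y \<in> carrier M"
  shows "rep M I x = rep M I y \<longleftrightarrow> x \<ominus>\<^bsub>M\<^esub> y \<in> I"
proof -
  interpret M: module k M by (rule M)
  note I' = M.submoduleE[OF I]
  have zero: "\<zero>\<^bsub>M\<^esub> \<in> I"
    using I'(2) I'(3,5) I'(1) M.r_neg by (metis all_not_in_conv subsetD)
  have P: "rep M I z \<in> carrier M \<and> z \<ominus>\<^bsub>M\<^esub> rep M I z \<in> I" if "z \<in> carrier M" for z
    unfolding rep_def by (rule someI[of _ z]) (use that zero in \<open>simp add: M.r_neg a_minus_def\<close>)
  have trans: "a \<ominus>\<^bsub>M\<^esub> c \<in> I" if "a \<ominus>\<^bsub>M\<^esub> b \<in> I" "b \<ominus>\<^bsub>M\<^esub> c \<in> I" "a \<in> carrier M" "b \<in> carrier M" "c \<in> carrier M" for a b c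
  proof -
    have "(a \<ominus>\<^bsub>M\<^esub> b) \<oplus>\<^bsub>M\<^esub> (b \<ominus>\<^bsub>M\<^esub> c) = a \<ominus>\<^bsub>M\<^esub> c"
      using that(3-5) by (simp add: a_minus_def M.a_assoc M.r_neg1)
    then show ?thesis using I'(5)[OF that(1,2)] by simp
  qed
  have sym: "b \<ominus>\<^bsub>M\<^esub> a \<in> I" if "a \<ominus>\<^bsub>M\<^esub> b \<in> I" "a \<in> carrier M" "b \<in> carrier M" for a b
  proof -
    have "\<ominus>\<^bsub>M\<^esub> (a \<ominus>\<^bsub>M\<^esub> b) = b \<ominus>\<^bsub>M\<^esub> a"
      using that(2,3) by (simp add: a_minus_def M.minus_add M.a_comm)
    then show ?thesis using I'(3)[OF that(1)] by simp
  qed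
  show ?thesis
  proof
    assume "rep M I x = rep M I y"
    then show "x \<ominus>\<^bsub>M\<^esub> y \<in> I" using P[OF x(1)] P[OF x(2)] trans sym x by metis
  next
    assume xy: "x \<ominus>\<^bsub>M\<^esub> y \<in> I"
    have "x \<ominus>\<^bsub>M\<^esub> z \<in> I \<longleftrightarrow> y \<ominus>\<^bsub>M\<^esub> z \<in> I" if "z \<in> carrier M" for z
      using trans[OF xy _ x that] trans[OF sym[OF xy x] _ x(2,1) that] by blast
    then show "rep M I x = rep M I y" unfolding rep_def by metis
  qed
qed

context
  fixes V S
  assumes V: "V \<in> Obj CM" and S: "\<And>A. A \<in> Fin \<Longrightarrow> submodule (S A) k (fobj V A)"
    and S_map: "\<And>A B h v. A \<in> Fin \<Longrightarrow> B \<in> Fin \<Longrightarrow> h \<in> E \<Longrightarrow> h ` A \<subseteq> B \<Longrightarrow> v \<in> S A \<Longrightarrow>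
      tr V A B h v \<in> S B"
begin

abbreviation "qm A \<equiv> rep (fobj V A) (S A)"

lemma qm_eq_iff: "A \<in> Fin \<Longrightarrow> v \<in> sec V A \<Longrightarrow> w \<in> sec V A \<Longrightarrow>
    qm A v = qm A w \<longleftrightarrow> v \<ominus>\<^bsub>fobj V A\<^esub> w \<in> S A"
  by (rule rep_eq_iff[OF cm_module[OF V] S])

text \<open>In each case the difference of the two values comes from \<open>v - w\<close>: it is
  unchanged, scaled or transported, and \<open>S\<close> is stable under scaling and
  transport.\<close>

lemma qm_congs:
  assumes A: "A \<in> Fin" and v: "v \<in> sec V A" "w \<in> sec V A" and eq: "qm A v = qm A w"
  shows "u \<in> sec V A \<Longrightarrow> qm A (v \<oplus>\<^bsub>fobj V A\<^esub> u) = qm A (w \<oplus>\<^bsub>fobj V A\<^esub> u)"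
    and "c \<in> carrier k \<Longrightarrow> qm A (c \<odot>\<^bsub>fobj V A\<^esub> v) = qm A (c \<odot>\<^bsub>fobj V A\<^esub> w)"
    and "B \<in> Fin \<Longrightarrow> h \<in> E \<Longrightarrow> h ` A \<subseteq> B \<Longrightarrow> qm B (tr V A B h v) = qm B (tr V A B h w)"
proof -
  interpret M: module k "fobj V A" by (rule cm_module[OF V A])
  have d: "v \<ominus>\<^bsub>fobj V A\<^esub> w \<in> S A" using eq by (simp add: qm_eq_iff A v)
  show "qm A (v \<oplus>\<^bsub>fobj V A\<^esub> u) = qm A (w \<oplus>\<^bsub>fobj V A\<^esub> u)" if u: "u \<in> sec V A"
  proof -
    have "(v \<oplus>\<^bsub>fobj V A\<^esub> u) \<ominus>\<^bsub>fobj V A\<^esub> (w \<oplus>\<^bsub>fobj V A\<^esub> u) =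
        v \<oplus>\<^bsub>fobj V A\<^esub> (u \<oplus>\<^bsub>fobj V A\<^esub> (\<ominus>\<^bsub>fobj V A\<^esub> u \<oplus>\<^bsub>fobj V A\<^esub> \<ominus>\<^bsub>fobj V A\<^esub> w))"
      using v u by (simp add: a_minus_def M.minus_add M.a_ac)
    also have "\<dots> = v \<ominus>\<^bsub>fobj V A\<^esub> w"
      using v u by (simp add: a_minus_def M.r_neg2)
    finally have "(v \<oplus>\<^bsub>fobj V A\<^esub> u) \<ominus>\<^bsub>fobj V A\<^esub> (w \<oplus>\<^bsub>fobj V A\<^esub> u) = v \<ominus>\<^bsub>fobj V A\<^esub> w" .
    then show ?thesis using d v u by (simp add: qm_eq_iff A)
  qed
  show "qm A (c \<odot>\<^bsub>fobj V A\<^esub> v) = qm A (c \<odot>\<^bsub>fobj V A\<^esub> w)" if c: "c \<in> carrier k"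
  proof -
    have "(c \<odot>\<^bsub>fobj V A\<^esub> v) \<ominus>\<^bsub>fobj V A\<^esub> (c \<odot>\<^bsub>fobj V A\<^esub> w) = c \<odot>\<^bsub>fobj V A\<^esub> (v \<ominus>\<^bsub>fobj V A\<^esub> w)"
      using v c by (simp add: a_minus_def M.smult_r_distr M.smult_r_minus)
    then show ?thesis using M.submoduleE(4)[OF S[OF A] c d] v c by (simp add: qm_eq_iff A)
  qed
  show "qm B (tr V A B h v) = qm B (tr V A B h w)" if h: "B \<in> Fin" "h \<in> E" "h ` A \<subseteq> B"
    using S_map[OF A h d] linear_maps_minus[OF cm_abelian_group[OF V A] cm_abelian_group[OF V h(1)] cm_linear[OF V A h] v]
    by (simp add: qm_eq_iff h cm_closed[OF V A h] v)
qed

lemma carrier_quot [simp]: "sec (quot V S) A = qm A ` sec V A"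
  by (simp add: quot_def)

lemma quot_ops:
  assumes A: "A \<in> Fin"
  shows "module k (fobj (quot V S) A)"
    and "v \<in> sec V A \<Longrightarrow> w \<in> sec V A \<Longrightarrow> qm A v \<oplus>\<^bsub>fobj (quot V S) A\<^esub> qm A w = qm A (v \<oplus>\<^bsub>fobj V A\<^esub> w)"
    and "c \<in> carrier k \<Longrightarrow> v \<in> sec V A \<Longrightarrow> c \<odot>\<^bsub>fobj (quot V S) A\<^esub> qm A v = qm A (c \<odot>\<^bsub>fobj V A\<^esub> v)"
    and "\<zero>\<^bsub>fobj (quot V S) A\<^esub> = qm A \<zero>\<^bsub>fobj V A\<^esub>"
proof -
  have q: "fobj (quot V S) A = image_module (qm A) (fobj V A)" by (simp add: quot_def)
  note c = qm_congs(1,2)[OF A]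
  show "module k (fobj (quot V S) A)"
    unfolding q by (rule module_image_module[OF cm_module[OF V A]]) (rule c; assumption)+
  show "qm A v \<oplus>\<^bsub>fobj (quot V S) A\<^esub> qm A w = qm A (v \<oplus>\<^bsub>fobj V A\<^esub> w)"
    if "v \<in> sec V A" "w \<in> sec V A"
    unfolding q by (rule image_module_add[OF cm_module[OF V A] _ _ that]) (rule c; assumption)+
  show "c \<odot>\<^bsub>fobj (quot V S) A\<^esub> qm A v = qm A (c \<odot>\<^bsub>fobj V A\<^esub> v)"
    if "c \<in> carrier k" "v \<in> sec V A"
    unfolding q by (rule image_module_smult[OF cm_module[OF V A] _ _ that]) (rule c; assumption)+
  show "\<zero>\<^bsub>fobj (quot V S) A\<^esub> = qm A \<zero>\<^bsub>fobj V A\<^esub>" by (simp add: q)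
qed

lemma quot_map:
  assumes A: "A \<in> Fin" "B \<in> Fin" "h \<in> E" "h ` A \<subseteq> B" and v: "v \<in> sec V A"
  shows "tr (quot V S) A B h (qm A v) = qm B (tr V A B h v)"
proof -
  have i: "inv_into (sec V A) (qm A) (qm A v) \<in> sec V A"
    "qm A (inv_into (sec V A) (qm A) (qm A v)) = qm A v"
    using v by (auto intro: inv_into_into f_inv_into_f)
  have "tr (quot V S) A B h (qm A v) =
      qm B (tr V A B h (inv_into (sec V A) (qm A) (qm A v)))"
    using v by (simp add: quot_def)
  also have "\<dots> = qm B (tr V A B h v)" by (rule qm_congs(3)[OF A(1) i(1) v i(2) A(2-4)])
  finally show ?thesis .
qed

lemma quot_in: "quot V S \<in> Obj CM"
proof (rule C_moduleI)
  fix A assume A: "A \<in> Fin"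
  show "module k (fobj (quot V S) A)" by (rule quot_ops(1)[OF A])
  show "v \<in> sec (quot V S) A \<Longrightarrow> tr (quot V S) A A id v = v" for v
    using A by (auto simp: quot_map[OF A A id_E] cm_id[OF V])
next
  fix A B h assume *: "A \<in> Fin" "B \<in> Fin" "h \<in> E" "h ` A \<subseteq> B"
  interpret M: module k "fobj V A" by (rule cm_module[OF V *(1)])
  note lin = cm_linear[OF V *]
  show "tr (quot V S) A B h \<in> linear_maps k (fobj (quot V S) A) (fobj (quot V S) B)"
  proof (rule linear_mapsI)
    show "tr (quot V S) A B h \<in> extensional (sec (quot V S) A)"
      by (simp add: quot_def)
  qed (auto simp: quot_map[OF *] quot_ops(2,3)[OF *(1)] quot_ops(2,3)[OF *(2)] linear_maps_closed[OF lin]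
      linear_maps_add[OF lin] linear_maps_smult[OF lin])
next
  fix A B D h h' v assume *: "A \<in> Fin" "B \<in> Fin" "D \<in> Fin" "h \<in> E" "h ` A \<subseteq> B" "h' \<in> E" "h' ` B \<subseteq> D"
    "v \<in> sec (quot V S) A"
  have "(h' \<circ> h) ` A \<subseteq> D" using * by auto
  then show "tr (quot V S) B D h' (tr (quot V S) A B h v) = tr (quot V S) A D (h' \<circ> h) v"
    using *(8) by (auto simp: quot_map[OF *(1,2,4,5)] quot_map[OF *(2,3,6,7)] quot_map[OF *(1,3) comp_E[OF *(6,4)]]
      cm_closed[OF V *(1,2,4,5)] cm_comp[OF V *(1-7)])
qed

lemma quot_proj_eq: "A \<in> Fin \<Longrightarrow> v \<in> sec V A \<Longrightarrow> quot_proj V S A v = qm A v"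
  by (simp add: quot_proj_def)

lemma quot_proj_in: "quot_proj V S \<in> Mor CM V (quot V S)"
proof (rule Mor_CMI)
  fix A assume A: "A \<in> Fin"
  interpret M: module k "fobj V A" by (rule cm_module[OF V A])
  show "quot_proj V S A \<in> linear_maps k (fobj V A) (fobj (quot V S) A)"
    by (rule linear_mapsI) (auto simp: quot_proj_def A quot_ops[OF A])
qed (auto simp: quot_proj_def quot_map cm_closed[OF V])

lemma quot_proj_zero_iff:
  assumes A: "A \<in> Fin" "v \<in> sec V A"
  shows "quot_proj V S A v = \<zero>\<^bsub>fobj (quot V S) A\<^esub> \<longleftrightarrow> v \<in> S A"
proof -
  interpret M: module k "fobj V A" by (rule cm_module[OF V A(1)])
  have "v \<ominus>\<^bsub>fobj V A\<^esub> \<zero>\<^bsub>fobj V A\<^esub> = v" using A(2) by (simp add: a_minus_def)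
  then show ?thesis using A by (simp add: quot_proj_eq quot_ops(4) qm_eq_iff)
qed

text \<open>The value on a coset is computed at a chosen representative. It does not depend on the
  choice, because two representatives differ by an element of \<open>S A\<close>, where
  \<open>\<eta>\<close> vanishes.\<close>

lemma Mor_from_quot:
  assumes \<eta>: "\<eta> \<in> Mor CM V W" and W: "W \<in> Obj CM"
    and zero: "\<And>A v. A \<in> Fin \<Longrightarrow> v \<in> S A \<Longrightarrow> \<eta> A v = \<zero>\<^bsub>fobj W A\<^esub>"
  shows "\<exists>u\<in>Mor CM (quot V S) W. \<forall>A\<in>Fin. \<forall>v\<in>sec V A. u A (quot_proj V S A v) = \<eta> A v"
proof -
  let ?u = "\<lambda>A\<in>Fin. \<lambda>x\<in>qm A ` sec V A. \<eta> A (inv_into (sec V A) (qm A) x)"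
  have u: "?u A (qm A v) = \<eta> A v" if A: "A \<in> Fin" and v: "v \<in> sec V A" for A v
  proof -
    interpret W: module k "fobj W A" by (rule cm_module[OF W A])
    let ?v = "inv_into (sec V A) (qm A) (qm A v)"
    note lin = mor_linear[OF \<eta> A]
    have v': "?v \<in> sec V A" "qm A ?v = qm A v"
      using v by (auto intro: inv_into_into f_inv_into_f)
    then have "\<eta> A (?v \<ominus>\<^bsub>fobj V A\<^esub> v) = \<zero>\<^bsub>fobj W A\<^esub>" using v by (intro zero[OF A]) (simp add: qm_eq_iff A)
    then have "\<eta> A ?v \<ominus>\<^bsub>fobj W A\<^esub> \<eta> A v = \<zero>\<^bsub>fobj W A\<^esub>"
      using linear_maps_minus[OF cm_abelian_group[OF V A] cm_abelian_group[OF W A] lin v'(1) v] by simp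
    then have "\<eta> A ?v = \<eta> A v"
      using linear_maps_closed[OF lin v] linear_maps_closed[OF lin v'(1)]
      by (metis W.M.add.inv_solve_right W.M.l_zero W.M.zero_closed a_minus_def)
    then show ?thesis using A v by simp
  qed
  have "?u \<in> Mor CM (quot V S) W"
  proof (rule Mor_CMI)
    fix A assume A: "A \<in> Fin"
    interpret M: module k "fobj V A" by (rule cm_module[OF V A])
    note lin = mor_linear[OF \<eta> A]
    have "?u A \<in> extensional (sec (quot V S) A)" using A by simp
    then show "?u A \<in> linear_maps k (fobj (quot V S) A) (fobj W A)"
      by (rule linear_mapsI)
        (auto simp: quot_ops[OF A] u[OF A] linear_maps_closed[OF lin] linear_maps_add[OF lin] linear_maps_smult[OF lin]
          simp del: restrict_apply)
  next
    fix A B h v assume *: "A \<in> Fin" "B \<in> Fin" "h \<in> E" "h ` A \<subseteq> B" "v \<in> sec (quot V S) A"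
    then show "?u B (tr (quot V S) A B h v) = tr W A B h (?u A v)"
      by (auto simp: quot_map[OF *(1-4)] u cm_closed[OF V *(1-4)] mor_natural[OF \<eta> *(1-4)] simp del: restrict_apply)
  qed simp
  moreover have "\<forall>A\<in>Fin. \<forall>v\<in>sec V A. ?u A (quot_proj V S A v) = \<eta> A v"
    using u by (auto simp: quot_proj_eq simp del: restrict_apply)
  ultimately show ?thesis by blast
qed

end

section \<open>Products of two C-modules, coded in the universe\<close>

definition pair1 :: "'u \<Rightarrow> 'u" where "pair1 x = fst (inv_into UNIV pair x)"
definition pair2 :: "'u \<Rightarrow> 'u" where "pair2 x = snd (inv_into UNIV pair x)"

lemma pair_simps [simp]: "pair1 (pair (x, y)) = x" "pair2 (pair (x, y)) = y"
  by (simp_all add: pair1_def pair2_def inj_pair)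

lemma pair_eq_iff [simp]: "pair p = pair q \<longleftrightarrow> p = q"
  by (rule inj_eq[OF inj_pair])

definition pair_module :: "('k, 'u) module \<Rightarrow> ('k, 'u) module \<Rightarrow> ('k, 'u) module" where
  "pair_module M N = \<lparr>carrier = pair ` (carrier M \<times> carrier N), mult = undefined, one = undefined,
     ring.zero = pair (\<zero>\<^bsub>M\<^esub>, \<zero>\<^bsub>N\<^esub>),
     add = (\<lambda>x y. pair (pair1 x \<oplus>\<^bsub>M\<^esub> pair1 y, pair2 x \<oplus>\<^bsub>N\<^esub> pair2 y)),
     smult = (\<lambda>c x. pair (c \<odot>\<^bsub>M\<^esub> pair1 x, c \<odot>\<^bsub>N\<^esub> pair2 x))\<rparr>"

lemma pair_module_simps [simp]:
  "carrier (pair_module M N) = pair ` (carrier M \<times> carrier N)"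
  "\<zero>\<^bsub>pair_module M N\<^esub> = pair (\<zero>\<^bsub>M\<^esub>, \<zero>\<^bsub>N\<^esub>)"
  "x \<oplus>\<^bsub>pair_module M N\<^esub> y = pair (pair1 x \<oplus>\<^bsub>M\<^esub> pair1 y, pair2 x \<oplus>\<^bsub>N\<^esub> pair2 y)"
  "c \<odot>\<^bsub>pair_module M N\<^esub> x = pair (c \<odot>\<^bsub>M\<^esub> pair1 x, c \<odot>\<^bsub>N\<^esub> pair2 x)"
  by (simp_all add: pair_module_def)

lemma module_pair_module:
  assumes "module k M" "module k N"
  shows "module k (pair_module M N)"
proof -
  interpret M: module k M by fact
  interpret N: module k N by fact
  show ?thesis
  proof (rule moduleI[OF k])
    show "abelian_group (pair_module M N)"
    proof (rule abelian_groupI)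
      fix x assume "x \<in> carrier (pair_module M N)"
      then obtain m n where "m \<in> carrier M" "n \<in> carrier N" "x = pair (m, n)" by auto
      then show "\<exists>y\<in>carrier (pair_module M N). y \<oplus>\<^bsub>pair_module M N\<^esub> x = \<zero>\<^bsub>pair_module M N\<^esub>"
        by (intro bexI[of _ "pair (\<ominus>\<^bsub>M\<^esub> m, \<ominus>\<^bsub>N\<^esub> n)"]) (auto simp: M.l_neg N.l_neg)
    qed (auto simp: M.a_ac N.a_ac)
  qed (auto simp: M.smult_l_distr N.smult_l_distr M.smult_r_distr N.smult_r_distr M.smult_assoc1 N.smult_assoc1)
qed

definition pair_cmod :: "('w, 'k, 'u) cmod \<Rightarrow> ('w, 'k, 'u) cmod \<Rightarrow> ('w, 'k, 'u) cmod" where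
  "pair_cmod V W = \<lparr>fobj = (\<lambda>A. pair_module (fobj V A) (fobj W A)),
     fmap = (\<lambda>A B f. \<lambda>x\<in>pair ` (sec V A \<times> sec W A). pair (fmap V A B f (pair1 x), fmap W A B f (pair2 x)))\<rparr>"

lemma pair_cmod_simps [simp]: "fobj (pair_cmod V W) A = pair_module (fobj V A) (fobj W A)"
  "fmap (pair_cmod V W) A B f =
     (\<lambda>x\<in>pair ` (sec V A \<times> sec W A). pair (fmap V A B f (pair1 x), fmap W A B f (pair2 x)))"
  by (simp_all add: pair_cmod_def)

context
  fixes V W assumes V: "V \<in> Obj CM" and W: "W \<in> Obj CM"
begin

lemma pair_cmod_in: "pair_cmod V W \<in> Obj CM"
proof (rule C_moduleI)
  fix A assume A: "A \<in> Fin"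
  show "module k (fobj (pair_cmod V W) A)"
    by (simp add: module_pair_module cm_module[OF V A] cm_module[OF W A])
  show "v \<in> sec (pair_cmod V W) A \<Longrightarrow> tr (pair_cmod V W) A A id v = v" for v
    by (auto simp: cm_id[OF V A] cm_id[OF W A])
next
  fix A B h assume *: "A \<in> Fin" "B \<in> Fin" "h \<in> E" "h ` A \<subseteq> B"
  interpret V: module k "fobj V A" by (rule cm_module[OF V *(1)])
  interpret W: module k "fobj W A" by (rule cm_module[OF W *(1)])
  note lin = cm_linear[OF V *] and lin' = cm_linear[OF W *]
  show "tr (pair_cmod V W) A B h \<in> linear_maps k (fobj (pair_cmod V W) A) (fobj (pair_cmod V W) B)"
    by (rule linear_mapsI)
      (auto simp: linear_maps_closed[OF lin] linear_maps_closed[OF lin'] linear_maps_add[OF lin] linear_maps_add[OF lin']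
        linear_maps_smult[OF lin] linear_maps_smult[OF lin'])
next
  fix A B D h h' v assume *: "A \<in> Fin" "B \<in> Fin" "D \<in> Fin" "h \<in> E" "h ` A \<subseteq> B" "h' \<in> E" "h' ` B \<subseteq> D"
    "v \<in> sec (pair_cmod V W) A"
  then show "tr (pair_cmod V W) B D h' (tr (pair_cmod V W) A B h v) =
      tr (pair_cmod V W) A D (h' \<circ> h) v"
    by (auto simp: cm_comp[OF V *(1-7)] cm_comp[OF W *(1-7)] cm_closed[OF V *(1,2,4,5)] cm_closed[OF W *(1,2,4,5)])
qed

lemma pair_proj_in:
  "(\<lambda>A\<in>Fin. \<lambda>x\<in>sec (pair_cmod V W) A. pair1 x) \<in> Mor CM (pair_cmod V W) V"
  "(\<lambda>A\<in>Fin. \<lambda>x\<in>sec (pair_cmod V W) A. pair2 x) \<in> Mor CM (pair_cmod V W) W"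
proof -
  have cl: "x \<oplus>\<^bsub>fobj U A\<^esub> y \<in> sec U A" "c \<in> carrier k \<Longrightarrow> c \<odot>\<^bsub>fobj U A\<^esub> x \<in> sec U A"
    if "U \<in> Obj CM" "A \<in> Fin" "x \<in> sec U A" "y \<in> sec U A" for U A x y c
    using that cm_module[OF that(1,2)] cm_abelian_group[OF that(1,2)]
    by (auto simp: module.smult_closed abelian_monoid.a_closed abelian_group.axioms(1))
  show "(\<lambda>A\<in>Fin. \<lambda>x\<in>sec (pair_cmod V W) A. pair1 x) \<in> Mor CM (pair_cmod V W) V"
    by (rule Mor_CMI, simp, rule linear_mapsI) (auto simp: cl V W cm_closed)
  show "(\<lambda>A\<in>Fin. \<lambda>x\<in>sec (pair_cmod V W) A. pair2 x) \<in> Mor CM (pair_cmod V W) W"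
    by (rule Mor_CMI, simp, rule linear_mapsI) (auto simp: cl V W cm_closed)
qed

end

subsection \<open>Torsion modules and isomorphisms modulo torsion\<close>

abbreviation "Tor \<equiv> torsion_modules k Fin E :: ('w, 'k, 'u) cmod set"

lemma cm_ops:
  assumes "V \<in> Obj CM" "A \<in> Fin"
  shows cm_zero_closed: "\<zero>\<^bsub>fobj V A\<^esub> \<in> sec V A"
    and cm_add_closed: "x \<in> sec V A \<Longrightarrow> y \<in> sec V A \<Longrightarrow> x \<oplus>\<^bsub>fobj V A\<^esub> y \<in> sec V A"
    and cm_smult_closed: "c \<in> carrier k \<Longrightarrow> x \<in> sec V A \<Longrightarrow> c \<odot>\<^bsub>fobj V A\<^esub> x \<in> sec V A"
    and cm_minus_closed: "x \<in> sec V A \<Longrightarrow> y \<in> sec V A \<Longrightarrow> x \<ominus>\<^bsub>fobj V A\<^esub> y \<in> sec V A"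
    and cm_zero_add: "\<zero>\<^bsub>fobj V A\<^esub> \<oplus>\<^bsub>fobj V A\<^esub> \<zero>\<^bsub>fobj V A\<^esub> = \<zero>\<^bsub>fobj V A\<^esub>"
    and cm_smult_zero: "c \<in> carrier k \<Longrightarrow> c \<odot>\<^bsub>fobj V A\<^esub> \<zero>\<^bsub>fobj V A\<^esub> = \<zero>\<^bsub>fobj V A\<^esub>"
    and cm_minus_eq_zero: "x \<in> sec V A \<Longrightarrow> y \<in> sec V A \<Longrightarrow>
      x \<ominus>\<^bsub>fobj V A\<^esub> y = \<zero>\<^bsub>fobj V A\<^esub> \<longleftrightarrow> x = y"
proof -
  interpret M: module k "fobj V A" by (rule cm_module[OF assms])
  show "\<zero>\<^bsub>fobj V A\<^esub> \<in> sec V A"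
    "x \<in> sec V A \<Longrightarrow> y \<in> sec V A \<Longrightarrow> x \<oplus>\<^bsub>fobj V A\<^esub> y \<in> sec V A"
    "c \<in> carrier k \<Longrightarrow> x \<in> sec V A \<Longrightarrow> c \<odot>\<^bsub>fobj V A\<^esub> x \<in> sec V A"
    "x \<in> sec V A \<Longrightarrow> y \<in> sec V A \<Longrightarrow> x \<ominus>\<^bsub>fobj V A\<^esub> y \<in> sec V A"
    "\<zero>\<^bsub>fobj V A\<^esub> \<oplus>\<^bsub>fobj V A\<^esub> \<zero>\<^bsub>fobj V A\<^esub> = \<zero>\<^bsub>fobj V A\<^esub>"
    "c \<in> carrier k \<Longrightarrow> c \<odot>\<^bsub>fobj V A\<^esub> \<zero>\<^bsub>fobj V A\<^esub> = \<zero>\<^bsub>fobj V A\<^esub>" by simp_all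
  show "x \<in> sec V A \<Longrightarrow> y \<in> sec V A \<Longrightarrow> x \<ominus>\<^bsub>fobj V A\<^esub> y = \<zero>\<^bsub>fobj V A\<^esub> \<longleftrightarrow> x = y"
    by (metis M.M.add.inv_solve_right M.M.l_zero M.M.zero_closed a_minus_def)
qed

lemma mor_closed: "\<eta> \<in> Mor CM V W \<Longrightarrow> A \<in> Fin \<Longrightarrow> v \<in> sec V A \<Longrightarrow> \<eta> A v \<in> sec W A"
  by (rule linear_maps_closed[OF mor_linear])

lemma mor_zero:
  assumes "V \<in> Obj CM" "W \<in> Obj CM" "\<eta> \<in> Mor CM V W" "A \<in> Fin"
  shows "\<eta> A \<zero>\<^bsub>fobj V A\<^esub> = \<zero>\<^bsub>fobj W A\<^esub>"
  by (rule linear_maps_zero[OF cm_abelian_group[OF assms(1,4)] cm_abelian_group[OF assms(2,4)] mor_linear[OF assms(3,4)]])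

lemma mor_natural_id: "\<eta> \<in> Mor CM V W \<Longrightarrow> A \<in> Fin \<Longrightarrow> B \<in> Fin \<Longrightarrow> A \<subseteq> B \<Longrightarrow> v \<in> sec V A \<Longrightarrow>
    \<eta> B (tr V A B id v) = tr W A B id (\<eta> A v)"
  by (rule mor_natural[OF _ _ _ id_E]) auto

lemma zero_map_in:
  assumes V: "V \<in> Obj CM" and W: "W \<in> Obj CM"
  shows "(\<lambda>A\<in>Fin. \<lambda>v\<in>sec V A. \<zero>\<^bsub>fobj W A\<^esub>) \<in> Mor CM V W"
  by (rule Mor_CMI, simp, rule linear_mapsI)
    (auto simp: cm_ops[OF V] cm_ops[OF W] cm_closed[OF V] cm_map_zero[OF W])

text \<open>Taking the zero submodule of a given object yields a zero object without singling out an
  element of the universe.\<close>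

lemma zero_object_sub:
  assumes V: "V \<in> Obj CM"
  shows "zero_object CM (sub V (\<lambda>A. {\<zero>\<^bsub>fobj V A\<^esub>}))" (is "zero_object CM ?Z")
proof -
  have Z: "?Z \<in> Obj CM"
    by (rule sub_in[OF V cm_submoduleI[OF V]]) (auto simp: cm_ops[OF V] cm_map_zero[OF V])
  have "\<exists>!f. f \<in> Mor CM X ?Z" if X: "X \<in> Obj CM" for X
  proof (rule ex1I)
    show "(\<lambda>A\<in>Fin. \<lambda>v\<in>sec X A. \<zero>\<^bsub>fobj ?Z A\<^esub>) \<in> Mor CM X ?Z" by (rule zero_map_in[OF X Z])
    fix f assume f: "f \<in> Mor CM X ?Z"
    show "f = (\<lambda>A\<in>Fin. \<lambda>v\<in>sec X A. \<zero>\<^bsub>fobj ?Z A\<^esub>)"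
      by (rule Mor_CM_eqI[OF f zero_map_in[OF X Z]]) (use mor_closed[OF f] in auto)
  qed
  moreover have "\<exists>!f. f \<in> Mor CM ?Z X" if X: "X \<in> Obj CM" for X
  proof (rule ex1I)
    show "(\<lambda>A\<in>Fin. \<lambda>v\<in>sec ?Z A. \<zero>\<^bsub>fobj X A\<^esub>) \<in> Mor CM ?Z X" by (rule zero_map_in[OF Z X])
    fix f assume f: "f \<in> Mor CM ?Z X"
    show "f = (\<lambda>A\<in>Fin. \<lambda>v\<in>sec ?Z A. \<zero>\<^bsub>fobj X A\<^esub>)"
      by (rule Mor_CM_eqI[OF f zero_map_in[OF Z X]]) (use mor_zero[OF Z X f] in auto)
  qed
  ultimately show ?thesis using Z by (simp add: zero_object_def)
qed

text \<open>A morphism into a zero object is unique and hence the zero map, and linear maps preserve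
  zero. Conversely, the zero submodule of \<open>X\<close> serves as the object to factor
  through.\<close>

lemma zero_morphism_iff:
  assumes X: "X \<in> Obj CM" and Y: "Y \<in> Obj CM" and f: "f \<in> Mor CM X Y"
  shows "zero_morphism CM X Y f \<longleftrightarrow> (\<forall>A\<in>Fin. \<forall>v\<in>sec X A. f A v = \<zero>\<^bsub>fobj Y A\<^esub>)"
proof
  assume "zero_morphism CM X Y f"
  then obtain Z a b where Z: "zero_object CM Z" and ab: "a \<in> Mor CM X Z" "b \<in> Mor CM Z Y" and f: "f = Cmp CM X Z Y b a"
    unfolding zero_morphism_def by blast
  have ZO: "Z \<in> Obj CM" using Z by (simp add: zero_object_def)
  have "\<exists>!f. f \<in> Mor CM X Z" using Z X by (simp add: zero_object_def)
  then have a: "a = (\<lambda>A\<in>Fin. \<lambda>v\<in>sec X A. \<zero>\<^bsub>fobj Z A\<^esub>)"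
    using ab(1) zero_map_in[OF X ZO] by blast
  show "\<forall>A\<in>Fin. \<forall>v\<in>sec X A. f A v = \<zero>\<^bsub>fobj Y A\<^esub>"
    by (simp add: f a compose_def mor_zero[OF ZO Y ab(2)])
next
  let ?Z = "sub X (\<lambda>A. {\<zero>\<^bsub>fobj X A\<^esub>})"
  let ?a = "\<lambda>A\<in>Fin. \<lambda>v\<in>sec X A. \<zero>\<^bsub>fobj ?Z A\<^esub>"
  let ?b = "\<lambda>A\<in>Fin. \<lambda>v\<in>sec ?Z A. \<zero>\<^bsub>fobj Y A\<^esub>"
  assume *: "\<forall>A\<in>Fin. \<forall>v\<in>sec X A. f A v = \<zero>\<^bsub>fobj Y A\<^esub>"
  have Z: "zero_object CM ?Z" by (rule zero_object_sub[OF X])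
  then have ZO: "?Z \<in> Obj CM" by (simp add: zero_object_def)
  note a = zero_map_in[OF X ZO] and b = zero_map_in[OF ZO Y]
  have "f = Cmp CM X ?Z Y ?b ?a"
    by (rule Mor_CM_eqI[OF f Cmp_in[OF is_category_CM X ZO Y a b]]) (use * in \<open>simp add: compose_def\<close>)
  then show "zero_morphism CM X Y f" unfolding zero_morphism_def using Z a b by blast
qed

lemma Tor_iff: "V \<in> Tor \<longleftrightarrow> V \<in> Obj CM \<and>
    (\<forall>A\<in>Fin. \<forall>v\<in>sec V A. \<exists>B\<in>Fin. A \<subseteq> B \<and> tr V A B id v = \<zero>\<^bsub>fobj V B\<^esub>)"
  by (simp add: torsion_modules_def incl_eq)

text \<open>The right-hand side says that the kernel of \<open>s\<close> is torsion. Two classes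
  with the same image are moved to a stage where the images of their representatives agree; the
  difference of the representatives then lies in the kernel and dies at a later stage.\<close>

lemma inj_on_Psi_map_iff:
  assumes X: "X \<in> Obj CM" and Y: "Y \<in> Obj CM" and s: "s \<in> Mor CM X Y"
  shows "inj_on (Psi_map X Y s) (germs X) \<longleftrightarrow> (\<forall>A\<in>Fin. \<forall>v\<in>sec X A. s A v = \<zero>\<^bsub>fobj Y A\<^esub> \<longrightarrow>
    (\<exists>B\<in>Fin. A \<subseteq> B \<and> tr X A B id v = \<zero>\<^bsub>fobj X B\<^esub>))"
proof (intro iffI ballI impI)
  fix A v assume inj: "inj_on (Psi_map X Y s) (germs X)" and A: "A \<in> Fin" "v \<in> sec X A" "s A v = \<zero>\<^bsub>fobj Y A\<^esub>"
  have "Psi_map X Y s (germ X A v) = Psi_map X Y s (germ X A \<zero>\<^bsub>fobj X A\<^esub>)"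
    using A by (simp add: Psi_map_germ[OF X Y s] cm_zero_closed[OF X] mor_zero[OF X Y s])
  then have "germ X A v = germ X A \<zero>\<^bsub>fobj X A\<^esub>"
    by (rule inj_onD[OF inj]) (use A in \<open>auto intro!: germ_in cm_zero_closed[OF X]\<close>)
  then obtain B where "B \<in> Fin" "A \<subseteq> B" "tr X A B id v = tr X A B id \<zero>\<^bsub>fobj X A\<^esub>"
    using germ_eq_iff[OF X A(1,2) A(1) cm_zero_closed[OF X A(1)]] by blast
  then show "\<exists>B\<in>Fin. A \<subseteq> B \<and> tr X A B id v = \<zero>\<^bsub>fobj X B\<^esub>"
    using cm_map_zero[OF X A(1) _ id_E] by (intro bexI[of _ B]) auto
next
  assume van: "\<forall>A\<in>Fin. \<forall>v\<in>sec X A. s A v = \<zero>\<^bsub>fobj Y A\<^esub> \<longrightarrow>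
    (\<exists>B\<in>Fin. A \<subseteq> B \<and> tr X A B id v = \<zero>\<^bsub>fobj X B\<^esub>)"
  show "inj_on (Psi_map X Y s) (germs X)"
  proof (rule inj_onI)
    fix x y assume xy: "x \<in> germs X" "y \<in> germs X" "Psi_map X Y s x = Psi_map X Y s y"
    obtain A v w where A: "A \<in> Fin" "v \<in> sec X A" "w \<in> sec X A" "x = germ X A v" "y = germ X A w"
      by (rule germs_common2[OF X xy(1,2)])
    have "germ Y A (s A v) = germ Y A (s A w)" using xy(3) A by (simp add: Psi_map_germ[OF X Y s])
    then obtain D where D: "D \<in> Fin" "A \<subseteq> D" "tr Y A D id (s A v) = tr Y A D id (s A w)"
      using germ_eq_iff[OF Y A(1) _ A(1)] mor_closed[OF s A(1)] A by blast
    let ?v = "tr X A D id v" and ?w = "tr X A D id w"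
    note vw = cm_closed_id[OF X A(1) D(1,2) A(2)] cm_closed_id[OF X A(1) D(1,2) A(3)]
    have "s D (?v \<ominus>\<^bsub>fobj X D\<^esub> ?w) = s D ?v \<ominus>\<^bsub>fobj Y D\<^esub> s D ?w"
      by (rule linear_maps_minus[OF cm_abelian_group[OF X D(1)] cm_abelian_group[OF Y D(1)] mor_linear[OF s D(1)] vw])
    also have "s D ?v = s D ?w" using mor_natural_id[OF s A(1) D(1,2)] A D(3) by simp
    also have "s D ?w \<ominus>\<^bsub>fobj Y D\<^esub> s D ?w = \<zero>\<^bsub>fobj Y D\<^esub>"
      using mor_closed[OF s D(1) vw(2)] by (simp add: cm_minus_eq_zero[OF Y D(1)])
    finally obtain B where B: "B \<in> Fin" "D \<subseteq> B" "tr X D B id (?v \<ominus>\<^bsub>fobj X D\<^esub> ?w) = \<zero>\<^bsub>fobj X B\<^esub>"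
      using van D(1) cm_minus_closed[OF X D(1) vw] by blast
    have "tr X D B id ?v \<ominus>\<^bsub>fobj X B\<^esub> tr X D B id ?w = \<zero>\<^bsub>fobj X B\<^esub>"
      using linear_maps_minus[OF cm_abelian_group[OF X D(1)] cm_abelian_group[OF X B(1)] cm_linear_id[OF X D(1) B(1,2)] vw] B(3) by simp
    then have eq: "tr X D B id ?v = tr X D B id ?w"
      using cm_minus_eq_zero[OF X B(1)] cm_closed_id[OF X D(1) B(1,2)] vw by blast
    have "germ X A v = germ X B (tr X D B id ?v)" "germ X A w = germ X B (tr X D B id ?w)"
      using germ_incl[OF X D(1) B(1,2)] vw germ_incl[OF X A(1) D(1,2)] A(2,3) by simp_all
    then show "x = y" using A eq by simp
  qed
qed

text \<open>The right-hand side says that the cokernel of \<open>s\<close> is torsion. A preimage of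
  the class of \<open>y\<close> is represented at some stage of its own, and its image meets
  \<open>y\<close> at a common later stage.\<close>

lemma surj_Psi_map_iff:
  assumes X: "X \<in> Obj CM" and Y: "Y \<in> Obj CM" and s: "s \<in> Mor CM X Y"
  shows "germs Y \<subseteq> Psi_map X Y s ` germs X \<longleftrightarrow> (\<forall>A\<in>Fin. \<forall>y\<in>sec Y A.
    \<exists>B\<in>Fin. A \<subseteq> B \<and> tr Y A B id y \<in> s B ` sec X B)"
proof (intro iffI ballI subsetI)
  fix A y assume sub: "germs Y \<subseteq> Psi_map X Y s ` germs X" and A: "A \<in> Fin" "y \<in> sec Y A"
  then obtain x where x: "x \<in> germs X" "germ Y A y = Psi_map X Y s x" using germ_in[of A y Y] by blast
  obtain B v where B: "B \<in> Fin" "v \<in> sec X B" "x = germ X B v" using x(1) by (rule germsE)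
  then have "germ Y A y = germ Y B (s B v)" using x(2) by (simp add: Psi_map_germ[OF X Y s])
  then obtain D where D: "D \<in> Fin" "A \<subseteq> D" "B \<subseteq> D" "tr Y A D id y = tr Y B D id (s B v)"
    using germ_eq_iff[OF Y A B(1)] mor_closed[OF s B(1,2)] by blast
  then have "tr Y A D id y = s D (tr X B D id v)"
    using mor_natural_id[OF s B(1) D(1,3) B(2)] by simp
  then show "\<exists>B\<in>Fin. A \<subseteq> B \<and> tr Y A B id y \<in> s B ` sec X B"
    using D cm_closed_id[OF X B(1) D(1,3) B(2)] by blast
next
  fix x assume *: "\<forall>A\<in>Fin. \<forall>y\<in>sec Y A. \<exists>B\<in>Fin. A \<subseteq> B \<and> tr Y A B id y \<in> s B ` sec X B"
    and x: "x \<in> germs Y"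
  obtain A y where A: "A \<in> Fin" "y \<in> sec Y A" "x = germ Y A y" using x by (rule germsE)
  then obtain B v where B: "B \<in> Fin" "A \<subseteq> B" "v \<in> sec X B" "tr Y A B id y = s B v"
    using * by blast
  then have "x = Psi_map X Y s (germ X B v)"
    using A germ_incl[OF Y A(1) B(1,2) A(2)] by (simp add: Psi_map_germ[OF X Y s])
  then show "x \<in> Psi_map X Y s ` germs X" using germ_in[OF B(1,3)] by blast
qed

lemma is_iso_Psi_map_iff:
  assumes X: "X \<in> Obj CM" and Y: "Y \<in> Obj CM" and s: "s \<in> Mor CM X Y"
  shows "is_iso UC (Psi X) (Psi Y) (Psi_map X Y s) \<longleftrightarrow>
    inj_on (Psi_map X Y s) (germs X) \<and> germs Y \<subseteq> Psi_map X Y s ` germs X"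
proof -
  have "Psi_map X Y s ` germs X \<subseteq> germs Y"
    using Psi_map_in[OF X Y s] linear_maps_closed by (fastforce simp: Mor_UC)
  then show ?thesis
    using is_iso_UC[OF Psi_in[OF X] Psi_in[OF Y] Psi_map_in[OF X Y s]] by (auto simp: bij_betw_def)
qed

definition kernel :: "('w, 'k, 'u) cmod \<Rightarrow> ('w, 'k, 'u) cmod \<Rightarrow> ('w set \<Rightarrow> 'u \<Rightarrow> 'u) \<Rightarrow> 'w set \<Rightarrow> 'u set" where
  "kernel X Y s A = {v \<in> sec X A. s A v = \<zero>\<^bsub>fobj Y A\<^esub>}"

definition range_of :: "('w, 'k, 'u) cmod \<Rightarrow> ('w set \<Rightarrow> 'u \<Rightarrow> 'u) \<Rightarrow> 'w set \<Rightarrow> 'u set" where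
  "range_of X s A = s A ` sec X A"

context
  fixes X Y s
  assumes X: "X \<in> Obj CM" and Y: "Y \<in> Obj CM" and s: "s \<in> Mor CM X Y"
begin

lemma kernel_sub:
  "A \<in> Fin \<Longrightarrow> submodule (kernel X Y s A) k (fobj X A)"
  "A \<in> Fin \<Longrightarrow> B \<in> Fin \<Longrightarrow> h \<in> E \<Longrightarrow> h ` A \<subseteq> B \<Longrightarrow> v \<in> kernel X Y s A \<Longrightarrow> tr X A B h v \<in> kernel X Y s B"
proof -
  show "A \<in> Fin \<Longrightarrow> submodule (kernel X Y s A) k (fobj X A)"
    by (rule cm_submoduleI[OF X])
      (auto simp: kernel_def cm_ops[OF X] cm_ops[OF Y] mor_zero[OF X Y s] linear_maps_add[OF mor_linear[OF s]]
        linear_maps_smult[OF mor_linear[OF s]])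
  show "A \<in> Fin \<Longrightarrow> B \<in> Fin \<Longrightarrow> h \<in> E \<Longrightarrow> h ` A \<subseteq> B \<Longrightarrow> v \<in> kernel X Y s A \<Longrightarrow> tr X A B h v \<in> kernel X Y s B"
    by (auto simp: kernel_def cm_closed[OF X] mor_natural[OF s] cm_map_zero[OF Y])
qed

lemma range_sub:
  "A \<in> Fin \<Longrightarrow> submodule (range_of X s A) k (fobj Y A)"
  "A \<in> Fin \<Longrightarrow> B \<in> Fin \<Longrightarrow> h \<in> E \<Longrightarrow> h ` A \<subseteq> B \<Longrightarrow> v \<in> range_of X s A \<Longrightarrow> tr Y A B h v \<in> range_of X s B"
proof -
  show "submodule (range_of X s A) k (fobj Y A)" if A: "A \<in> Fin"
  proof (rule cm_submoduleI[OF Y A])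
    note lin = mor_linear[OF s A]
    show "\<zero>\<^bsub>fobj Y A\<^esub> \<in> range_of X s A"
      unfolding range_of_def using mor_zero[OF X Y s A] cm_zero_closed[OF X A] by (metis imageI)
    show "x \<oplus>\<^bsub>fobj Y A\<^esub> y \<in> range_of X s A" if "x \<in> range_of X s A" "y \<in> range_of X s A" for x y
      using that cm_add_closed[OF X A] by (auto simp: range_of_def linear_maps_add[OF lin, symmetric])
    show "c \<odot>\<^bsub>fobj Y A\<^esub> x \<in> range_of X s A" if "c \<in> carrier k" "x \<in> range_of X s A" for c x
      using that cm_smult_closed[OF X A] by (auto simp: range_of_def linear_maps_smult[OF lin, symmetric])
  qed (auto simp: range_of_def A mor_closed[OF s])
  show "A \<in> Fin \<Longrightarrow> B \<in> Fin \<Longrightarrow> h \<in> E \<Longrightarrow> h ` A \<subseteq> B \<Longrightarrow> v \<in> range_of X s A \<Longrightarrow> tr Y A B h v \<in> range_of X s B"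
    by (auto simp: range_of_def mor_natural[OF s, symmetric] cm_closed[OF X])
qed

text \<open>A map into the submodule is the same function as a map into \<open>X\<close> with values
  there, so the unique factorization of \<open>g\<close> is \<open>g\<close> itself.\<close>

lemma is_kernel_kernel: "is_kernel CM X Y s (sub X (kernel X Y s)) (sub_incl (kernel X Y s))"
proof -
  let ?K = "sub X (kernel X Y s)" and ?i = "sub_incl (kernel X Y s)"
  have K: "?K \<in> Obj CM" by (rule sub_in[OF X kernel_sub])
  have i: "?i \<in> Mor CM ?K X" by (rule sub_incl_in[OF X kernel_sub])
  note cmp = Cmp_in[OF is_category_CM]
  have "zero_morphism CM ?K Y (Cmp CM ?K X Y s ?i)"
    unfolding zero_morphism_iff[OF K Y cmp[OF K X Y i s]]
    by (simp add: compose_def sub_incl_def) (simp add: kernel_def)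
  moreover have "\<exists>!u. u \<in> Mor CM W ?K \<and> Cmp CM W ?K X ?i u = g"
    if W: "W \<in> Obj CM" and g: "g \<in> Mor CM W X" and z: "zero_morphism CM W Y (Cmp CM W X Y s g)" for W g
  proof -
    have "\<forall>A\<in>Fin. \<forall>v\<in>sec W A. s A (g A v) = \<zero>\<^bsub>fobj Y A\<^esub>"
      using z unfolding zero_morphism_iff[OF W Y cmp[OF W X Y g s]] by (simp add: compose_def)
    then have gK: "\<And>A v. A \<in> Fin \<Longrightarrow> v \<in> sec W A \<Longrightarrow> g A v \<in> kernel X Y s A"
      using mor_closed[OF g] by (auto simp: kernel_def)
    have "g \<in> Mor CM W ?K" by (rule Mor_sub[OF X kernel_sub g gK])
    moreover have comp: "Cmp CM W ?K X ?i u = u" if u: "u \<in> Mor CM W ?K" for u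
    proof (rule extensionalityI)
      fix A assume A: "A \<in> Fin"
      show "Cmp CM W ?K X ?i u A = u A"
        by (rule extensionalityI[OF _ linear_maps_extensional[OF mor_linear[OF u A]]])
          (use A mor_closed[OF u A] in \<open>auto simp: compose_def sub_incl_def\<close>)
    qed (use mor_extensional[OF u] in auto)
    ultimately show ?thesis by (intro ex1I[of _ g]) auto
  qed
  ultimately show ?thesis unfolding is_kernel_def using K i by blast
qed

lemma cokernel_proj_zero_iff:
  "A \<in> Fin \<Longrightarrow> v \<in> sec Y A \<Longrightarrow>
    quot_proj Y (range_of X s) A v = \<zero>\<^bsub>fobj (quot Y (range_of X s)) A\<^esub> \<longleftrightarrow> v \<in> range_of X s A"
  by (rule quot_proj_zero_iff[OF Y range_sub])

text \<open>A map that vanishes on the range descends to cosets. The descent is unique because every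
  section of the quotient is the image of a section of \<open>Y\<close>.\<close>

lemma is_cokernel_cokernel: "is_cokernel CM X Y s (quot Y (range_of X s)) (quot_proj Y (range_of X s))"
proof -
  let ?Q = "quot Y (range_of X s)" and ?p = "quot_proj Y (range_of X s)"
  have Q: "?Q \<in> Obj CM" by (rule quot_in[OF Y range_sub])
  have p: "?p \<in> Mor CM Y ?Q" by (rule quot_proj_in[OF Y range_sub])
  note cmp = Cmp_in[OF is_category_CM]
  have "zero_morphism CM X ?Q (Cmp CM X Y ?Q ?p s)"
    unfolding zero_morphism_iff[OF X Q cmp[OF X Y Q s p]]
    by (auto simp: compose_def cokernel_proj_zero_iff mor_closed[OF s]) (simp add: range_of_def)
  moreover have "\<exists>!u. u \<in> Mor CM ?Q W \<and> Cmp CM Y ?Q W u ?p = g"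
    if W: "W \<in> Obj CM" and g: "g \<in> Mor CM Y W" and z: "zero_morphism CM X W (Cmp CM X Y W g s)" for W g
  proof -
    have "\<forall>A\<in>Fin. \<forall>v\<in>sec X A. g A (s A v) = \<zero>\<^bsub>fobj W A\<^esub>"
      using z unfolding zero_morphism_iff[OF X W cmp[OF X Y W s g]] by (simp add: compose_def)
    then have "\<And>A v. A \<in> Fin \<Longrightarrow> v \<in> range_of X s A \<Longrightarrow> g A v = \<zero>\<^bsub>fobj W A\<^esub>"
      by (auto simp: range_of_def)
    then obtain u where u: "u \<in> Mor CM ?Q W" "\<forall>A\<in>Fin. \<forall>v\<in>sec Y A. u A (?p A v) = g A v"
      using Mor_from_quot[OF Y range_sub g W] by blast
    show ?thesis
    proof (rule ex1I[of _ u])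
      show "u \<in> Mor CM ?Q W \<and> Cmp CM Y ?Q W u ?p = g"
        using u by (intro conjI Mor_CM_eqI[OF cmp[OF Y Q W p u(1)] g]) (auto simp: compose_def)
      fix u' assume u': "u' \<in> Mor CM ?Q W \<and> Cmp CM Y ?Q W u' ?p = g"
      show "u' = u"
      proof (rule Mor_CM_eqI[of _ ?Q W])
        fix A q assume A: "A \<in> Fin" "q \<in> sec ?Q A"
        then obtain v where v: "v \<in> sec Y A" "q = ?p A v"
          by (auto simp: carrier_quot[OF Y range_sub] quot_proj_def)
        have "u' A q = Cmp CM Y ?Q W u' ?p A v" using A v by (simp add: compose_def)
        also have "\<dots> = g A v" using u' by simp
        also have "\<dots> = u A q" using u(2) A v by simp
        finally show "u' A q = u A q" .
      qed (use u u' in auto)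
    qed
  qed
  ultimately show ?thesis unfolding is_cokernel_iff using Q p by blast
qed

text \<open>\<open>iso_modulo\<close> asks for some kernel and some cokernel in \<open>Tor\<close>,
  not for the concrete ones. The universal property gives a map between an arbitrary one and the
  concrete one, and this map is enough to carry the vanishing at later stages over.\<close>

lemma iso_modulo_Tor_iff:
  "s \<in> iso_modulo CM Tor X Y \<longleftrightarrow> is_iso UC (Psi X) (Psi Y) (Psi_map X Y s)"
proof -
  let ?K = "sub X (kernel X Y s)" and ?i = "sub_incl (kernel X Y s)"
  let ?Q = "quot Y (range_of X s)" and ?p = "quot_proj Y (range_of X s)"
  have K: "?K \<in> Obj CM" by (rule sub_in[OF X kernel_sub])
  have i: "?i \<in> Mor CM ?K X" by (rule sub_incl_in[OF X kernel_sub])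
  have Q: "?Q \<in> Obj CM" by (rule quot_in[OF Y range_sub])
  have p: "?p \<in> Mor CM Y ?Q" by (rule quot_proj_in[OF Y range_sub])
  note cmp = Cmp_in[OF is_category_CM]
  have ker: "(\<exists>K\<in>Tor. \<exists>i. is_kernel CM X Y s K i) \<longleftrightarrow> inj_on (Psi_map X Y s) (germs X)"
  proof
    assume "\<exists>K\<in>Tor. \<exists>i. is_kernel CM X Y s K i"
    then obtain K' j where K': "K' \<in> Tor" "is_kernel CM X Y s K' j" by blast
    have K'O: "K' \<in> Obj CM" and j: "j \<in> Mor CM K' X" using K'(2) by (auto simp: is_kernel_def)
    have "zero_morphism CM ?K Y (Cmp CM ?K X Y s ?i)" using is_kernel_kernel by (simp add: is_kernel_def)
    \<comment> \<open>The concrete kernel factors through the given torsion kernel, so an element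
      killed by \<open>s\<close> comes from a section of \<open>K'\<close>, which dies at a later
      stage.\<close>
    then obtain u where u: "u \<in> Mor CM ?K K'" "Cmp CM ?K K' X j u = ?i"
      using K'(2) K i unfolding is_kernel_def by blast
    show "inj_on (Psi_map X Y s) (germs X)"
      unfolding inj_on_Psi_map_iff[OF X Y s]
    proof (intro ballI impI)
      fix A v assume A: "A \<in> Fin" "v \<in> sec X A" "s A v = \<zero>\<^bsub>fobj Y A\<^esub>"
      then have v: "v \<in> kernel X Y s A" by (simp add: kernel_def)
      have uv: "u A v \<in> sec K' A" using mor_closed[OF u(1) A(1)] v by simp
      have juv: "j A (u A v) = v"
        using fun_cong[OF fun_cong[OF u(2), of A], of v] A v by (simp add: compose_def sub_incl_def)
      obtain B where B: "B \<in> Fin" "A \<subseteq> B" "tr K' A B id (u A v) = \<zero>\<^bsub>fobj K' B\<^esub>"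
        using K'(1) A(1) uv unfolding Tor_iff by blast
      have "tr X A B id v = j B (tr K' A B id (u A v))"
        using mor_natural_id[OF j A(1) B(1,2) uv] juv by simp
      then show "\<exists>B\<in>Fin. A \<subseteq> B \<and> tr X A B id v = \<zero>\<^bsub>fobj X B\<^esub>"
        using B mor_zero[OF K'O X j B(1)] by auto
    qed
  next
    assume "inj_on (Psi_map X Y s) (germs X)"
    then have "\<forall>A\<in>Fin. \<forall>v\<in>sec X A. s A v = \<zero>\<^bsub>fobj Y A\<^esub> \<longrightarrow>
      (\<exists>B\<in>Fin. A \<subseteq> B \<and> tr X A B id v = \<zero>\<^bsub>fobj X B\<^esub>)"
      by (simp add: inj_on_Psi_map_iff[OF X Y s])
    then have "?K \<in> Tor" unfolding Tor_iff using K by (auto simp: kernel_def)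
    then show "\<exists>K\<in>Tor. \<exists>i. is_kernel CM X Y s K i" using is_kernel_kernel by blast
  qed
  have coker: "(\<exists>Q\<in>Tor. \<exists>p. is_cokernel CM X Y s Q p) \<longleftrightarrow> germs Y \<subseteq> Psi_map X Y s ` germs X"
  proof
    assume "\<exists>Q\<in>Tor. \<exists>p. is_cokernel CM X Y s Q p"
    then obtain Q' r where Q': "Q' \<in> Tor" "is_cokernel CM X Y s Q' r" by blast
    have Q'O: "Q' \<in> Obj CM" and r: "r \<in> Mor CM Y Q'" using Q'(2) by (auto simp: is_cokernel_iff)
    have "zero_morphism CM X ?Q (Cmp CM X Y ?Q ?p s)" using is_cokernel_cokernel by (simp add: is_cokernel_iff)
    \<comment> \<open>The concrete projection factors through the given torsion cokernel; at a stage
      where the latter kills \<open>y\<close>, the section lies in the range of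
      \<open>s\<close>.\<close>
    then obtain u where u: "u \<in> Mor CM Q' ?Q" "Cmp CM Y Q' ?Q u r = ?p"
      using Q'(2) Q p unfolding is_cokernel_iff by blast
    show "germs Y \<subseteq> Psi_map X Y s ` germs X"
      unfolding surj_Psi_map_iff[OF X Y s]
    proof (intro ballI)
      fix A y assume A: "A \<in> Fin" "y \<in> sec Y A"
      note ry = mor_closed[OF r A]
      obtain B where B: "B \<in> Fin" "A \<subseteq> B" "tr Q' A B id (r A y) = \<zero>\<^bsub>fobj Q' B\<^esub>"
        using Q'(1) A(1) ry unfolding Tor_iff by blast
      let ?y = "tr Y A B id y"
      note yB = cm_closed_id[OF Y A(1) B(1,2) A(2)]
      have "?p B ?y = u B (r B ?y)"
        using fun_cong[OF fun_cong[OF u(2), of B], of ?y] B(1) yB by (simp add: compose_def)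
      also have "r B ?y = \<zero>\<^bsub>fobj Q' B\<^esub>" using mor_natural_id[OF r A(1) B(1,2) A(2)] B(3) by simp
      also have "u B \<zero>\<^bsub>fobj Q' B\<^esub> = \<zero>\<^bsub>fobj ?Q B\<^esub>" by (rule mor_zero[OF Q'O Q u(1) B(1)])
      finally have "?y \<in> range_of X s B" using cokernel_proj_zero_iff[OF B(1) yB] by blast
      then show "\<exists>B\<in>Fin. A \<subseteq> B \<and> tr Y A B id y \<in> s B ` sec X B"
        using B(1,2) unfolding range_of_def by blast
    qed
  next
    assume "germs Y \<subseteq> Psi_map X Y s ` germs X"
    then have *: "\<forall>A\<in>Fin. \<forall>y\<in>sec Y A. \<exists>B\<in>Fin. A \<subseteq> B \<and> tr Y A B id y \<in> range_of X s B"
      by (simp add: surj_Psi_map_iff[OF X Y s] range_of_def)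
    have "?Q \<in> Tor"
      unfolding Tor_iff
    proof (intro conjI Q ballI)
      fix A q assume A: "A \<in> Fin" and q: "q \<in> sec ?Q A"
      then obtain y where y: "y \<in> sec Y A" "q = ?p A y"
        by (auto simp: carrier_quot[OF Y range_sub] quot_proj_def)
      obtain B where B: "B \<in> Fin" "A \<subseteq> B" "tr Y A B id y \<in> range_of X s B" using * A y by blast
      have "tr ?Q A B id q = ?p B (tr Y A B id y)"
        using mor_natural_id[OF p A B(1,2) y(1)] y(2) by simp
      also have "\<dots> = \<zero>\<^bsub>fobj ?Q B\<^esub>"
        using cokernel_proj_zero_iff[OF B(1) cm_closed_id[OF Y A B(1,2) y(1)]] B(3) by blast
      finally show "\<exists>B\<in>Fin. A \<subseteq> B \<and> tr ?Q A B id q = \<zero>\<^bsub>fobj ?Q B\<^esub>" using B by blast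
    qed
    then show "\<exists>Q\<in>Tor. \<exists>p. is_cokernel CM X Y s Q p" using is_cokernel_cokernel by blast
  qed
  show ?thesis
    using s ker coker is_iso_Psi_map_iff[OF X Y s] by (simp add: iso_modulo_def)
qed

end

section \<open>Fractions of C-modules modulo torsion\<close>

lemma iso_modulo_Tor:
  "X \<in> Obj CM \<Longrightarrow> Y \<in> Obj CM \<Longrightarrow>
    iso_modulo CM Tor X Y = {s \<in> Mor CM X Y. is_iso UC (Psi X) (Psi Y) (Psi_map X Y s)}"
  using iso_modulo_Tor_iff[of X Y] unfolding iso_modulo_def by blast

text \<open>\<open>T\<close> is the equalizer of \<open>f\<close> and \<open>g\<close> inside
  \<open>X\<close>. Its inclusion is injective on sections, and equality under \<open>Psi\<close>
  says that every section of \<open>X\<close> enters it at a later stage, so the cokernel of the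
  inclusion is torsion.\<close>

lemma Psi_equalizer:
  assumes X: "X \<in> Obj CM" and Y: "Y \<in> Obj CM" and f: "f \<in> Mor CM X Y" and g: "g \<in> Mor CM X Y"
    and eq: "Psi_map X Y f = Psi_map X Y g"
  shows "\<exists>T\<in>Obj CM. \<exists>t\<in>iso_modulo CM Tor T X. Cmp CM T X Y f t = Cmp CM T X Y g t"
proof -
  define S where "S A = {v \<in> sec X A. f A v = g A v}" for A
  have S: "submodule (S A) k (fobj X A)" if "A \<in> Fin" for A
    using that by (intro cm_submoduleI[OF X])
      (auto simp: S_def cm_ops[OF X] mor_zero[OF X Y f] mor_zero[OF X Y g]
        linear_maps_add[OF mor_linear[OF f]] linear_maps_add[OF mor_linear[OF g]]
        linear_maps_smult[OF mor_linear[OF f]] linear_maps_smult[OF mor_linear[OF g]])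
  have S_map: "tr X A B h v \<in> S B" if "A \<in> Fin" "B \<in> Fin" "h \<in> E" "h ` A \<subseteq> B" "v \<in> S A" for A B h v
    using that by (auto simp: S_def cm_closed[OF X] mor_natural[OF f] mor_natural[OF g])
  have T: "sub X S \<in> Obj CM" by (rule sub_in[OF X S S_map])
  have t: "sub_incl S \<in> Mor CM (sub X S) X" by (rule sub_incl_in[OF X S S_map])
  have "inj_on (Psi_map (sub X S) X (sub_incl S)) (germs (sub X S))"
    unfolding inj_on_Psi_map_iff[OF T X t] by (auto simp: sub_incl_def S_def intro!: bexI cm_id[OF X])
  moreover have "germs X \<subseteq> Psi_map (sub X S) X (sub_incl S) ` germs (sub X S)"
    unfolding surj_Psi_map_iff[OF T X t]
  proof (intro ballI)
    fix A v assume A: "A \<in> Fin" "v \<in> sec X A"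
    have "germ Y A (f A v) = germ Y A (g A v)"
      using fun_cong[OF eq, of "germ X A v"] A by (simp add: Psi_map_germ[OF X Y f] Psi_map_germ[OF X Y g])
    then obtain D where D: "D \<in> Fin" "A \<subseteq> D" "tr Y A D id (f A v) = tr Y A D id (g A v)"
      using germ_eq_iff[OF Y A(1) mor_closed[OF f A] A(1) mor_closed[OF g A]] by blast
    then have "tr X A D id v \<in> S D"
      using A by (simp add: S_def cm_closed_id[OF X] mor_natural_id[OF f] mor_natural_id[OF g])
    then show "\<exists>B\<in>Fin. A \<subseteq> B \<and> tr X A B id v \<in> sub_incl S B ` sec (sub X S) B"
      using D by (intro bexI[of _ D]) (auto simp: sub_incl_def intro!: image_eqI[of _ _ "tr X A D id v"])
  qed
  ultimately have "sub_incl S \<in> iso_modulo CM Tor (sub X S) X"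
    using t T X by (simp add: iso_modulo_Tor is_iso_Psi_map_iff)
  moreover have "Cmp CM (sub X S) X Y f (sub_incl S) = Cmp CM (sub X S) X Y g (sub_incl S)"
    by (auto simp: compose_def sub_incl_def fun_eq_iff restrict_def) (auto simp: S_def)
  ultimately show ?thesis using T by blast
qed

text \<open>Monomials at \<open>id\<close> recover compatibility with scalars, and monomials with
  coefficient \<open>1\<close> recover compatibility with the action of \<open>E\<close>.\<close>

lemma Mor_PsiD:
  assumes X: "X \<in> Obj CM" and Y: "Y \<in> Obj CM" and \<phi>: "\<phi> \<in> Mor UC (Psi X) (Psi Y)"
  shows Mor_Psi_closed: "x \<in> germs X \<Longrightarrow> \<phi> x \<in> germs Y"
    and Mor_Psi_add: "x \<in> germs X \<Longrightarrow> y \<in> germs X \<Longrightarrow> \<phi> (x \<oplus>\<^bsub>colimit X\<^esub> y) = \<phi> x \<oplus>\<^bsub>colimit Y\<^esub> \<phi> y"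
    and Mor_Psi_smult: "c \<in> carrier k \<Longrightarrow> x \<in> germs X \<Longrightarrow> \<phi> (c \<odot>\<^bsub>colimit X\<^esub> x) = c \<odot>\<^bsub>colimit Y\<^esub> \<phi> x"
    and Mor_Psi_act: "h \<in> E \<Longrightarrow> x \<in> germs X \<Longrightarrow> \<phi> (act X h x) = act Y h (\<phi> x)"
    and Mor_Psi_zero: "\<phi> \<zero>\<^bsub>colimit X\<^esub> = \<zero>\<^bsub>colimit Y\<^esub>"
proof -
  have lin: "\<phi> \<in> linear_maps kE.RG (Psi X) (Psi Y)" using \<phi> by (simp add: Mor_UC)
  have closed: "\<phi> x \<in> germs Y" if "x \<in> germs X" for x using linear_maps_closed[OF lin] that by simp
  have add: "\<phi> (x \<oplus>\<^bsub>colimit X\<^esub> y) = \<phi> x \<oplus>\<^bsub>colimit Y\<^esub> \<phi> y" if "x \<in> germs X" "y \<in> germs X" for x y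
    using linear_maps_add[OF lin, of x y] that by (simp add: Psi_add[OF X] Psi_add[OF Y])
  have smult: "\<phi> (c \<odot>\<^bsub>colimit X\<^esub> x) = c \<odot>\<^bsub>colimit Y\<^esub> \<phi> x" if "c \<in> carrier k" "x \<in> germs X" for c x
    using linear_maps_smult[OF lin, of "kE.e c id" x] that
    by (simp add: Psi_basis[OF X] Psi_basis[OF Y] id_E closed act_id[OF X] act_id[OF Y])
  have act: "\<phi> (act X h x) = act Y h (\<phi> x)" if "h \<in> E" "x \<in> germs X" for h x
    using linear_maps_smult[OF lin, of "kE.e \<one>\<^bsub>k\<^esub> h" x] that module.smult_one[OF module_colimit[OF X]] module.smult_one[OF module_colimit[OF Y]]
    by (simp add: Psi_basis[OF X] Psi_basis[OF Y] closed act_closed[OF X] act_closed[OF Y])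
  have zero: "\<phi> \<zero>\<^bsub>colimit X\<^esub> = \<zero>\<^bsub>colimit Y\<^esub>"
    using linear_maps_zero[OF left_moduleD(2)[OF left_module_Psi[OF X]] left_moduleD(2)[OF left_module_Psi[OF Y]] lin]
    by (simp add: Psi_def)
  show "x \<in> germs X \<Longrightarrow> \<phi> x \<in> germs Y"
    "x \<in> germs X \<Longrightarrow> y \<in> germs X \<Longrightarrow> \<phi> (x \<oplus>\<^bsub>colimit X\<^esub> y) = \<phi> x \<oplus>\<^bsub>colimit Y\<^esub> \<phi> y"
    "c \<in> carrier k \<Longrightarrow> x \<in> germs X \<Longrightarrow> \<phi> (c \<odot>\<^bsub>colimit X\<^esub> x) = c \<odot>\<^bsub>colimit Y\<^esub> \<phi> x"
    "h \<in> E \<Longrightarrow> x \<in> germs X \<Longrightarrow> \<phi> (act X h x) = act Y h (\<phi> x)"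
    "\<phi> \<zero>\<^bsub>colimit X\<^esub> = \<zero>\<^bsub>colimit Y\<^esub>"
    by (fact closed, fact add, fact smult, fact act, fact zero)
qed

text \<open>Writing \<open>[x]\<close> for classes, the apex consists of the pairs
  \<open>(x, y)\<close> with \<open>\<phi> [x] = [y]\<close>. The kernel of the left projection
  consists of pairs \<open>(0, y)\<close> with \<open>[y] = 0\<close>, so it is torsion. Every
  \<open>\<phi> [x]\<close> is represented by some \<open>y\<close> at a later stage, so the left
  projection is surjective up to torsion. The equation required of the roof is the condition that
  defines the apex.\<close>

lemma Psi_fraction:
  assumes X: "X \<in> Obj CM" and Y: "Y \<in> Obj CM" and \<phi>: "\<phi> \<in> Mor UC (Psi X) (Psi Y)"
  shows "\<exists>U\<in>Obj CM. \<exists>s\<in>iso_modulo CM Tor U X. \<exists>f\<in>Mor CM U Y.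
    Cmp UC (Psi U) (Psi X) (Psi Y) \<phi> (Psi_map U X s) = Psi_map U Y f"
proof -
  let ?P = "pair_cmod X Y"
  note P = pair_cmod_in[OF X Y]
  note closed = Mor_Psi_closed[OF X Y \<phi>] and add = Mor_Psi_add[OF X Y \<phi>] and smult = Mor_Psi_smult[OF X Y \<phi>]
    and act = Mor_Psi_act[OF X Y \<phi>] and zero = Mor_Psi_zero[OF X Y \<phi>]
  define S where "S A = {p \<in> sec ?P A. \<phi> (germ X A (pair1 p)) = germ Y A (pair2 p)}" for A
  have S: "submodule (S A) k (fobj ?P A)" if A: "A \<in> Fin" for A
  proof (rule cm_submoduleI[OF P A])
    show "\<zero>\<^bsub>fobj ?P A\<^esub> \<in> S A"
      using zero A by (auto simp: S_def cm_ops[OF X] cm_ops[OF Y] colimit_zero[OF X A] colimit_zero[OF Y A])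
    show "p \<oplus>\<^bsub>fobj ?P A\<^esub> q \<in> S A" if "p \<in> S A" "q \<in> S A" for p q
      using that A by (auto simp: S_def cm_ops[OF X] cm_ops[OF Y] colimit_add[OF X A, symmetric] colimit_add[OF Y A, symmetric] add germ_in)
    show "c \<odot>\<^bsub>fobj ?P A\<^esub> p \<in> S A" if "c \<in> carrier k" "p \<in> S A" for c p
      using that A by (auto simp: S_def cm_ops[OF X] cm_ops[OF Y] colimit_smult[OF X, symmetric] colimit_smult[OF Y, symmetric] smult germ_in)
  qed (auto simp: S_def)
  have S_map: "tr ?P A B h p \<in> S B" if *: "A \<in> Fin" "B \<in> Fin" "h \<in> E" "h ` A \<subseteq> B" "p \<in> S A" for A B h p
  proof -
    obtain x y where p: "p = pair (x, y)" "x \<in> sec X A" "y \<in> sec Y A" "\<phi> (germ X A x) = germ Y A y"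
      using *(5) by (auto simp: S_def)
    have "\<phi> (germ X B (tr X A B h x)) = germ Y B (tr Y A B h y)"
      using act[OF *(3) germ_in[OF *(1) p(2)]] p(4)
      by (simp add: act_germ[OF X *(1) p(2) *(3,2,4)] act_germ[OF Y *(1) p(3) *(3,2,4)])
    then show ?thesis using p *(1-4) by (simp add: S_def cm_closed[OF X] cm_closed[OF Y])
  qed
  let ?U = "sub ?P S"
  have U: "?U \<in> Obj CM" by (rule sub_in[OF P S S_map])
  define s where "s = (\<lambda>A\<in>Fin. \<lambda>p\<in>S A. (\<lambda>A\<in>Fin. \<lambda>x\<in>sec ?P A. pair1 x) A p)"
  define f where "f = (\<lambda>A\<in>Fin. \<lambda>p\<in>S A. (\<lambda>A\<in>Fin. \<lambda>x\<in>sec ?P A. pair2 x) A p)"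
  have s: "s \<in> Mor CM ?U X" unfolding s_def by (rule Mor_from_sub[OF P S S_map pair_proj_in(1)[OF X Y]])
  have f: "f \<in> Mor CM ?U Y" unfolding f_def by (rule Mor_from_sub[OF P S S_map pair_proj_in(2)[OF X Y]])
  have s_eq: "s A p = pair1 p" and f_eq: "f A p = pair2 p" if "A \<in> Fin" "p \<in> S A" for A p
    using that by (auto simp: s_def f_def S_def)
  have inj: "inj_on (Psi_map ?U X s) (germs ?U)"
    unfolding inj_on_Psi_map_iff[OF U X s]
  proof (intro ballI impI)
    fix A p assume A: "A \<in> Fin" and p: "p \<in> sec ?U A" and "s A p = \<zero>\<^bsub>fobj X A\<^esub>"
    then obtain y where y: "p = pair (\<zero>\<^bsub>fobj X A\<^esub>, y)" "y \<in> sec Y A" "\<phi> (germ X A \<zero>\<^bsub>fobj X A\<^esub>) = germ Y A y"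
      by (auto simp: s_eq S_def)
    then have "germ Y A y = germ Y A \<zero>\<^bsub>fobj Y A\<^esub>"
      using zero by (simp add: colimit_zero[OF X A] colimit_zero[OF Y A])
    then obtain B where B: "B \<in> Fin" "A \<subseteq> B" "tr Y A B id y = tr Y A B id \<zero>\<^bsub>fobj Y A\<^esub>"
      using germ_eq_iff[OF Y A y(2) A cm_zero_closed[OF Y A]] by blast
    then show "\<exists>B\<in>Fin. A \<subseteq> B \<and> tr ?U A B id p = \<zero>\<^bsub>fobj ?U B\<^esub>"
      using p y A cm_map_zero[OF X A B(1) id_E] cm_map_zero[OF Y A B(1) id_E] cm_zero_closed[OF X A]
      by (intro bexI[of _ B]) auto
  qed
  have surj: "germs X \<subseteq> Psi_map ?U X s ` germs ?U"
    unfolding surj_Psi_map_iff[OF U X s]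
  proof (intro ballI)
    fix A x assume A: "A \<in> Fin" "x \<in> sec X A"
    \<comment> \<open>The representative of the image of the class of \<open>x\<close> lives at a
      stage \<open>B\<close> unrelated to \<open>A\<close>; the pair is formed at the union.\<close>
    obtain B y where B: "B \<in> Fin" "y \<in> sec Y B" "\<phi> (germ X A x) = germ Y B y"
      using closed[OF germ_in[OF A]] by (rule germsE)
    let ?D = "A \<union> B"
    have D: "?D \<in> Fin" "A \<subseteq> ?D" "B \<subseteq> ?D" using Fin_Un[OF A(1) B(1)] by auto
    let ?x = "tr X A ?D id x" and ?y = "tr Y B ?D id y"
    have "pair (?x, ?y) \<in> S ?D"
      using A B D by (simp add: S_def cm_closed_id[OF X] cm_closed_id[OF Y] germ_incl[OF X] germ_incl[OF Y])
    then show "\<exists>B\<in>Fin. A \<subseteq> B \<and> tr X A B id x \<in> s B ` sec ?U B"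
      using D by (intro bexI[of _ ?D] conjI image_eqI[of _ _ "pair (?x, ?y)"]) (auto simp: s_eq)
  qed
  have "Cmp UC (Psi ?U) (Psi X) (Psi Y) \<phi> (Psi_map ?U X s) = Psi_map ?U Y f"
  proof (rule germs_extensionalityI[of _ ?U])
    fix A p assume A: "A \<in> Fin" "p \<in> sec ?U A"
    then show "Cmp UC (Psi ?U) (Psi X) (Psi Y) \<phi> (Psi_map ?U X s) (germ ?U A p) = Psi_map ?U Y f (germ ?U A p)"
      using Psi_map_germ[OF U X s A] Psi_map_germ[OF U Y f A] germ_in[OF A]
      by (simp add: Cmp_UC compose_def s_eq f_eq) (simp add: S_def)
  qed (auto simp: Cmp_UC Psi_map_def)
  moreover have "s \<in> iso_modulo CM Tor ?U X"
    using iso_modulo_Tor_iff[OF U X s] is_iso_Psi_map_iff[OF U X s] inj surj by blast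
  ultimately show ?thesis using U f by blast
qed

text \<open>For this choice of the inverted morphisms, the localization studied above is the Serre
  quotient by the torsion modules.\<close>

lemma right_fractions_Psi: "right_fractions CM UC Psi_functor (iso_modulo CM Tor)"
proof (rule right_fractions.intro[OF is_category_CM is_category_UC is_functor_Psi], unfold Psi_functor_simps)
  fix X Y assume X: "X \<in> Obj CM" and Y: "Y \<in> Obj CM"
  show "iso_modulo CM Tor X Y = {s \<in> Mor CM X Y. is_iso UC (Psi X) (Psi Y) (Psi_map X Y s)}"
    by (rule iso_modulo_Tor[OF X Y])
  show "\<exists>U\<in>Obj CM. \<exists>s\<in>iso_modulo CM Tor U X. \<exists>f\<in>Mor CM U Y.
      Cmp UC (Psi U) (Psi X) (Psi Y) \<phi> (Psi_map U X s) = Psi_map U Y f"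
    if "\<phi> \<in> Mor UC (Psi X) (Psi Y)" for \<phi>
    by (rule Psi_fraction[OF X Y that])
  show "\<exists>T\<in>Obj CM. \<exists>t\<in>iso_modulo CM Tor T X. Cmp CM T X Y f t = Cmp CM T X Y g t"
    if "f \<in> Mor CM X Y" "g \<in> Mor CM X Y" "Psi_map X Y f = Psi_map X Y g" for f g
    by (rule Psi_equalizer[OF X Y that])
qed

subsection \<open>The uniformly continuous module as a colimit\<close>

definition fixed :: "(('w \<Rightarrow> 'w) \<Rightarrow> 'k, 'u) module \<Rightarrow> 'w set \<Rightarrow> 'u set" where
  "fixed M A = {v \<in> carrier M. \<forall>h\<in>E. \<forall>h'\<in>E. restrict h A = restrict h' A \<longrightarrow>
     basis_element k h \<odot>\<^bsub>M\<^esub> v = basis_element k h' \<odot>\<^bsub>M\<^esub> v}"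

text \<open>A morphism is given only as a function on \<open>A\<close>. All its extensions in
  \<open>E\<close> act alike on \<open>fixed M A\<close>, so \<open>SOME\<close> may pick any of
  them, as \<open>Phi_map\<close> confirms.\<close>

definition Phi :: "(('w \<Rightarrow> 'w) \<Rightarrow> 'k, 'u) module \<Rightarrow> ('w, 'k, 'u) cmod" where
  "Phi M = \<lparr>fobj = (\<lambda>A. (kE.scalar_restriction M)\<lparr>carrier := fixed M A\<rparr>),
     fmap = (\<lambda>A B f. \<lambda>v\<in>fixed M A. basis_element k (SOME h. h \<in> E \<and> restrict h A = f) \<odot>\<^bsub>M\<^esub> v)\<rparr>"

lemma Phi_simps [simp]: "sec (Phi M) A = fixed M A" "\<zero>\<^bsub>fobj (Phi M) A\<^esub> = \<zero>\<^bsub>M\<^esub>"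
  "x \<oplus>\<^bsub>fobj (Phi M) A\<^esub> y = x \<oplus>\<^bsub>M\<^esub> y" "c \<odot>\<^bsub>fobj (Phi M) A\<^esub> x = kE.e c id \<odot>\<^bsub>M\<^esub> x"
  by (simp_all add: Phi_def kE.scalar_restriction_def)

context
  fixes M assumes M: "M \<in> Obj UC"
begin

lemma UC_left_module: "left_module kE.RG M"
  using M by (simp add: Obj_UC)

lemma M_ops:
  shows lact_closed: "h \<in> E \<Longrightarrow> v \<in> carrier M \<Longrightarrow> basis_element k h \<odot>\<^bsub>M\<^esub> v \<in> carrier M"
    and lact_comp: "g \<in> E \<Longrightarrow> h \<in> E \<Longrightarrow> v \<in> carrier M \<Longrightarrow>
      basis_element k g \<odot>\<^bsub>M\<^esub> (basis_element k h \<odot>\<^bsub>M\<^esub> v) = basis_element k (g \<circ> h) \<odot>\<^bsub>M\<^esub> v"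
    and lact_id: "v \<in> carrier M \<Longrightarrow> basis_element k id \<odot>\<^bsub>M\<^esub> v = v"
    and lact_add: "h \<in> E \<Longrightarrow> v \<in> carrier M \<Longrightarrow> w \<in> carrier M \<Longrightarrow>
      basis_element k h \<odot>\<^bsub>M\<^esub> (v \<oplus>\<^bsub>M\<^esub> w) = basis_element k h \<odot>\<^bsub>M\<^esub> v \<oplus>\<^bsub>M\<^esub> basis_element k h \<odot>\<^bsub>M\<^esub> w"
    and lact_smult: "h \<in> E \<Longrightarrow> c \<in> carrier k \<Longrightarrow> v \<in> carrier M \<Longrightarrow>
      basis_element k h \<odot>\<^bsub>M\<^esub> (kE.e c id \<odot>\<^bsub>M\<^esub> v) = kE.e c id \<odot>\<^bsub>M\<^esub> (basis_element k h \<odot>\<^bsub>M\<^esub> v)"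
    and scalar_closed: "c \<in> carrier k \<Longrightarrow> v \<in> carrier M \<Longrightarrow> kE.e c id \<odot>\<^bsub>M\<^esub> v \<in> carrier M"
    and M_add_closed: "v \<in> carrier M \<Longrightarrow> w \<in> carrier M \<Longrightarrow> v \<oplus>\<^bsub>M\<^esub> w \<in> carrier M"
proof -
  note M' = left_moduleD[OF UC_left_module]
  have b: "kE.e c h \<in> carrier kE.RG" if "c \<in> carrier k" "h \<in> E" for c h
    using kE.basis_in[of c h] that by simp
  show "h \<in> E \<Longrightarrow> v \<in> carrier M \<Longrightarrow> basis_element k h \<odot>\<^bsub>M\<^esub> v \<in> carrier M"
    by (simp add: kE.basis_element_eq M'(3) b)
  show "g \<in> E \<Longrightarrow> h \<in> E \<Longrightarrow> v \<in> carrier M \<Longrightarrow>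
      basis_element k g \<odot>\<^bsub>M\<^esub> (basis_element k h \<odot>\<^bsub>M\<^esub> v) = basis_element k (g \<circ> h) \<odot>\<^bsub>M\<^esub> v"
    by (simp add: kE.basis_element_eq M'(6)[symmetric] b kE.basis_mult)
  show "v \<in> carrier M \<Longrightarrow> basis_element k id \<odot>\<^bsub>M\<^esub> v = v"
    using M'(7) by (simp add: kE.basis_element_eq kE.RG_simps(2))
  show "h \<in> E \<Longrightarrow> v \<in> carrier M \<Longrightarrow> w \<in> carrier M \<Longrightarrow>
      basis_element k h \<odot>\<^bsub>M\<^esub> (v \<oplus>\<^bsub>M\<^esub> w) = basis_element k h \<odot>\<^bsub>M\<^esub> v \<oplus>\<^bsub>M\<^esub> basis_element k h \<odot>\<^bsub>M\<^esub> w"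
    by (simp add: kE.basis_element_eq M'(5) b)
  show "h \<in> E \<Longrightarrow> c \<in> carrier k \<Longrightarrow> v \<in> carrier M \<Longrightarrow>
      basis_element k h \<odot>\<^bsub>M\<^esub> (kE.e c id \<odot>\<^bsub>M\<^esub> v) = kE.e c id \<odot>\<^bsub>M\<^esub> (basis_element k h \<odot>\<^bsub>M\<^esub> v)"
    using kE.basis_smult_commute(1)[OF UC_left_module, of c h v] by (simp add: kE.basis_element_eq)
  show "c \<in> carrier k \<Longrightarrow> v \<in> carrier M \<Longrightarrow> kE.e c id \<odot>\<^bsub>M\<^esub> v \<in> carrier M"
    by (simp add: M'(3) b id_E)
  show "v \<in> carrier M \<Longrightarrow> w \<in> carrier M \<Longrightarrow> v \<oplus>\<^bsub>M\<^esub> w \<in> carrier M"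
    using M'(2) by (simp add: abelian_monoid.a_closed abelian_group.axioms(1))
qed

lemma fixedD:
  assumes "v \<in> fixed M A"
  shows fixed_carrier: "v \<in> carrier M"
    and fixed_cong: "h \<in> E \<Longrightarrow> h' \<in> E \<Longrightarrow> restrict h A = restrict h' A \<Longrightarrow>
      basis_element k h \<odot>\<^bsub>M\<^esub> v = basis_element k h' \<odot>\<^bsub>M\<^esub> v"
  using assms unfolding fixed_def by blast+

lemma fixedI:
  assumes "v \<in> carrier M"
    and "\<And>h h'. h \<in> E \<Longrightarrow> h' \<in> E \<Longrightarrow> restrict h A = restrict h' A \<Longrightarrow>
      basis_element k h \<odot>\<^bsub>M\<^esub> v = basis_element k h' \<odot>\<^bsub>M\<^esub> v"
  shows "v \<in> fixed M A"
  using assms unfolding fixed_def by blast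

lemma fixed_mono: "A \<subseteq> B \<Longrightarrow> v \<in> fixed M A \<Longrightarrow> v \<in> fixed M B"
proof -
  assume AB: "A \<subseteq> B" and v: "v \<in> fixed M A"
  have "restrict h A = restrict h' A" if "restrict h B = restrict h' B" for h h' :: "'w \<Rightarrow> 'w"
    using that AB by (metis inf.absorb_iff2 restrict_restrict)
  then show ?thesis using v fixed_cong[OF v] unfolding fixed_def by blast
qed

text \<open>Uniform continuity enters here: the finite set that it provides is enlarged to a member
  of \<open>Fin\<close>.\<close>

lemma fixed_exists:
  assumes "v \<in> carrier M"
  obtains A where "A \<in> Fin" "v \<in> fixed M A"
proof -
  obtain A where A: "finite A" "\<forall>h\<in>E. \<forall>h'\<in>E. restrict h A = restrict h' A \<longrightarrow>
      basis_element k h \<odot>\<^bsub>M\<^esub> v = basis_element k h' \<odot>\<^bsub>M\<^esub> v"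
    using M assms unfolding Obj_UC uniformly_continuous_def by blast
  then have "v \<in> fixed M A" using assms unfolding fixed_def by blast
  moreover obtain B where "B \<in> Fin" "A \<subseteq> B" using Fin_cover[OF A(1)] .
  ultimately show thesis using that fixed_mono by blast
qed

text \<open>If \<open>g\<close> and \<open>g'\<close> agree on \<open>B\<close>, which contains the
  image of \<open>A\<close> under \<open>h\<close>, then their composites with \<open>h\<close>
  agree on \<open>A\<close>.\<close>

lemma fixed_map:
  assumes h: "h \<in> E" "h ` A \<subseteq> B" and v: "v \<in> fixed M A"
  shows "basis_element k h \<odot>\<^bsub>M\<^esub> v \<in> fixed M B"
  unfolding fixed_def
proof (intro CollectI conjI ballI impI)
  show "basis_element k h \<odot>\<^bsub>M\<^esub> v \<in> carrier M" using fixed_carrier[OF v] h by (simp add: lact_closed)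
  fix g g' assume g: "g \<in> E" "g' \<in> E" "restrict g B = restrict g' B"
  have gB: "g y = g' y" if "y \<in> B" for y using g(3) that by (metis restrict_apply')
  have "restrict (g \<circ> h) A = restrict (g' \<circ> h) A"
    by (rule restrict_ext) (use gB h(2) in auto)
  then show "basis_element k g \<odot>\<^bsub>M\<^esub> (basis_element k h \<odot>\<^bsub>M\<^esub> v) = basis_element k g' \<odot>\<^bsub>M\<^esub> (basis_element k h \<odot>\<^bsub>M\<^esub> v)"
    using fixed_cong[OF v comp_E[OF g(1) h(1)] comp_E[OF g(2) h(1)]] g h fixed_carrier[OF v] by (simp add: lact_comp)
qed

lemma Phi_map:
  assumes "h \<in> E" "v \<in> fixed M A"
  shows "tr (Phi M) A B h v = basis_element k h \<odot>\<^bsub>M\<^esub> v"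
proof -
  have "(SOME h'. h' \<in> E \<and> restrict h' A = restrict h A) \<in> E \<and>
      restrict (SOME h'. h' \<in> E \<and> restrict h' A = restrict h A) A = restrict h A"
    by (rule someI[of _ h]) (simp add: assms)
  then show ?thesis using fixed_cong[OF assms(2) _ assms(1)] assms(2) by (simp add: Phi_def)
qed

text \<open>Elements of \<open>E\<close> act additively and commute with the scalars, so the
  defining equations of \<open>fixed M A\<close> survive sums and scalar multiples.\<close>

lemma submodule_fixed: "submodule (fixed M A) k (kE.scalar_restriction M)"
proof (rule submodule_if_closed[OF kE.module_scalar_restriction[OF UC_left_module]])
  interpret M: abelian_group M by (rule left_moduleD(2)[OF UC_left_module])
  show "fixed M A \<subseteq> carrier (kE.scalar_restriction M)" by (auto simp: fixed_def)
  have z: "basis_element k h \<odot>\<^bsub>M\<^esub> \<zero>\<^bsub>M\<^esub> = \<zero>\<^bsub>M\<^esub>" if "h \<in> E" for h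
    using lact_add[OF that, of "\<zero>\<^bsub>M\<^esub>" "\<zero>\<^bsub>M\<^esub>"] lact_closed[OF that, of "\<zero>\<^bsub>M\<^esub>"]
    by (metis M.l_zero M.zero_closed M.add.r_cancel_one')
  show "\<zero>\<^bsub>kE.scalar_restriction M\<^esub> \<in> fixed M A"
    by (rule fixedI) (simp_all add: z)
  show "x \<oplus>\<^bsub>kE.scalar_restriction M\<^esub> y \<in> fixed M A" if xy: "x \<in> fixed M A" "y \<in> fixed M A" for x y
    unfolding kE.scalar_restriction_simps
  proof (rule fixedI)
    note c = fixed_carrier[OF xy(1)] fixed_carrier[OF xy(2)]
    show "x \<oplus>\<^bsub>M\<^esub> y \<in> carrier M" by (rule M_add_closed[OF c])
    fix h h' assume h: "h \<in> E" "h' \<in> E" "restrict h A = restrict h' A"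
    show "basis_element k h \<odot>\<^bsub>M\<^esub> (x \<oplus>\<^bsub>M\<^esub> y) = basis_element k h' \<odot>\<^bsub>M\<^esub> (x \<oplus>\<^bsub>M\<^esub> y)"
      by (simp only: lact_add[OF h(1) c] lact_add[OF h(2) c] fixed_cong[OF xy(1) h] fixed_cong[OF xy(2) h])
  qed
  show "c \<odot>\<^bsub>kE.scalar_restriction M\<^esub> x \<in> fixed M A" if c: "c \<in> carrier k" and x: "x \<in> fixed M A" for c x
    unfolding kE.scalar_restriction_simps EM_simps
  proof (rule fixedI)
    note xM = fixed_carrier[OF x]
    show "kE.e c id \<odot>\<^bsub>M\<^esub> x \<in> carrier M" by (rule scalar_closed[OF c xM])
    fix h h' assume h: "h \<in> E" "h' \<in> E" "restrict h A = restrict h' A"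
    show "basis_element k h \<odot>\<^bsub>M\<^esub> (kE.e c id \<odot>\<^bsub>M\<^esub> x) = basis_element k h' \<odot>\<^bsub>M\<^esub> (kE.e c id \<odot>\<^bsub>M\<^esub> x)"
      by (simp only: lact_smult[OF h(1) c xM] lact_smult[OF h(2) c xM] fixed_cong[OF x h])
  qed
qed

lemma Phi_in: "Phi M \<in> Obj CM"
proof (rule C_moduleI)
  fix A assume A: "A \<in> Fin"
  show "module k (fobj (Phi M) A)"
    using submodule.submodule_is_module[OF submodule_fixed kE.module_scalar_restriction[OF UC_left_module]] by (simp add: Phi_def)
  show "tr (Phi M) A A id v = v" if "v \<in> sec (Phi M) A" for v
    using that by (simp add: Phi_map id_E lact_id fixed_carrier)
next
  fix A B h assume *: "A \<in> Fin" "B \<in> Fin" "h \<in> E" "h ` A \<subseteq> B"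
  note sr = kE.module_scalar_restriction[OF UC_left_module]
  show "tr (Phi M) A B h \<in> linear_maps k (fobj (Phi M) A) (fobj (Phi M) B)"
  proof (rule linear_mapsI)
    show "tr (Phi M) A B h \<in> extensional (sec (Phi M) A)" by (simp add: Phi_def)
    show "tr (Phi M) A B h x \<in> sec (Phi M) B" if "x \<in> sec (Phi M) A" for x
      using that * fixed_map by (simp add: Phi_map)
    have cl: "x \<oplus>\<^bsub>M\<^esub> y \<in> fixed M A" "c \<in> carrier k \<Longrightarrow> kE.e c id \<odot>\<^bsub>M\<^esub> x \<in> fixed M A"
      if "x \<in> fixed M A" "y \<in> fixed M A" for x y c
      using module.submoduleE(4,5)[OF sr submodule_fixed] that by simp_all
    show "tr (Phi M) A B h (x \<oplus>\<^bsub>fobj (Phi M) A\<^esub> y) =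
        tr (Phi M) A B h x \<oplus>\<^bsub>fobj (Phi M) B\<^esub> tr (Phi M) A B h y"
      if "x \<in> sec (Phi M) A" "y \<in> sec (Phi M) A" for x y
      using that * by (simp add: Phi_map cl lact_add fixed_carrier)
    show "tr (Phi M) A B h (c \<odot>\<^bsub>fobj (Phi M) A\<^esub> x) = c \<odot>\<^bsub>fobj (Phi M) B\<^esub> tr (Phi M) A B h x"
      if "c \<in> carrier k" "x \<in> sec (Phi M) A" for c x
      using that * by (simp add: Phi_map cl lact_smult fixed_carrier)
  qed
next
  fix A B D h h' v assume "A \<in> Fin" "B \<in> Fin" "D \<in> Fin" "h \<in> E" "h ` A \<subseteq> B" "h' \<in> E" "h' ` B \<subseteq> D"
    "v \<in> sec (Phi M) A"
  then show "tr (Phi M) B D h' (tr (Phi M) A B h v) = tr (Phi M) A D (h' \<circ> h) v"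
    by (simp add: Phi_map fixed_map comp_E lact_comp fixed_carrier)
qed

text \<open>The identity acts trivially on \<open>M\<close>, so the maps of \<open>Phi M\<close>
  along inclusions do not move elements, and passing to a later stage identifies nothing.\<close>

lemma germ_Phi_eq_iff:
  assumes "A \<in> Fin" "B \<in> Fin" "v \<in> fixed M A" "w \<in> fixed M B"
  shows "germ (Phi M) A v = germ (Phi M) B w \<longleftrightarrow> v = w"
proof -
  have "germ (Phi M) A v = germ (Phi M) B w \<longleftrightarrow> (\<exists>D\<in>Fin. A \<subseteq> D \<and> B \<subseteq> D \<and> v = w)"
    using assms by (simp add: germ_eq_iff[OF Phi_in] Phi_map id_E lact_id fixed_carrier)
  then show ?thesis using Fin_Un[OF assms(1,2)] by blast
qed

definition to_colimit :: "'u \<Rightarrow> 'u" where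
  "to_colimit = (\<lambda>v\<in>carrier M. germ (Phi M) (SOME A. A \<in> Fin \<and> v \<in> fixed M A) v)"

lemma to_colimit_eq:
  assumes "A \<in> Fin" "v \<in> fixed M A"
  shows "to_colimit v = germ (Phi M) A v"
proof -
  have "(SOME A. A \<in> Fin \<and> v \<in> fixed M A) \<in> Fin \<and> v \<in> fixed M (SOME A. A \<in> Fin \<and> v \<in> fixed M A)"
    by (rule someI[of _ A]) (simp add: assms)
  then show ?thesis using assms fixed_carrier[OF assms(2)] by (simp add: to_colimit_def germ_Phi_eq_iff)
qed

lemma to_colimit_closed: "v \<in> carrier M \<Longrightarrow> to_colimit v \<in> germs (Phi M)"
  by (erule fixed_exists) (simp add: to_colimit_eq germ_in)

lemma is_iso_to_colimit: "is_iso UC M (Psi (Phi M)) to_colimit"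
proof -
  have "to_colimit \<in> Mor UC M (Psi (Phi M))"
    unfolding Mor_UC
  proof (rule kE.linear_maps_monoid_algebraI[OF UC_left_module left_module_Psi[OF Phi_in]])
    show "to_colimit \<in> extensional (carrier M)" by (simp add: to_colimit_def)
    fix v assume v: "v \<in> carrier M"
    then show "to_colimit v \<in> carrier (Psi (Phi M))" by (simp add: to_colimit_closed)
    show "to_colimit (v \<oplus>\<^bsub>M\<^esub> w) = to_colimit v \<oplus>\<^bsub>Psi (Phi M)\<^esub> to_colimit w" if w: "w \<in> carrier M" for w
    proof -
      obtain A where A: "A \<in> Fin" "v \<in> fixed M A" using fixed_exists[OF v] .
      obtain B where B: "B \<in> Fin" "w \<in> fixed M B" using fixed_exists[OF w] .
      have AB: "A \<union> B \<in> Fin" "v \<in> fixed M (A \<union> B)" "w \<in> fixed M (A \<union> B)"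
        using A B Fin_Un fixed_mono[of _ "A \<union> B"] by auto
      then have "v \<oplus>\<^bsub>M\<^esub> w \<in> fixed M (A \<union> B)"
        using cm_add_closed[OF Phi_in AB(1), of v w] by simp
      then show ?thesis
        using AB colimit_add[OF Phi_in AB(1), of v w] by (simp add: to_colimit_eq[OF AB(1)] Psi_add[OF Phi_in])
    qed
    show "to_colimit (kE.e c h \<odot>\<^bsub>M\<^esub> v) = kE.e c h \<odot>\<^bsub>Psi (Phi M)\<^esub> to_colimit v" if c: "c \<in> carrier k" and h: "h \<in> carrier EM" for c h
    proof -
      have h: "h \<in> E" using h by simp
      obtain A where A: "A \<in> Fin" "v \<in> fixed M A" using fixed_exists[OF v] .
      let ?hv = "basis_element k h \<odot>\<^bsub>M\<^esub> v"
      note hA = Fin_image[OF A(1), of h]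
      have hv: "?hv \<in> fixed M (h ` A)" by (rule fixed_map[OF h subset_refl A(2)])
      have chv: "kE.e c id \<odot>\<^bsub>M\<^esub> ?hv \<in> fixed M (h ` A)"
        using cm_smult_closed[OF Phi_in hA c, of ?hv] hv by simp
      \<comment> \<open>A monomial acts as a scalar after an element of \<open>E\<close>; the latter
        moves the stage from \<open>A\<close> to its image under \<open>h\<close>.\<close>
      have "kE.e c h \<odot>\<^bsub>M\<^esub> v = kE.e c id \<odot>\<^bsub>M\<^esub> ?hv"
        using kE.basis_smult_commute(2)[OF UC_left_module c, of h v] h v by (simp add: kE.basis_element_eq)
      then have "to_colimit (kE.e c h \<odot>\<^bsub>M\<^esub> v) = germ (Phi M) (h ` A) (kE.e c id \<odot>\<^bsub>M\<^esub> ?hv)"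
        using chv by (simp add: to_colimit_eq[OF hA])
      also have "\<dots> = c \<odot>\<^bsub>colimit (Phi M)\<^esub> germ (Phi M) (h ` A) ?hv"
        using colimit_smult[OF Phi_in c hA, of ?hv] hv by simp
      also have "germ (Phi M) (h ` A) ?hv = act (Phi M) h (germ (Phi M) A v)"
        using act_germ[OF Phi_in A(1) _ h hA subset_refl, of v] A(2) by (simp add: Phi_map[OF h])
      also have "c \<odot>\<^bsub>colimit (Phi M)\<^esub> act (Phi M) h (germ (Phi M) A v) = kE.e c h \<odot>\<^bsub>Psi (Phi M)\<^esub> to_colimit v"
        using A by (simp add: to_colimit_eq[OF A] Psi_basis[OF Phi_in c h] germ_in)
      finally show ?thesis .
    qed
  qed
  moreover have "bij_betw to_colimit (carrier M) (germs (Phi M))"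
    unfolding bij_betw_def
  proof
    show "inj_on to_colimit (carrier M)"
    proof (rule inj_onI)
      fix v w assume v: "v \<in> carrier M" and w: "w \<in> carrier M" and eq: "to_colimit v = to_colimit w"
      obtain A where A: "A \<in> Fin" "v \<in> fixed M A" using fixed_exists[OF v] .
      obtain B where B: "B \<in> Fin" "w \<in> fixed M B" using fixed_exists[OF w] .
      show "v = w" using eq A B by (simp add: to_colimit_eq[OF A] to_colimit_eq[OF B] germ_Phi_eq_iff)
    qed
    have "x \<in> to_colimit ` carrier M" if "x \<in> germs (Phi M)" for x
    proof -
      obtain A v where A: "A \<in> Fin" "v \<in> sec (Phi M) A" "x = germ (Phi M) A v"
        using \<open>x \<in> germs (Phi M)\<close> by (rule germsE)
      then have v: "v \<in> fixed M A" by simp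
      show ?thesis using A(3) to_colimit_eq[OF A(1) v] fixed_carrier[OF v] by (metis imageI)
    qed
    then show "to_colimit ` carrier M = germs (Phi M)" using to_colimit_closed by blast
  qed
  ultimately show ?thesis using is_iso_UC[OF M Psi_in[OF Phi_in]] by simp
qed

end

lemma essentially_surjective_Psi: "essentially_surjective CM UC Psi_functor"
  unfolding essentially_surjective_def Psi_functor_simps using Phi_in is_iso_to_colimit by blast

subsection \<open>Sheaves\<close>

abbreviation "Top \<equiv> inclusion_topology Fin E"
abbreviation "SH \<equiv> Sh (op_cat Cat) Top (constant_sheaf k) ::
  (('w set, 'w \<Rightarrow> 'w, 'k, 'u) module_presheaf, 'w set \<Rightarrow> 'u \<Rightarrow> 'u) cat"

definition is_sheaf :: "('w, 'k, 'u) cmod \<Rightarrow> bool" where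
  "is_sheaf V \<longleftrightarrow> sheaf_condition (op_cat Cat) Top (\<lambda>A. sec V A) (fmap V)"

lemma op_Cat_simps [simp]: "Obj (op_cat Cat) = Fin" "Mor (op_cat Cat) B A = Mor Cat A B"
  "Cmp (op_cat Cat) G B A f g = compose A g f" "Idn (op_cat Cat) A = (\<lambda>x\<in>A. x)"
  by (simp_all add: op_cat_def finset_category_def)

lemma compose_eq_iff: "compose S f g = compose S f' g' \<longleftrightarrow> (\<forall>x\<in>S. f (g x) = f' (g' x))"
  by (auto simp: compose_def fun_eq_iff)

lemma compose_restrict: "h ` A \<subseteq> B \<Longrightarrow> compose A (restrict h' B) (restrict h A) = restrict (h' \<circ> h) A"
  by (auto simp: compose_def fun_eq_iff)

text \<open>C-modules are spelled out in the shape in which sheaves of modules are defined, with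
  morphisms as functions rather than as elements of \<open>E\<close>, so that the comparison of the
  two becomes an unfolding.\<close>

lemma Obj_CM_iff: "V \<in> Obj CM \<longleftrightarrow> (\<forall>A\<in>Fin. module k (fobj V A)) \<and>
    (\<forall>A\<in>Fin. \<forall>B\<in>Fin. \<forall>f\<in>Mor Cat A B. fmap V A B f \<in> linear_maps k (fobj V A) (fobj V B)) \<and>
    (\<forall>A\<in>Fin. \<forall>v\<in>sec V A. fmap V A A (\<lambda>x\<in>A. x) v = v) \<and>
    (\<forall>A\<in>Fin. \<forall>B\<in>Fin. \<forall>D\<in>Fin. \<forall>f\<in>Mor Cat A B. \<forall>g\<in>Mor Cat B D. \<forall>v\<in>sec V A.
      fmap V A D (compose A g f) v = fmap V B D g (fmap V A B f v))" (is "?l \<longleftrightarrow> ?r")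
proof
  assume V: ?l
  then have F: "is_functor Cat (module_category k) V" by (simp add: Obj_CM)
  note F' = is_functorD[OF F]
  have "fmap V A D (compose A g f) v = fmap V B D g (fmap V A B f v)"
    if "A \<in> Fin" "B \<in> Fin" "D \<in> Fin" "f \<in> Mor Cat A B" "g \<in> Mor Cat B D" "v \<in> sec V A" for A B D f g v
    using F'(4)[of A B D f g] that by (simp add: compose_eq)
  then show ?r
    using F'(1-3) by (simp add: left_module_k)
next
  assume r: ?r
  show ?l
  proof (rule C_moduleI)
    fix A B D h h' v assume *: "A \<in> Fin" "B \<in> Fin" "D \<in> Fin" "h \<in> E" "h ` A \<subseteq> B" "h' \<in> E" "h' ` B \<subseteq> D"
      "v \<in> sec V A"
    then have "compose A (restrict h' B) (restrict h A) = restrict (h' \<circ> h) A"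
      by (intro compose_restrict)
    moreover have "restrict h A \<in> Mor Cat A B" "restrict h' B \<in> Mor Cat B D" using * by (auto simp: Mor_Cat)
    ultimately show "tr V B D h' (tr V A B h v) = tr V A D (h' \<circ> h) v"
      using r * by metis
  next
    fix A B h assume *: "A \<in> Fin" "B \<in> Fin" "h \<in> E" "h ` A \<subseteq> B"
    then have "restrict h A \<in> Mor Cat A B" by (auto simp: Mor_Cat)
    then show "tr V A B h \<in> linear_maps k (fobj V A) (fobj V B)" using r * by blast
  qed (use r in \<open>auto simp: restrict_id\<close>)
qed

lemma cm_map_in:
  "V \<in> Obj CM \<Longrightarrow> A \<in> Fin \<Longrightarrow> B \<in> Fin \<Longrightarrow> f \<in> Mor Cat A B \<Longrightarrow> fmap V A B f \<in> linear_maps k (fobj V A) (fobj V B)"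
  unfolding Obj_CM_iff by blast

lemma Obj_SH: "V \<in> Obj SH \<longleftrightarrow> V \<in> Obj CM \<and> is_sheaf V"
  unfolding Obj_CM_iff
  by (simp add: Sh_def sheaf_of_modules_def is_sheaf_def constant_sheaf_def linear_maps_def)

text \<open>The structure sheaf has the same ring everywhere and identity restrictions. A sheaf of
  modules over it is therefore a C-module with the sheaf condition, morphisms are the same, and the
  two categories are equal as records.\<close>

lemma SH_eq: "SH = full_subcategory CM {V. is_sheaf V}"
proof (rule cat.equality)
  show "Obj SH = Obj (full_subcategory CM {V. is_sheaf V})" using Obj_SH by auto
  have "\<eta> \<in> Mor SH V W \<longleftrightarrow> \<eta> \<in> Mor CM V W" for V W \<eta>
    by (simp add: Sh_def sheaf_morphisms_def C_modules_def functor_category_def nat_trans_def constant_sheaf_def compose_eq_iff)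
  then show "Mor SH = Mor (full_subcategory CM {V. is_sheaf V})" by (auto simp: fun_eq_iff)
qed (simp_all add: Sh_def fun_eq_iff)

lemma is_category_SH: "is_category SH"
  unfolding SH_eq by (rule is_category_full_subcategory[OF is_category_CM])

text \<open>The sieve generated by the inclusion of \<open>A\<close> into \<open>B\<close>: the
  morphisms from \<open>A\<close> to \<open>G\<close> that extend to a morphism from
  \<open>B\<close> to \<open>G\<close>. Whenever a sheaf is exploited below, it is through a sieve
  of this form.\<close>

definition gen_sieve :: "'w set \<Rightarrow> 'w set \<Rightarrow> ('w set \<times> ('w \<Rightarrow> 'w)) set" where
  "gen_sieve A B = {(G, restrict h A) | G h. G \<in> Fin \<and> h \<in> E \<and> h ` B \<subseteq> G}"

lemma gen_sieve_in:
  assumes A: "A \<in> Fin" "B \<in> Fin" "A \<subseteq> B"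
  shows "gen_sieve A B \<in> Top A"
proof -
  have "(Z, compose A g f) \<in> gen_sieve A B"
    if Yf: "(Y, f) \<in> gen_sieve A B" and Z: "Z \<in> Fin" "g \<in> Mor Cat Y Z" for Y f Z g
  proof -
    obtain h where h: "f = restrict h A" "h \<in> E" "h ` B \<subseteq> Y" using Yf by (auto simp: gen_sieve_def)
    obtain h' where h': "g = restrict h' Y" "h' \<in> E" "h' ` Y \<subseteq> Z" using Z(2) by (auto simp: Mor_Cat)
    have "compose A g f = restrict (h' \<circ> h) A"
      unfolding h(1) h'(1) by (rule compose_restrict) (use h(3) A(3) in blast)
    moreover have "(h' \<circ> h) ` B \<subseteq> Z" using h h' by auto
    ultimately show ?thesis using Z(1) comp_E[OF h'(2) h(2)] unfolding gen_sieve_def by blast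
  qed
  moreover have "gen_sieve A B \<subseteq> {(Y, f). Y \<in> Fin \<and> f \<in> Mor Cat A Y}"
    using A(3) unfolding gen_sieve_def by (fastforce simp: Mor_Cat)
  ultimately have "sieve (op_cat Cat) A (gen_sieve A B)"
    using A unfolding sieve_def by auto
  moreover have "(B, incl A B) \<in> gen_sieve A B"
    using A id_E unfolding gen_sieve_def incl_eq by (intro CollectI exI[of _ B] exI[of _ id]) auto
  ultimately show ?thesis using A unfolding inclusion_topology_def by blast
qed

lemma is_sheafD:
  assumes "is_sheaf V" "A \<in> Fin" "S \<in> Top A"
    and "\<And>Y f. (Y, f) \<in> S \<Longrightarrow> x (Y, f) \<in> sec V Y"
    and "\<And>Y f Z g. (Y, f) \<in> S \<Longrightarrow> Z \<in> Fin \<Longrightarrow> g \<in> Mor Cat Y Z \<Longrightarrow> fmap V Y Z g (x (Y, f)) = x (Z, compose A g f)"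
  shows "\<exists>!s. s \<in> sec V A \<and> (\<forall>(Y, f)\<in>S. fmap V A Y f s = x (Y, f))"
proof -
  have "matching_family (op_cat Cat) (\<lambda>A. sec V A) (fmap V) A S x"
    unfolding matching_family_def using assms(4,5) by auto
  then show ?thesis using assms(1-3) unfolding is_sheaf_def sheaf_condition_def by simp
qed

text \<open>Sheaves are separated: sections that agree at \<open>B\<close> agree along every member
  of the sieve generated by the inclusion of \<open>A\<close> into \<open>B\<close>, so they glue
  the same family.\<close>

lemma germ_inj_sheaf:
  assumes V: "V \<in> Obj CM" and sh: "is_sheaf V" and A: "A \<in> Fin" "v \<in> sec V A" "w \<in> sec V A"
    and eq: "germ V A v = germ V A w"
  shows "v = w"
proof -
  obtain B where B: "B \<in> Fin" "A \<subseteq> B" "tr V A B id v = tr V A B id w"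
    using eq germ_eq_iff[OF V A(1,2) A(1,3)] by blast
  have agree: "fmap V A Y f v = fmap V A Y f w" if Yf: "(Y, f) \<in> gen_sieve A B" for Y f
  proof -
    obtain h where h: "Y \<in> Fin" "f = restrict h A" "h \<in> E" "h ` B \<subseteq> Y" using Yf by (auto simp: gen_sieve_def)
    have "tr V A Y h u = tr V B Y h (tr V A B id u)"
      if "u \<in> sec V A" for u
      using cm_comp[OF V A(1) B(1) h(1) id_E _ h(3,4) that] B(2) by simp
    then show ?thesis using A(2,3) B(3) by (simp add: h(2))
  qed
  define P where "P s \<longleftrightarrow> s \<in> sec V A \<and>
    (\<forall>(Y, f)\<in>gen_sieve A B. fmap V A Y f s = (\<lambda>(Y, f). fmap V A Y f v) (Y, f))" for s
  have "\<exists>!s. s \<in> sec V A \<and> (\<forall>(Y, f)\<in>gen_sieve A B. fmap V A Y f s = (\<lambda>(Y, f). fmap V A Y f v) (Y, f))"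
  proof (rule is_sheafD[OF sh A(1) gen_sieve_in[OF A(1) B(1,2)]])
    fix Y f assume Yf: "(Y, f) \<in> gen_sieve A B"
    then have f: "Y \<in> Fin" "f \<in> Mor Cat A Y"
      using B(2) unfolding gen_sieve_def by (fastforce simp: Mor_Cat)+
    show "(case (Y, f) of (Y, f) \<Rightarrow> fmap V A Y f v) \<in> sec V Y"
      using linear_maps_closed[OF cm_map_in[OF V A(1) f] A(2)] by simp
    show "fmap V Y Z g (case (Y, f) of (Y, f) \<Rightarrow> fmap V A Y f v) = (case (Z, compose A g f) of (Y, f) \<Rightarrow> fmap V A Y f v)"
      if "Z \<in> Fin" "g \<in> Mor Cat Y Z" for Z g
      using V A(1,2) f that unfolding Obj_CM_iff by simp
  qed
  then have "\<exists>!s. P s" unfolding P_def .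
  moreover have "P v" "P w" unfolding P_def using A(2,3) agree by auto
  ultimately show ?thesis unfolding Ex1_def by metis
qed

text \<open>The class \<open>x\<close> is represented by some \<open>w\<close> at a stage
  \<open>B\<close> containing \<open>A\<close>. Applying extensions of morphisms to \<open>w\<close>
  gives a family on the sieve generated by the inclusion. The invariance of \<open>x\<close> makes
  this family matching, and its gluing is the section sought.\<close>

lemma germ_surj_sheaf:
  assumes V: "V \<in> Obj CM" and sh: "is_sheaf V" and A: "A \<in> Fin" and x: "x \<in> germs V"
    and inv: "\<And>h h'. h \<in> E \<Longrightarrow> h' \<in> E \<Longrightarrow> restrict h A = restrict h' A \<Longrightarrow> act V h x = act V h' x"
  obtains v where "v \<in> sec V A" "germ V A v = x"
proof -
  obtain B0 where B0: "B0 \<in> Fin" "\<forall>B\<in>Fin. B0 \<subseteq> B \<longrightarrow> (\<exists>v\<in>sec V B. x = germ V B v)"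
    by (rule germs_from[OF V x])
  define B where "B = A \<union> B0"
  have B: "B \<in> Fin" "A \<subseteq> B" using Fin_Un[OF A B0(1)] by (auto simp: B_def)
  obtain w where w: "w \<in> sec V B" "x = germ V B w" using B0 B by (auto simp: B_def)
  \<comment> \<open>A member of the sieve is only a function on \<open>A\<close>;
    \<open>c G f\<close> chooses an extension that maps \<open>B\<close> into \<open>G\<close>. By
    \<open>inv\<close> the class of the resulting value does not depend on the choice.\<close>
  define c where "c G f = (SOME h. h \<in> E \<and> h ` B \<subseteq> G \<and> restrict h A = f)" for G f
  have c: "c G f \<in> E \<and> c G f ` B \<subseteq> G \<and> restrict (c G f) A = f" if Gf: "(G, f) \<in> gen_sieve A B" for G f
  proof -
    obtain h where "h \<in> E \<and> h ` B \<subseteq> G \<and> restrict h A = f" using Gf by (auto simp: gen_sieve_def)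
    then show ?thesis unfolding c_def by (rule someI[where P = "\<lambda>h. h \<in> E \<and> h ` B \<subseteq> G \<and> restrict h A = f"])
  qed
  define y where "y = (\<lambda>(G, f). tr V B G (c G f) w)"
  have gG: "G \<in> Fin" if "(G, f) \<in> gen_sieve A B" for G f using that by (auto simp: gen_sieve_def)
  have y_in: "y (G, f) \<in> sec V G" if "(G, f) \<in> gen_sieve A B" for G f
    using cm_closed[OF V B(1) gG[OF that], of "c G f" w] c[OF that] w(1) by (simp add: y_def)
  have y_germ: "germ V G (y (G, f)) = act V h x" if Gf: "(G, f) \<in> gen_sieve A B" and h: "h \<in> E" "restrict h A = f" for G f h
  proof -
    have "germ V G (y (G, f)) = act V (c G f) x"
      using act_germ[OF V B(1) w(1) _ gG[OF Gf], of "c G f"] c[OF Gf] by (simp add: y_def w(2))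
    also have "\<dots> = act V h x" using c[OF Gf] h by (intro inv) auto
    finally show ?thesis .
  qed
  note top = gen_sieve_in[OF A B]
  then have sv: "sieve (op_cat Cat) A (gen_sieve A B)" by (simp add: inclusion_topology_def)
  have "\<exists>!s. s \<in> sec V A \<and> (\<forall>(Y, f)\<in>gen_sieve A B. fmap V A Y f s = y (Y, f))"
  proof (rule is_sheafD[OF sh A top y_in])
    fix Y f Z g assume Yf: "(Y, f) \<in> gen_sieve A B" and Z: "Z \<in> Fin" and g: "g \<in> Mor Cat Y Z"
    have Zg: "(Z, compose A g f) \<in> gen_sieve A B"
      using sv Yf Z g unfolding sieve_def by fastforce
    obtain h' where h': "g = restrict h' Y" "h' \<in> E" "h' ` Y \<subseteq> Z" using g by (auto simp: Mor_Cat)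
    obtain h where h: "f = restrict h A" "h \<in> E" "h ` B \<subseteq> Y" using Yf by (auto simp: gen_sieve_def)
    \<comment> \<open>Sections of a sheaf are determined by their classes, so the matching condition
      can be checked in the colimit, where composition in \<open>E\<close> is available.\<close>
    have "germ V Z (fmap V Y Z g (y (Y, f))) = act V h' (germ V Y (y (Y, f)))"
      using act_germ[OF V gG[OF Yf] y_in[OF Yf] h'(2) Z h'(3)] by (simp add: h'(1))
    also have "\<dots> = act V (h' \<circ> h) x" using y_germ[OF Yf h(2)] h(1) act_comp[OF V h'(2) h(2) x] by simp
    also have "\<dots> = germ V Z (y (Z, compose A g f))"
    proof (rule y_germ[OF Zg, symmetric])
      show "h' \<circ> h \<in> E" by (rule comp_E[OF h'(2) h(2)])
      have "h ` A \<subseteq> Y" using h(3) B(2) by blast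
      then show "restrict (h' \<circ> h) A = compose A g f" by (simp add: h(1) h'(1) compose_restrict)
    qed
    finally have eq: "germ V Z (fmap V Y Z g (y (Y, f))) = germ V Z (y (Z, compose A g f))" .
    have "fmap V Y Z g (y (Y, f)) \<in> sec V Z"
      unfolding h'(1) by (rule cm_closed[OF V gG[OF Yf] Z h'(2,3) y_in[OF Yf]])
    then show "fmap V Y Z g (y (Y, f)) = y (Z, compose A g f)"
      by (rule germ_inj_sheaf[OF V sh Z _ y_in[OF Zg] eq])
  qed
  then obtain s where s: "s \<in> sec V A" "\<forall>(Y, f)\<in>gen_sieve A B. fmap V A Y f s = y (Y, f)" by blast
  have BA: "(B, restrict id A) \<in> gen_sieve A B"
    using B id_E unfolding gen_sieve_def by (intro CollectI exI[of _ B] exI[of _ id]) auto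
  have "germ V A s = germ V B (tr V A B id s)" using germ_incl[OF V A B s(1)] by simp
  also have "\<dots> = germ V B (y (B, restrict id A))" using s(2) BA by auto
  also have "\<dots> = act V id x" by (rule y_germ[OF BA id_E refl])
  also have "\<dots> = x" by (rule act_id[OF V x])
  finally show thesis using that s(1) by blast
qed

text \<open>A covering sieve contains the inclusion into some \<open>B\<close>. Inclusions act as
  the identity on elements of \<open>M\<close>, so the component of the family there is the only
  candidate for the gluing. It remains to see that it is fixed already over the smaller set
  \<open>A\<close> and that it restricts to every component.\<close>

lemma is_sheaf_Phi:
  assumes M: "M \<in> Obj UC"
  shows "is_sheaf (Phi M)"
  unfolding is_sheaf_def sheaf_condition_def op_Cat_simps Phi_simps
proof (intro ballI allI impI)
  fix A S x assume A: "A \<in> Fin" and S: "S \<in> Top A"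
    and mf: "matching_family (op_cat Cat) (fixed M) (fmap (Phi M)) A S x"
  have sv: "\<And>Y f. (Y, f) \<in> S \<Longrightarrow> Y \<in> Fin \<and> f \<in> Mor Cat A Y"
    "\<And>Y f Z g. (Y, f) \<in> S \<Longrightarrow> Z \<in> Fin \<Longrightarrow> g \<in> Mor Cat Y Z \<Longrightarrow> (Z, compose A g f) \<in> S"
    using S unfolding inclusion_topology_def sieve_def by fastforce+
  obtain B where B: "B \<in> Fin" "A \<subseteq> B" "(B, restrict id A) \<in> S"
    using S by (auto simp: inclusion_topology_def incl_eq)
  have x_in: "x (Y, f) \<in> fixed M Y" if "(Y, f) \<in> S" for Y f
    using mf that unfolding matching_family_def by auto
  have x_map: "basis_element k h \<odot>\<^bsub>M\<^esub> x (Y, f) = x (Z, compose A (restrict h Y) f)"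
    if "(Y, f) \<in> S" "Z \<in> Fin" "h \<in> E" "h ` Y \<subseteq> Z" for Y f Z h
  proof -
    have "restrict h Y \<in> Mor Cat Y Z" using that by (auto simp: Mor_Cat)
    then have "tr (Phi M) Y Z h (x (Y, f)) = x (Z, compose A (restrict h Y) f)"
      using mf that unfolding matching_family_def by fastforce
    then show ?thesis using Phi_map[OF M that(3) x_in[OF that(1)]] by simp
  qed
  let ?y = "x (B, restrict id A)"
  have comp_B: "compose A (restrict h B) (restrict id A) = restrict h A" for h :: "'w \<Rightarrow> 'w"
    using B(2) by (auto simp: compose_def fun_eq_iff)
  have y: "?y \<in> fixed M B" by (rule x_in[OF B(3)])
  have y_map: "basis_element k h \<odot>\<^bsub>M\<^esub> ?y = x (Z, restrict h A)" if "Z \<in> Fin" "h \<in> E" "h ` B \<subseteq> Z" for h Z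
    using x_map[OF B(3) that] comp_B by simp
  have yA: "?y \<in> fixed M A"
  proof (rule fixedI[OF M fixed_carrier[OF M y]])
    fix h h' assume h: "h \<in> E" "h' \<in> E" "restrict h A = restrict h' A"
    \<comment> \<open>Over one codomain that receives \<open>B\<close> under both maps, the two
      values are the same component of the family, namely the one at the common restriction to
      \<open>A\<close>.\<close>
    have Z: "h ` B \<union> h' ` B \<in> Fin" by (intro Fin_Un Fin_image B)
    show "basis_element k h \<odot>\<^bsub>M\<^esub> ?y = basis_element k h' \<odot>\<^bsub>M\<^esub> ?y"
      using y_map[OF Z h(1)] y_map[OF Z h(2)] h(3) by simp
  qed
  have "fmap (Phi M) A Y f ?y = x (Y, f)" if Yf: "(Y, f) \<in> S" for Y f
  proof -
    obtain h where h: "h \<in> E" "f = restrict h A" "h ` A \<subseteq> Y" using sv(1)[OF Yf] by (auto simp: Mor_Cat)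
    have Y: "Y \<in> Fin" using sv(1)[OF Yf] by blast
    \<comment> \<open>\<open>f\<close> maps \<open>A\<close> into \<open>Y\<close>, but its
      extension \<open>h\<close> need not map \<open>B\<close> there; the comparison takes place in
      a codomain large enough for both.\<close>
    let ?Z = "Y \<union> h ` B"
    have Z: "?Z \<in> Fin" by (intro Fin_Un Fin_image B Y)
    have "compose A (restrict id Y) f = f" using h by (auto simp: compose_def fun_eq_iff)
    then have "basis_element k id \<odot>\<^bsub>M\<^esub> x (Y, f) = x (?Z, f)" using x_map[OF Yf Z id_E] by simp
    moreover have "basis_element k h \<odot>\<^bsub>M\<^esub> ?y = x (?Z, f)" using y_map[OF Z h(1)] h(2) by simp
    ultimately show ?thesis
      using lact_id[OF M fixed_carrier[OF M x_in[OF Yf]]] Phi_map[OF M h(1) yA] h(2) by simp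
  qed
  moreover have "s = ?y" if s: "s \<in> fixed M A" "\<forall>(Y, f)\<in>S. fmap (Phi M) A Y f s = x (Y, f)" for s
  proof -
    have "tr (Phi M) A B id s = ?y" using s(2) B(3) by auto
    then show ?thesis using Phi_map[OF M id_E s(1)] lact_id[OF M fixed_carrier[OF M s(1)]] by simp
  qed
  ultimately show "\<exists>!s. s \<in> fixed M A \<and> (\<forall>(Y, f)\<in>S. fmap (Phi M) A Y f s = x (Y, f))"
    using yA by (intro ex1I[of _ ?y]) auto
qed

text \<open>The action on the class of \<open>v\<close> depends only on restrictions to
  \<open>A\<close>, and \<open>\<phi>\<close> preserves this property. Since \<open>W\<close> is a
  sheaf, the image class therefore comes from a section at \<open>A\<close>. This section is unique,
  which yields linearity and naturality.\<close>

lemma Psi_full_sheaf: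
  assumes V: "V \<in> Obj CM" and W: "W \<in> Obj CM" and sh: "is_sheaf W" and \<phi>: "\<phi> \<in> Mor UC (Psi V) (Psi W)"
  shows "\<exists>\<eta>\<in>Mor CM V W. Psi_map V W \<eta> = \<phi>"
proof -
  note closed = Mor_Psi_closed[OF V W \<phi>] and add = Mor_Psi_add[OF V W \<phi>] and smult = Mor_Psi_smult[OF V W \<phi>]
    and act = Mor_Psi_act[OF V W \<phi>]
  note inj = germ_inj_sheaf[OF W sh]
  have "\<exists>w. w \<in> sec W A \<and> germ W A w = \<phi> (germ V A v)" if A: "A \<in> Fin" "v \<in> sec V A" for A v
  proof -
    have "act W h (\<phi> (germ V A v)) = act W h' (\<phi> (germ V A v))" if "h \<in> E" "h' \<in> E" "restrict h A = restrict h' A" for h h'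
      using act_cong[OF V A that] act[OF that(1) germ_in[OF A]] act[OF that(2) germ_in[OF A]] by simp
    then obtain w where "w \<in> sec W A" "germ W A w = \<phi> (germ V A v)"
      by (rule germ_surj_sheaf[OF W sh A(1) closed[OF germ_in[OF A]]])
    then show ?thesis by blast
  qed
  then obtain e where e: "\<And>A v. A \<in> Fin \<Longrightarrow> v \<in> sec V A \<Longrightarrow> e A v \<in> sec W A"
    and ge: "\<And>A v. A \<in> Fin \<Longrightarrow> v \<in> sec V A \<Longrightarrow> germ W A (e A v) = \<phi> (germ V A v)"
    by metis
  let ?\<eta> = "\<lambda>A\<in>Fin. \<lambda>v\<in>sec V A. e A v"
  have \<eta>: "?\<eta> \<in> Mor CM V W"
  proof (rule Mor_CMI)
    fix A assume A: "A \<in> Fin"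
    show "?\<eta> A \<in> linear_maps k (fobj V A) (fobj W A)"
    proof (rule linear_mapsI)
      fix v assume v: "v \<in> sec V A"
      show "?\<eta> A (v \<oplus>\<^bsub>fobj V A\<^esub> w) = ?\<eta> A v \<oplus>\<^bsub>fobj W A\<^esub> ?\<eta> A w" if w: "w \<in> sec V A" for w
      proof -
        have "germ W A (e A (v \<oplus>\<^bsub>fobj V A\<^esub> w)) = germ W A (e A v \<oplus>\<^bsub>fobj W A\<^esub> e A w)"
          using A v w by (simp add: ge cm_add_closed[OF V] colimit_add[OF W, symmetric] colimit_add[OF V, symmetric] e add germ_in)
        then have "e A (v \<oplus>\<^bsub>fobj V A\<^esub> w) = e A v \<oplus>\<^bsub>fobj W A\<^esub> e A w"
          by (rule inj[OF A, rotated -1]) (use A v w in \<open>auto intro: e cm_add_closed[OF V] cm_add_closed[OF W]\<close>)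
        then show ?thesis using A v w by (simp add: cm_add_closed[OF V])
      qed
      show "?\<eta> A (c \<odot>\<^bsub>fobj V A\<^esub> v) = c \<odot>\<^bsub>fobj W A\<^esub> ?\<eta> A v" if c: "c \<in> carrier k" for c
      proof -
        have "germ W A (e A (c \<odot>\<^bsub>fobj V A\<^esub> v)) = germ W A (c \<odot>\<^bsub>fobj W A\<^esub> e A v)"
          using A v c by (simp add: ge cm_smult_closed[OF V] colimit_smult[OF W, symmetric] colimit_smult[OF V, symmetric] e smult germ_in)
        then have "e A (c \<odot>\<^bsub>fobj V A\<^esub> v) = c \<odot>\<^bsub>fobj W A\<^esub> e A v"
          by (rule inj[OF A, rotated -1]) (use A v c in \<open>auto intro: e cm_smult_closed[OF V] cm_smult_closed[OF W]\<close>)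
        then show ?thesis using A v c by (simp add: cm_smult_closed[OF V])
      qed
    qed (auto simp: A e)
  next
    fix A B h v assume *: "A \<in> Fin" "B \<in> Fin" "h \<in> E" "h ` A \<subseteq> B" "v \<in> sec V A"
    note hv = cm_closed[OF V *]
    have "germ W B (e B (tr V A B h v)) = germ W B (tr W A B h (e A v))"
      using * hv act[OF *(3) germ_in[OF *(1,5)]] act_germ[OF V *(1,5,3,2,4)] act_germ[OF W *(1) e[OF *(1,5)] *(3,2,4)]
      by (simp add: ge)
    then have "e B (tr V A B h v) = tr W A B h (e A v)"
      by (rule inj[OF *(2), rotated -1]) (use * hv in \<open>auto intro: e cm_closed[OF W]\<close>)
    then show "?\<eta> B (tr V A B h v) = tr W A B h (?\<eta> A v)"
      using * hv by simp
  qed simp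
  moreover have "Psi_map V W ?\<eta> = \<phi>"
  proof (rule germs_extensionalityI[of _ V])
    show "\<phi> \<in> extensional (germs V)" using linear_maps_extensional[of \<phi> kE.RG "Psi V" "Psi W"] \<phi> by (simp add: Mor_UC)
    show "Psi_map V W ?\<eta> (germ V A v) = \<phi> (germ V A v)" if "A \<in> Fin" "v \<in> sec V A" for A v
      using Psi_map_germ[OF V W \<eta> that] that by (simp add: ge)
  qed (simp add: Psi_map_def)
  ultimately show ?thesis by blast
qed

text \<open>Faithfulness is the separatedness of the target, and fullness is
  \<open>Psi_full_sheaf\<close>.\<close>

lemma fully_faithful_Psi: "fully_faithful SH UC Psi_functor"
  unfolding fully_faithful_def Psi_functor_simps
proof (intro conjI ballI)
  show "is_functor SH UC Psi_functor"
    unfolding SH_eq by (rule is_functor_full_subcategory[OF is_functor_Psi])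
  fix V W assume "V \<in> Obj SH" "W \<in> Obj SH"
  then have V: "V \<in> Obj CM" and W: "W \<in> Obj CM" and sh: "is_sheaf W" by (auto simp: Obj_SH)
  have "inj_on (Psi_map V W) (Mor CM V W)"
  proof (rule inj_onI)
    fix \<eta> \<theta> assume *: "\<eta> \<in> Mor CM V W" "\<theta> \<in> Mor CM V W" "Psi_map V W \<eta> = Psi_map V W \<theta>"
    show "\<eta> = \<theta>"
    proof (rule Mor_CM_eqI[OF *(1,2)])
      fix A v assume A: "A \<in> Fin" "v \<in> sec V A"
      have "germ W A (\<eta> A v) = germ W A (\<theta> A v)"
        using Psi_map_germ[OF V W *(1) A] Psi_map_germ[OF V W *(2) A] *(3) by simp
      then show "\<eta> A v = \<theta> A v"
        by (rule germ_inj_sheaf[OF W sh A(1) mor_closed[OF *(1) A] mor_closed[OF *(2) A]])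
    qed
  qed
  then show "bij_betw (Psi_map V W) (Mor SH V W) (Mor UC (Psi V) (Psi W))"
    using Psi_map_in[OF V W] Psi_full_sheaf[OF V W sh] unfolding SH_eq full_subcategory_simps bij_betw_def by blast
qed

text \<open>The preimage \<open>Phi M\<close> found among C-modules is already a sheaf.\<close>

lemma essentially_surjective_Psi_sheaf: "essentially_surjective SH UC Psi_functor"
  unfolding essentially_surjective_def Psi_functor_simps using Phi_in is_iso_to_colimit is_sheaf_Phi Obj_SH by blast

subsection \<open>Retractions\<close>

lemma inclusion_topology_trivial:
  assumes retr: "\<And>A B. A \<in> Fin \<Longrightarrow> B \<in> Fin \<Longrightarrow> A \<subseteq> B \<Longrightarrow> \<exists>p\<in>Mor Cat B A. compose A p (incl A B) = (\<lambda>x\<in>A. x)"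
  shows "Top = trivial_topology (op_cat Cat)"
proof
  fix A
  have top: "grothendieck_topology (op_cat Cat) Top"
    by (rule grothendieck_topology_inclusion[OF E finite_Fin Fin_up])
  have "S = maximal_sieve (op_cat Cat) A" if S: "S \<in> Top A" and A: "A \<in> Fin" for S
  proof -
    have sv: "S \<subseteq> maximal_sieve (op_cat Cat) A"
      "\<And>Y f Z g. (Y, f) \<in> S \<Longrightarrow> Z \<in> Fin \<Longrightarrow> g \<in> Mor Cat Y Z \<Longrightarrow> (Z, compose A g f) \<in> S"
      using S unfolding inclusion_topology_def sieve_def maximal_sieve_def by fastforce+
    obtain B where B: "B \<in> Fin" "A \<subseteq> B" "(B, incl A B) \<in> S" using S by (auto simp: inclusion_topology_def)
    obtain p where p: "p \<in> Mor Cat B A" "compose A p (incl A B) = (\<lambda>x\<in>A. x)" using retr[OF A B(1,2)] by blast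
    have id: "(A, \<lambda>x\<in>A. x) \<in> S" using sv(2)[OF B(3) A p(1)] p(2) by simp
    have "(Y, f) \<in> S" if "Y \<in> Fin" "f \<in> Mor Cat A Y" for Y f
    proof -
      have "compose A f (\<lambda>x\<in>A. x) = f"
        using Cmp_Idn[OF is_category_Cat, of A Y f] that A by simp
      then show ?thesis using sv(2)[OF id that] by simp
    qed
    then show ?thesis using sv(1) by (auto simp: maximal_sieve_def)
  qed
  moreover have "maximal_sieve (op_cat Cat) A \<in> Top A" if "A \<in> Fin"
    using top that unfolding grothendieck_topology_def by simp
  moreover have "Top A = {}" if "A \<notin> Fin"
    using that unfolding inclusion_topology_def sieve_def by simp
  ultimately show "Top A = trivial_topology (op_cat Cat) A"
    unfolding trivial_topology_def by auto
qed

text \<open>On a maximal sieve a matching family is determined by its component at the identity,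
  which is its unique gluing. Hence every C-module is a sheaf for the trivial topology.\<close>

lemma SH_eq_CM:
  assumes triv: "Top = trivial_topology (op_cat Cat)"
  shows "SH = CM"
proof -
  have "is_sheaf V" if V: "V \<in> Obj CM" for V
    unfolding is_sheaf_def sheaf_condition_def op_Cat_simps
  proof (intro ballI allI impI)
    fix A S x assume A: "A \<in> Fin" and "S \<in> Top A"
      and mf: "matching_family (op_cat Cat) (\<lambda>A. sec V A) (fmap V) A S x"
    then have S: "S = maximal_sieve (op_cat Cat) A" by (simp add: triv trivial_topology_def)
    have id: "(\<lambda>x\<in>A. x) \<in> Mor Cat A A" using Idn_in[OF is_category_Cat] A by simp
    have AS: "(A, \<lambda>x\<in>A. x) \<in> S" using A id by (simp add: S maximal_sieve_def)
    let ?s = "x (A, \<lambda>x\<in>A. x)"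
    have s: "?s \<in> sec V A" using mf AS unfolding matching_family_def by auto
    have "fmap V A Y f ?s = x (Y, f)" if Yf: "(Y, f) \<in> S" for Y f
    proof -
      have f: "Y \<in> Fin" "f \<in> Mor Cat A Y" using Yf by (auto simp: S maximal_sieve_def)
      have "compose A f (\<lambda>x\<in>A. x) = f" using Cmp_Idn[OF is_category_Cat, of A Y f] f A by simp
      moreover have "fmap V A Y f ?s = x (Y, compose A f (\<lambda>x\<in>A. x))"
        using mf AS f unfolding matching_family_def by fastforce
      ultimately show ?thesis by simp
    qed
    moreover have "t = ?s" if t: "t \<in> sec V A" "\<forall>(Y, f)\<in>S. fmap V A Y f t = x (Y, f)" for t
      using t(2) AS cm_id[OF V A t(1)] by (auto simp: restrict_id)
    ultimately show "\<exists>!s. s \<in> sec V A \<and> (\<forall>(Y, f)\<in>S. fmap V A Y f s = x (Y, f))"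
      using s by (intro ex1I[of _ ?s]) auto
  qed
  then have "Obj CM \<inter> {V. is_sheaf V} = Obj CM" by blast
  then show ?thesis unfolding SH_eq full_subcategory_def by simp
qed

text \<open>All three are cospans over the uniformly continuous modules, formed from two of the
  localization functor, \<open>Psi\<close> on sheaves, and the identity.\<close>

lemma equivalences:
  "UC \<simeq>\<^sub>c\<^sub>a\<^sub>t serre_quotient CM Tor" "serre_quotient CM Tor \<simeq>\<^sub>c\<^sub>a\<^sub>t SH" "SH \<simeq>\<^sub>c\<^sub>a\<^sub>t UC"
proof -
  interpret right_fractions CM UC Psi_functor "iso_modulo CM Tor" by (rule right_fractions_Psi)
  note L = is_category_localization fully_faithful_localization_functor
    essentially_surjective_localization_functor[OF essentially_surjective_Psi]
  note U = fully_faithful_id essentially_surjective_id[OF is_category_UC]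
  note S = fully_faithful_Psi essentially_surjective_Psi_sheaf
  show "UC \<simeq>\<^sub>c\<^sub>a\<^sub>t serre_quotient CM Tor"
    unfolding serre_quotient_def by (rule equivalent_categories_cospan[OF is_category_UC L(1) is_category_UC U L(2,3)])
  show "serre_quotient CM Tor \<simeq>\<^sub>c\<^sub>a\<^sub>t SH"
    unfolding serre_quotient_def by (rule equivalent_categories_cospan[OF L(1) is_category_SH is_category_UC L(2,3) S])
  show "SH \<simeq>\<^sub>c\<^sub>a\<^sub>t UC"
    by (rule equivalent_categories_cospan[OF is_category_SH is_category_UC is_category_UC S U])
qed

end

text \<open>An infinite set is equipotent with the set of its finite subsets, so \<open>Fin\<close>
  embeds into \<open>'w\<close> and hence into \<open>'u\<close>. The universe is itself infinite,
  so its square embeds into it. A point of a stage is then coded by pairing the code of the stage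
  with the element.\<close>

lemma obtain_encodings:
  assumes w: "infinite (UNIV :: 'w set)" and wu: "(UNIV :: 'w set) \<lesssim> (UNIV :: 'u set)"
    and fin: "\<And>A. A \<in> Fin \<Longrightarrow> finite A"
  obtains enc :: "'w set \<times> 'u \<Rightarrow> 'u" and pair :: "'u \<times> 'u \<Rightarrow> 'u"
  where "inj_on enc (Fin \<times> UNIV)" "inj pair"
proof -
  have u: "infinite (UNIV :: 'u set)" using w wu by (meson infinite_le_lepoll lepoll_trans)
  have "|(UNIV :: 'u set) \<times> (UNIV :: 'u set)| \<le>o |UNIV :: 'u set|"
    using card_of_Times_same_infinite[OF u] by (rule ordIso_imp_ordLeq)
  then obtain pair :: "'u \<times> 'u \<Rightarrow> 'u" where pair: "inj pair"
    unfolding card_of_ordLeq[symmetric] by (auto simp: UNIV_Times_UNIV)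
  have "Fin \<subseteq> Fpow (UNIV :: 'w set)" using fin by (auto simp: Fpow_def)
  then have "Fin \<lesssim> (UNIV :: 'u set)"
    by (meson subset_imp_lepoll lepoll_trans lepoll_trans2 eqpoll_Fpow[OF w] wu)
  then obtain j :: "'w set \<Rightarrow> 'u" where j: "inj_on j Fin" unfolding lepoll_def by blast
  have "inj_on (\<lambda>(A, v). pair (j A, v)) (Fin \<times> UNIV)"
    using j inj_eq[OF pair] by (auto simp: inj_on_def)
  then show thesis using that pair by blast
qed

theorem theorem1p10:
  fixes k :: "'k ring" and E :: "('w \<Rightarrow> 'w) set" and Fin :: "'w set set"
  assumes "cring k"
    and "infinite (UNIV :: 'w set)"
    and "submonoid E full_transformation_monoid"
    and "Fin = {A. finite A} \<or> Fin = {A. finite A \<and> A \<noteq> {}}"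
    and "(UNIV :: 'w set) \<lesssim> (UNIV :: 'u set)"
  shows
    "(uc_modules k E :: ((('w \<Rightarrow> 'w) \<Rightarrow> 'k, 'u) module, 'u \<Rightarrow> 'u) cat)
       \<simeq>\<^sub>c\<^sub>a\<^sub>t serre_quotient (C_modules k Fin E)
                 (torsion_modules k Fin E :: ('w, 'k, 'u) cmod set) \<and>
     serre_quotient (C_modules k Fin E) (torsion_modules k Fin E :: ('w, 'k, 'u) cmod set)
       \<simeq>\<^sub>c\<^sub>a\<^sub>t (Sh (op_cat (finset_category Fin E)) (inclusion_topology Fin E) (constant_sheaf k)
               :: (('w set, 'w \<Rightarrow> 'w, 'k, 'u) module_presheaf, 'w set \<Rightarrow> 'u \<Rightarrow> 'u) cat) \<and>
     ((\<forall>A\<in>Fin. \<forall>B\<in>Fin. A \<subseteq> B \<longrightarrow>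
         (\<exists>p\<in>Mor (finset_category Fin E) B A. p ` B = A \<and>
            Cmp (finset_category Fin E) A B A p (incl A B) = Idn (finset_category Fin E) A)) \<longrightarrow>
      inclusion_topology Fin E = trivial_topology (op_cat (finset_category Fin E)) \<and>
      (C_modules k Fin E :: (('w, 'k, 'u) cmod, 'w set \<Rightarrow> 'u \<Rightarrow> 'u) cat)
        \<simeq>\<^sub>c\<^sub>a\<^sub>t (uc_modules k E :: ((('w \<Rightarrow> 'w) \<Rightarrow> 'k, 'u) module, 'u \<Rightarrow> 'u) cat))"
proof -
  have fin: "\<And>A. A \<in> Fin \<Longrightarrow> finite A" using assms(4) by auto
  obtain enc :: "'w set \<times> 'u \<Rightarrow> 'u" and pair :: "'u \<times> 'u \<Rightarrow> 'u"
    where enc: "inj_on enc (Fin \<times> UNIV)" and pair: "inj pair"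
    by (rule obtain_encodings[OF assms(2,5) fin])
  interpret finset_modules k E Fin enc pair
  proof (rule finset_modules.intro[OF assms(1,3) fin _ _ _ enc pair])
    show "\<And>A B. A \<in> Fin \<Longrightarrow> A \<subseteq> B \<Longrightarrow> finite B \<Longrightarrow> B \<in> Fin" using assms(4) by auto
    show "\<And>A h. A \<in> Fin \<Longrightarrow> h ` A \<in> Fin" using assms(4) by auto
    \<comment> \<open>A singleton belongs to \<open>Fin\<close> under both conventions.\<close>
    have "{undefined} \<in> Fin" using assms(4) by auto
    then show "Fin \<noteq> {}" by blast
  qed
  note eqv = equivalences
  show ?thesis
  proof (intro conjI impI)
    assume *: "\<forall>A\<in>Fin. \<forall>B\<in>Fin. A \<subseteq> B \<longrightarrow> (\<exists>p\<in>Mor Cat B A. p ` B = A \<and> Cmp Cat A B A p (incl A B) = Idn Cat A)"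
    show triv: "Top = trivial_topology (op_cat Cat)"
    proof (rule inclusion_topology_trivial)
      fix A B assume "A \<in> Fin" "B \<in> Fin" "A \<subseteq> B"
      then obtain p where "p \<in> Mor Cat B A" "Cmp Cat A B A p (incl A B) = Idn Cat A" using * by blast
      then show "\<exists>p\<in>Mor Cat B A. compose A p (incl A B) = (\<lambda>x\<in>A. x)" by auto
    qed
    \<comment> \<open>For the trivial topology the category of sheaves is the category of C-modules
      itself, so the third equivalence specialises to the claim.\<close>
    show "CM \<simeq>\<^sub>c\<^sub>a\<^sub>t UC" using eqv(3) unfolding SH_eq_CM[OF triv] .
  qed (fact eqv(1), fact eqv(2))
qed

end
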